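(* Let $f\colon(\mathbb{C}^n,0)\to(\mathbb{C}^{n+1},0)$ be a finite and generically one-to-one holomorphic map-germ (of any corank). Suppose that $$0\rightarrow\mathcal{O}_{\mathbb{C}^{n+1},0}^{r+1}\xrightarrow{\Lambda}\mathcal{O}_{\mathbb{C}^{n+1},0}^{r+1}\xrightarrow{G}\mathcal{O}_{\mathbb{C}^n,0}\rightarrow0$$ is an exact sequence of $\mathcal{O}_{\mathbb{C}^{n+1},0}$-modules (a presentation of $\mathcal{O}_{\mathbb{C}^n,0}$ over $\mathcal{O}_{\mathbb{C}^{n+1},0}$ via $f$) in which $\Lambda$ is symmetric and $G=\begin{bmatrix}1&g_1&\cdots&g_r\end{bmatrix}$, i.e. the first element of the generating set is equal to $1$. Let $$\mu\colon\mathcal{O}_{\mathbb{C}^n,0}\otimes_{\mathcal{O}_{\mathbb{C}^{n+1},0}}\mathcal{O}_{\mathbb{C}^n,0}\to\mathcal{O}_{\mathbb{C}^n,0},\qquad a\otimes b\mapsto ab,$$ be the multiplication map. Then the sequence of $\mathcal{O}_{\mathbb{C}^n,0}$-modules $$0\rightarrow\mathcal{O}_{\mathbb{C}^n,0}^{r}\xrightarrow{f^*\Lambda^1_1}\mathcal{O}_{\mathbb{C}^n,0}^{r}\xrightarrow{\Delta G}\operatorname{Ker}(\mu)\rightarrow0$$ is exact, where $\Delta G$ is defined by $\hat e_i\mapsto g_i\otimes1-1\otimes g_i$ for $i=1,\ldots,r$.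
   Context: $\mathcal{O}_{\mathbb{C}^n,0}$ is an $\mathcal{O}_{\mathbb{C}^{n+1},0}$-module via $f^*$. $\Lambda^1_1$ is the $r\times r$ matrix obtained from $\Lambda$ by deleting its first row and first column, and $f^*\Lambda^1_1$ is obtained from it by composing every entry with $f$. $\hat e_1,\ldots,\hat e_r$ is the standard basis of $\mathcal{O}_{\mathbb{C}^n,0}^r$. The tensor product and $\operatorname{Ker}(\mu)$ are $\mathcal{O}_{\mathbb{C}^n,0}$-modules through the right-hand factor. *)

theory Defs
  imports
    "HOL-Analysis.Analysis"
    "HOL-Algebra.Algebra"
    "Jordan_Normal_Form.VS_Connect"
begin

text \<open>
  The library has no holomorphy in several variables: a function on \<^typ>\<open>complex^'n\<close> is taken to be
  holomorphic on an open set if it is Frechet differentiable there with complex-linear derivatives.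
  Components of points are written with \<^const>\<open>vec_nth\<close>, since \<open>$\<close> also indexes the vectors of
  \<open>Jordan_Normal_Form\<close>.
\<close>

definition holo_fun_on :: "(complex^'n \<Rightarrow> complex) \<Rightarrow> (complex^'n) set \<Rightarrow> bool" where
  "holo_fun_on h U \<longleftrightarrow>
     open U \<and> (\<forall>x\<in>U. \<exists>D. (h has_derivative D) (at x) \<and> (\<forall>c v. D (c *s v) = c * D v))"

definition holo_map_on :: "(complex^'n \<Rightarrow> complex^'m) \<Rightarrow> (complex^'n) set \<Rightarrow> bool" where
  "holo_map_on f U \<longleftrightarrow> (\<forall>i. holo_fun_on (\<lambda>x. vec_nth (f x) i) U)"

definition holo_fun_germ :: "(complex^'n \<Rightarrow> complex) \<Rightarrow> bool" where
  "holo_fun_germ h \<longleftrightarrow> (\<exists>U. 0 \<in> U \<and> holo_fun_on h U)"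

text \<open>
  Map-germs are given by representatives: total functions of which only the values near the
  origin matter. Everything below depends only on the germ of \<open>f\<close> at \<open>0\<close>.
\<close>

definition holo_map_germ :: "(complex^'n \<Rightarrow> complex^'m) \<Rightarrow> bool" where
  "holo_map_germ f \<longleftrightarrow> f 0 = 0 \<and> (\<exists>U. 0 \<in> U \<and> holo_map_on f U)"

definition finite_map_germ :: "(complex^'n \<Rightarrow> complex^'m) \<Rightarrow> bool" where
  "finite_map_germ f \<longleftrightarrow>
     (\<exists>U V. open U \<and> 0 \<in> U \<and> open V \<and> f ` U \<subseteq> V \<and> holo_map_on f U \<and>
        closed_map (top_of_set U) (top_of_set V) f \<and> (\<forall>y\<in>V. finite {x\<in>U. f x = y}))"

text \<open>
  Generically one-to-one: for some representative, the points that are alone in their fibre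
  include a dense open subset of the domain.
\<close>

definition generically_one_to_one :: "(complex^'n \<Rightarrow> complex^'m) \<Rightarrow> bool" where
  "generically_one_to_one f \<longleftrightarrow>
     (\<exists>U W. open U \<and> 0 \<in> U \<and> holo_map_on f U \<and>
        open W \<and> W \<subseteq> U \<and> U \<subseteq> closure W \<and>
        (\<forall>x\<in>W. \<forall>x'\<in>U. f x' = f x \<longrightarrow> x' = x))"

lemma holo_fun_on_const: "open U \<Longrightarrow> holo_fun_on (\<lambda>_. c) U"
  unfolding holo_fun_on_def by (auto intro!: exI[of _ "\<lambda>_. 0"])

lemma holo_fun_on_add:
  assumes "holo_fun_on h U" "holo_fun_on k U" shows "holo_fun_on (\<lambda>x. h x + k x) U"
proof -
  have "\<exists>D. ((\<lambda>x. h x + k x) has_derivative D) (at x) \<and> (\<forall>c v. D (c *s v) = c * D v)"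
    if "x \<in> U" for x
  proof -
    from assms that obtain D E where
      "(h has_derivative D) (at x)" "\<forall>c v. D (c *s v) = c * D v"
      "(k has_derivative E) (at x)" "\<forall>c v. E (c *s v) = c * E v"
      unfolding holo_fun_on_def by blast
    then show ?thesis
      by (intro exI[of _ "\<lambda>v. D v + E v"]) (auto intro!: has_derivative_add simp: algebra_simps)
  qed
  then show ?thesis using assms by (auto simp: holo_fun_on_def)
qed

lemma holo_fun_on_mult:
  assumes "holo_fun_on h U" "holo_fun_on k U" shows "holo_fun_on (\<lambda>x. h x * k x) U"
proof -
  have "\<exists>D. ((\<lambda>x. h x * k x) has_derivative D) (at x) \<and> (\<forall>c v. D (c *s v) = c * D v)"
    if "x \<in> U" for x
  proof -
    from assms that obtain D E where
      "(h has_derivative D) (at x)" "\<forall>c v. D (c *s v) = c * D v"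
      "(k has_derivative E) (at x)" "\<forall>c v. E (c *s v) = c * E v"
      unfolding holo_fun_on_def by blast
    then show ?thesis
      using has_derivative_mult[of h D x UNIV k E]
      by (intro exI[of _ "\<lambda>v. h x * E v + D v * k x"]) (auto simp: distrib_left mult_ac)
  qed
  then show ?thesis using assms by (auto simp: holo_fun_on_def)
qed

lemma holo_fun_on_subset: "holo_fun_on h U \<Longrightarrow> open V \<Longrightarrow> V \<subseteq> U \<Longrightarrow> holo_fun_on h V"
  unfolding holo_fun_on_def by blast

lemma holo_fun_on_compose:
  fixes f :: "complex^'n \<Rightarrow> complex^'m"
  assumes h: "holo_fun_on h V" and f: "holo_map_on f U" and U: "open U" and im: "f ` U \<subseteq> V"
  shows "holo_fun_on (h \<circ> f) U"
proof -
  have "\<exists>D. ((h \<circ> f) has_derivative D) (at x) \<and> (\<forall>c v. D (c *s v) = c * D v)"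
    if x: "x \<in> U" for x
  proof -
    from f x have "\<forall>i. \<exists>D. ((\<lambda>x. vec_nth (f x) i) has_derivative D) (at x) \<and>
        (\<forall>c v. D (c *s v) = c * D v)"
      unfolding holo_map_on_def holo_fun_on_def by blast
    then obtain E where E: "\<And>i. ((\<lambda>x. vec_nth (f x) i) has_derivative E i) (at x)"
      "\<And>i c v. E i (c *s v) = c * E i v" by metis
    define F where "F = (\<lambda>v. \<chi> i. E i v)"
    have F: "(f has_derivative F) (at x)"
    proof -
      have "((\<lambda>x. \<Sum>i\<in>UNIV. axis i (vec_nth (f x) i)) has_derivative
             (\<lambda>v. \<Sum>i\<in>UNIV. axis i (E i v))) (at x)"
      proof (intro has_derivative_sum)
        fix i :: 'm
        have "bounded_linear (axis i :: complex \<Rightarrow> complex^'m)"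
          by (intro linear_conv_bounded_linear[THEN iffD1] linearI)
             (auto simp: axis_def Finite_Cartesian_Product.vec_eq_iff)
        from bounded_linear.has_derivative[OF this E(1)]
        show "((\<lambda>x. axis i (vec_nth (f x) i)) has_derivative (\<lambda>v. axis i (E i v))) (at x)" .
      qed
      moreover have "(\<Sum>i\<in>UNIV. axis i (y i)) = (\<chi> i. y i)" for y :: "'m \<Rightarrow> complex"
        by (simp add: Finite_Cartesian_Product.vec_eq_iff axis_def)
      ultimately show ?thesis by (simp add: F_def Finite_Cartesian_Product.vec_nth_inverse)
    qed
    from h im x obtain D where D: "(h has_derivative D) (at (f x))" "\<forall>c v. D (c *s v) = c * D v"
      unfolding holo_fun_on_def by blast
    have "F (c *s v) = c *s F v" for c v
      by (simp add: F_def E(2) Finite_Cartesian_Product.vec_eq_iff)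
    then show ?thesis using diff_chain_at[OF F D(1)] D(2)
      by (intro exI[of _ "D \<circ> F"]) auto
  qed
  then show ?thesis using U by (auto simp: holo_fun_on_def)
qed

lemma holo_fun_germ_const: "holo_fun_germ (\<lambda>_. c)"
  unfolding holo_fun_germ_def using holo_fun_on_const[of UNIV c] by auto

lemma holo_fun_germ_add:
  assumes "holo_fun_germ h" "holo_fun_germ k" shows "holo_fun_germ (\<lambda>x. h x + k x)"
proof -
  from assms obtain U V where UV: "0 \<in> U" "holo_fun_on h U" "0 \<in> V" "holo_fun_on k V"
    unfolding holo_fun_germ_def by blast
  then have "open (U \<inter> V)" by (auto simp: holo_fun_on_def)
  then have "holo_fun_on (\<lambda>x. h x + k x) (U \<inter> V)"
    using UV by (intro holo_fun_on_add) (auto intro: holo_fun_on_subset)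
  then show ?thesis using UV unfolding holo_fun_germ_def by blast
qed

lemma holo_fun_germ_mult:
  assumes "holo_fun_germ h" "holo_fun_germ k" shows "holo_fun_germ (\<lambda>x. h x * k x)"
proof -
  from assms obtain U V where UV: "0 \<in> U" "holo_fun_on h U" "0 \<in> V" "holo_fun_on k V"
    unfolding holo_fun_germ_def by blast
  then have "open (U \<inter> V)" by (auto simp: holo_fun_on_def)
  then have "holo_fun_on (\<lambda>x. h x * k x) (U \<inter> V)"
    using UV by (intro holo_fun_on_mult) (auto intro: holo_fun_on_subset)
  then show ?thesis using UV unfolding holo_fun_germ_def by blast
qed

lemma holo_fun_germ_uminus: "holo_fun_germ h \<Longrightarrow> holo_fun_germ (\<lambda>x. - h x)"
  using holo_fun_germ_mult[OF holo_fun_germ_const[of "-1"]] by simp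

lemma holo_map_germ_tendsto:
  assumes "holo_map_germ f" shows "(f \<longlongrightarrow> 0) (nhds 0)"
proof -
  from assms obtain U where U: "0 \<in> U" "holo_map_on f U" and f0: "f 0 = 0"
    unfolding holo_map_germ_def by blast
  have "isCont (\<lambda>x. vec_nth (f x) i) 0" for i
    using U has_derivative_continuous unfolding holo_map_on_def holo_fun_on_def by blast
  then have "((\<lambda>x. vec_nth (f x) i) \<longlongrightarrow> vec_nth (f 0) i) (at 0)" for i
    by (simp add: isCont_def)
  then have "(f \<longlongrightarrow> f 0) (at 0)" by (rule vec_tendstoI)
  then have "(f \<longlongrightarrow> f 0) (nhds 0)"
    using tendsto_at_iff_tendsto_nhds by blast
  then show ?thesis by (simp add: f0)
qed

lemma holo_fun_germ_compose:
  assumes h: "holo_fun_germ h" and f: "holo_map_germ f" shows "holo_fun_germ (h \<circ> f)"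
proof -
  from h obtain V where V: "0 \<in> V" "holo_fun_on h V" unfolding holo_fun_germ_def by blast
  then have "open V" by (simp add: holo_fun_on_def)
  from f obtain U where U: "0 \<in> U" "holo_map_on f U" unfolding holo_map_germ_def by blast
  then have "open U" by (simp add: holo_map_on_def holo_fun_on_def)
  have "eventually (\<lambda>x. f x \<in> V) (nhds 0)"
    using holo_map_germ_tendsto[OF f] \<open>open V\<close> V(1) by (rule topological_tendstoD)
  then obtain U' where U': "open U'" "0 \<in> U'" "\<forall>x\<in>U'. f x \<in> V"
    unfolding eventually_nhds by blast
  have "holo_map_on f (U \<inter> U')"
    using U(2) holo_fun_on_subset \<open>open U\<close> U'(1) unfolding holo_map_on_def by blast
  then have "holo_fun_on (h \<circ> f) (U \<inter> U')"
    using V(2) U'(3) \<open>open U\<close> U'(1) by (intro holo_fun_on_compose[of h V]) auto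
  then show ?thesis unfolding holo_fun_germ_def using U(1) U'(2) by blast
qed

definition germ_eq :: "(complex^'n \<Rightarrow> complex) \<Rightarrow> (complex^'n \<Rightarrow> complex) \<Rightarrow> bool" where
  "germ_eq h k \<longleftrightarrow> holo_fun_germ h \<and> holo_fun_germ k \<and> eventually (\<lambda>x. h x = k x) (nhds 0)"

text \<open>The ring of germs at the origin of holomorphic functions on \<^typ>\<open>complex^'n\<close>.\<close>

quotient_type 'n germ = "complex^('n::finite) \<Rightarrow> complex" / partial: germ_eq
proof (rule part_equivpI)
  show "\<exists>h :: complex^'n \<Rightarrow> complex. germ_eq h h"
    using holo_fun_germ_const by (auto simp: germ_eq_def)
  show "symp (germ_eq :: (complex^'n \<Rightarrow> complex) \<Rightarrow> _)"
    by (rule sympI) (auto simp: germ_eq_def elim: eventually_mono)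
  show "transp (germ_eq :: (complex^'n \<Rightarrow> complex) \<Rightarrow> _)"
    by (rule transpI) (auto simp: germ_eq_def elim: eventually_elim2)
qed

instantiation germ :: (finite) comm_ring_1
begin

lift_definition zero_germ :: "'a germ" is "\<lambda>_. 0"
  by (simp add: germ_eq_def holo_fun_germ_const)

lift_definition one_germ :: "'a germ" is "\<lambda>_. 1"
  by (simp add: germ_eq_def holo_fun_germ_const)

lift_definition plus_germ :: "'a germ \<Rightarrow> 'a germ \<Rightarrow> 'a germ" is "\<lambda>h k x. h x + k x"
  by (auto simp: germ_eq_def holo_fun_germ_add elim: eventually_elim2)

lift_definition times_germ :: "'a germ \<Rightarrow> 'a germ \<Rightarrow> 'a germ" is "\<lambda>h k x. h x * k x"
  by (auto simp: germ_eq_def holo_fun_germ_mult elim: eventually_elim2)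

lift_definition uminus_germ :: "'a germ \<Rightarrow> 'a germ" is "\<lambda>h x. - h x"
  by (auto simp: germ_eq_def holo_fun_germ_uminus elim: eventually_mono)

definition minus_germ :: "'a germ \<Rightarrow> 'a germ \<Rightarrow> 'a germ" where
  "minus_germ a b = a + - b"

instance
proof
  fix a b c :: "'a germ"
  show "a + b + c = a + (b + c)" "a + b = b + a" "0 + a = a" "- a + a = 0"
    "a * b * c = a * (b * c)" "a * b = b * a" "1 * a = a" "(a + b) * c = a * c + b * c"
    by (transfer, auto simp: germ_eq_def algebra_simps
          intro!: holo_fun_germ_add holo_fun_germ_mult holo_fun_germ_uminus holo_fun_germ_const)+
  show "a - b = a + - b" by (simp add: minus_germ_def)
  show "(0::'a germ) \<noteq> 1"
    by transfer (auto simp: germ_eq_def dest: eventually_nhds_x_imp_x)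
qed

end

text \<open>The ring homomorphism \<open>f\<^sup>*\<close>; the default value \<open>0\<close> is irrelevant for map-germs \<open>f\<close>.\<close>

lift_definition germ_pullback :: "(complex^'n \<Rightarrow> complex^'m) \<Rightarrow> 'm germ \<Rightarrow> 'n germ"
  is "\<lambda>f h. if holo_map_germ f then h \<circ> f else (\<lambda>_. 0)"
proof -
  fix f :: "complex^'n \<Rightarrow> complex^'m" and h k :: "complex^'m \<Rightarrow> complex"
  assume hk: "germ_eq h k"
  show "germ_eq (if holo_map_germ f then h \<circ> f else (\<lambda>_. 0))
                (if holo_map_germ f then k \<circ> f else (\<lambda>_. 0))"
  proof (cases "holo_map_germ f")
    case True
    have "eventually (\<lambda>x. h (f x) = k (f x)) (nhds 0)"
      using hk holo_map_germ_tendsto[OF True]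
      by (auto simp: germ_eq_def filterlim_iff)
    then show ?thesis using True hk by (auto simp: germ_eq_def holo_fun_germ_compose)
  qed (simp add: germ_eq_def holo_fun_germ_const)
qed

definition short_exact_modules ::
  "('r, 'x) ring_scheme \<Rightarrow> ('r, 'a) module \<Rightarrow> ('r, 'b) module \<Rightarrow> ('r, 'c) module \<Rightarrow>
   ('a \<Rightarrow> 'b) \<Rightarrow> ('b \<Rightarrow> 'c) \<Rightarrow> bool" where
  "short_exact_modules R L M N \<alpha> \<beta> \<longleftrightarrow>
     Module.module R L \<and> Module.module R M \<and> Module.module R N \<and>
     \<alpha> \<in> module_hom R L M \<and> \<beta> \<in> module_hom R M N \<and>
     inj_on \<alpha> (carrier L) \<and>
     \<alpha> ` carrier L = {x \<in> carrier M. \<beta> x = \<zero>\<^bsub>N\<^esub>} \<and>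
     \<beta> ` carrier M = carrier N"

text \<open>The linear map out of the free module of rank \<open>r\<close> that sends the \<open>i\<close>-th basis vector to \<open>t i\<close>.\<close>

definition free_module_map :: "('r, 'a) module \<Rightarrow> nat \<Rightarrow> (nat \<Rightarrow> 'a) \<Rightarrow> 'r Matrix.vec \<Rightarrow> 'a" where
  "free_module_map M r t v = finsum M (\<lambda>i. (v $ i) \<odot>\<^bsub>M\<^esub> t i) {..<r}"

text \<open>A commutative ring as a module over another one, by restriction of scalars along \<open>\<phi>\<close>.\<close>

definition restr_module :: "('r \<Rightarrow> 'a::comm_ring_1) \<Rightarrow> ('r, 'a) module" where
  "restr_module \<phi> = \<lparr>carrier = UNIV, mult = (*), one = 1, ring.zero = 0, add = (+),
                     smult = (\<lambda>r a. \<phi> r * a)\<rparr>"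

text \<open>
  The tensor product of the \<open>R\<close>-modules \<open>M\<close> and \<open>N\<close>: the free abelian group on pairs modulo the
  subgroup generated by the bilinearity and balancing relations; its elements are cosets.
\<close>

definition tensor_relations ::
  "('r, 'x) ring_scheme \<Rightarrow> ('r, 'a) module \<Rightarrow> ('r, 'b) module \<Rightarrow> ('a \<times> 'b \<Rightarrow>\<^sub>0 int) set" where
  "tensor_relations R M N =
     {frag_of (x \<oplus>\<^bsub>M\<^esub> x', y) - frag_of (x, y) - frag_of (x', y) | x x' y.
        x \<in> carrier M \<and> x' \<in> carrier M \<and> y \<in> carrier N} \<union>
     {frag_of (x, y \<oplus>\<^bsub>N\<^esub> y') - frag_of (x, y) - frag_of (x, y') | x y y'.
        x \<in> carrier M \<and> y \<in> carrier N \<and> y' \<in> carrier N} \<union>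
     {frag_of (r \<odot>\<^bsub>M\<^esub> x, y) - frag_of (x, r \<odot>\<^bsub>N\<^esub> y) | r x y.
        r \<in> carrier R \<and> x \<in> carrier M \<and> y \<in> carrier N}"

definition tensor_null ::
  "('r, 'x) ring_scheme \<Rightarrow> ('r, 'a) module \<Rightarrow> ('r, 'b) module \<Rightarrow> ('a \<times> 'b \<Rightarrow>\<^sub>0 int) set" where
  "tensor_null R M N =
     generate (free_Abelian_group (carrier M \<times> carrier N)) (tensor_relations R M N)"

definition tensor_coset ::
  "('r, 'x) ring_scheme \<Rightarrow> ('r, 'a) module \<Rightarrow> ('r, 'b) module \<Rightarrow>
   ('a \<times> 'b \<Rightarrow>\<^sub>0 int) \<Rightarrow> ('a \<times> 'b \<Rightarrow>\<^sub>0 int) set" where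
  "tensor_coset R M N c =
     tensor_null R M N #>\<^bsub>free_Abelian_group (carrier M \<times> carrier N)\<^esub> c"

definition tensor ::
  "('r, 'x) ring_scheme \<Rightarrow> ('r, 'a) module \<Rightarrow> ('r, 'b) module \<Rightarrow>
   'a \<Rightarrow> 'b \<Rightarrow> ('a \<times> 'b \<Rightarrow>\<^sub>0 int) set" where
  "tensor R M N x y = tensor_coset R M N (frag_of (x, y))"

text \<open>
  \<open>N'\<close> is \<open>N\<close> regarded as a module over a second ring \<open>S\<close> whose action commutes with that of \<open>R\<close>.
  The tensor product becomes an \<open>S\<close>-module by \<open>s (x \<otimes> y) = x \<otimes> s y\<close>. An operation on cosets is
  given by its values on representatives, \<^const>\<open>the_elem\<close> extracting the common value. The
  fields \<open>mult\<close> and \<open>one\<close> play no role in a module.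
\<close>

definition tensor_right_module ::
  "('r, 'x) ring_scheme \<Rightarrow> ('r, 'a) module \<Rightarrow> ('r, 'b) module \<Rightarrow> ('s, 'b) module \<Rightarrow>
   ('s, ('a \<times> 'b \<Rightarrow>\<^sub>0 int) set) module" where
  "tensor_right_module R M N N' =
     (let Q = free_Abelian_group (carrier M \<times> carrier N) Mod tensor_null R M N
      in \<lparr>carrier = carrier Q, mult = undefined, one = undefined,
          ring.zero = monoid.one Q, add = monoid.mult Q,
          smult = (\<lambda>s t. the_elem
            ((\<lambda>c. tensor_coset R M N
                     (frag_extend (\<lambda>(x, y). frag_of (x, s \<odot>\<^bsub>N'\<^esub> y)) c)) ` t))\<rparr>)"

text \<open>For a ring homomorphism \<open>\<phi>\<close> from \<open>'r\<close> to \<open>'a\<close>: the tensor square of \<open>'a\<close> over \<open>'r\<close>.\<close>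

definition tensor_square :: "('r::comm_ring_1 \<Rightarrow> 'a::comm_ring_1) \<Rightarrow>
    ('a, ('a \<times> 'a \<Rightarrow>\<^sub>0 int) set) module" where
  "tensor_square \<phi> =
     tensor_right_module class_ring (restr_module \<phi>) (restr_module \<phi>) (restr_module id)"

definition pure_tensor :: "('r::comm_ring_1 \<Rightarrow> 'a::comm_ring_1) \<Rightarrow> 'a \<Rightarrow> 'a \<Rightarrow>
    ('a \<times> 'a \<Rightarrow>\<^sub>0 int) set" where
  "pure_tensor \<phi> = tensor class_ring (restr_module \<phi>) (restr_module \<phi>)"

text \<open>The multiplication map \<open>a \<otimes> b \<mapsto> ab\<close>, extended additively and evaluated on representatives.\<close>

definition mult_map :: "('a \<times> 'a \<Rightarrow>\<^sub>0 int) set \<Rightarrow> 'a::comm_ring_1" where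
  "mult_map t = the_elem
     ((\<lambda>c. \<Sum>k\<in>Poly_Mapping.keys c. of_int (Poly_Mapping.lookup c k) * (fst k * snd k)) ` t)"

definition ker_mult_map :: "('r::comm_ring_1 \<Rightarrow> 'a::comm_ring_1) \<Rightarrow>
    ('a, ('a \<times> 'a \<Rightarrow>\<^sub>0 int) set) module" where
  "ker_mult_map \<phi> =
     (tensor_square \<phi>)\<lparr>carrier := {t \<in> carrier (tensor_square \<phi>). mult_map t = 0}\<rparr>"

text \<open>
  The components of \<open>g\<close> are indexed from \<open>0\<close>, so \<open>g $ i\<close> is the generator usually called
  \<open>g\<^bsub>i+1\<^esub>\<close>; it is entry \<open>i + 1\<close> of \<open>vCons 1 g\<close>.
\<close>

text \<open>The linear map sending the \<open>i\<close>-th basis vector to \<open>g\<^sub>i \<otimes> 1 - 1 \<otimes> g\<^sub>i\<close>.\<close>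

definition Delta :: "('r::comm_ring_1 \<Rightarrow> 'a::comm_ring_1) \<Rightarrow> 'a Matrix.vec \<Rightarrow> 'a Matrix.vec \<Rightarrow>
    ('a \<times> 'a \<Rightarrow>\<^sub>0 int) set" where
  "Delta \<phi> g = free_module_map (tensor_square \<phi>) (dim_vec g)
     (\<lambda>i. pure_tensor \<phi> (g $ i) 1 \<ominus>\<^bsub>tensor_square \<phi>\<^esub> pure_tensor \<phi> 1 (g $ i))"

end

theory Submission
  imports Defs
    "HOL-Complex_Analysis.Complex_Analysis"
    "HOL-Computational_Algebra.Fundamental_Theorem_Algebra"
    "Jordan_Normal_Form.Char_Poly"
begin

text \<open>
  Write \<open>R\<close> and \<open>S\<close> for the rings of germs on the target and on the source of \<open>f\<close>. Tensoring the
  presentation with \<open>S\<close> presents \<open>S \<otimes>\<^sub>R S\<close> by \<open>f\<^sup>*\<Lambda>\<close>. Replace the generators \<open>g\<^sub>i \<otimes> 1\<close> by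
  \<open>g\<^sub>i \<otimes> 1 - 1 \<otimes> g\<^sub>i\<close> and keep \<open>1 \<otimes> 1\<close>: the first row of the matrix becomes \<open>G f\<^sup>*\<Lambda> = 0\<close>, which
  splits off \<open>S = S (1 \<otimes> 1)\<close>, and since \<open>\<Lambda>\<close> is symmetric, the first column is a combination of the
  other ones. So \<open>Ker \<mu>\<close>, the complementary summand, is presented by \<open>f\<^sup>*\<Lambda>\<^sup>1\<^sub>1\<close>. This part is formal and
  holds for any ring homomorphism (\<open>exact_if_minor_injective\<close>).

  What remains is the injectivity of \<open>f\<^sup>*\<Lambda>\<^sup>1\<^sub>1\<close>. By symmetry, a vector \<open>v\<close> in its kernel, extended by a
  zero, gives \<open>w\<close> with \<open>w\<^sup>T f\<^sup>*\<Lambda> = 0\<close>. At each point \<open>x\<close> near the origin, \<open>w(x)\<close> is then a linear form on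
  the fibre at \<open>y = f(x)\<close> of the module presented by \<open>\<Lambda>\<close>, in terms of its values on the generators;
  another such form is the evaluation \<open>G(x) = (1, g\<^sub>1(x), \<dots>, g\<^sub>r(x))\<close>. Multiplication by the coordinates
  \<open>x\<^sub>j\<close> of the source acts on these forms by commuting operators. The point is that joint
  eigenvectors are multiples of evaluations at points of the fibre of \<open>f\<close>, and that an eigenvector of
  the second level gives a tangent vector annihilated by the derivative of \<open>f\<close> (\<open>form_vanishes\<close>). Where a
  point is alone in its fibre and \<open>w(x) \<noteq> 0\<close>, the form \<open>w(x)\<close> is not a multiple of \<open>G(x)\<close>, so an
  eigenvector of the second level exists (\<open>second_level_eigenvector\<close>), and the derivative of \<open>f\<close> is not
  injective. This cannot happen on an open set on which \<open>f\<close> is injective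
  (\<open>injective_holo_map_immersive\<close>), so \<open>w = 0\<close>.

  To compare forms with points, a function \<open>h\<close> has to be written as a combination of the generators
  whose coefficients, for all \<open>y\<close> near the origin, give the value \<open>h(x) u\<^sub>0\<close> on each joint eigenvector
  \<open>u\<close> with eigenvalues \<open>x\<close>. The presentation supplies a combination that represents \<open>h\<close>, but this
  is an identity on the graph of \<open>f\<close>, and the point \<open>(x, y)\<close> is not yet known to lie there. So a
  combination is built from the coordinates: \<open>x\<^sub>j\<close> satisfies a polynomial over \<open>R\<close> whose lower coefficients vanish at the
  origin (\<open>Weierstrass_equation\<close>), and division by these polynomials (\<open>Weierstrass_division\<close>) turns \<open>h\<close> into a
  polynomial in the coordinates over \<open>R\<close> (\<open>lifts_exists\<close>), for which the statement is clear. Applied to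
  the components of \<open>f\<close> and to the generators, this gives the claims on eigenvectors
  (\<open>eventually_calculus\<close>).
\<close>

section \<open>Holomorphic functions of several variables\<close>

lemma holo_fun_on_open: "holo_fun_on h U \<Longrightarrow> open U"
  by (simp add: holo_fun_on_def)

lemma holo_fun_on_has_derivative:
  assumes "holo_fun_on h U" "x \<in> U"
  shows "(h has_derivative frechet_derivative h (at x)) (at x)"
  using assms unfolding holo_fun_on_def
  by (metis differentiableI frechet_derivative_works)

lemma holo_fun_on_derivative_scale:
  assumes "holo_fun_on h U" "x \<in> U"
  shows "frechet_derivative h (at x) (c *s v) = c * frechet_derivative h (at x) v"
proof -
  obtain D where "(h has_derivative D) (at x)" "\<forall>c v. D (c *s v) = c * D v"
    using assms unfolding holo_fun_on_def by blast
  then show ?thesis using frechet_derivative_at by metis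
qed

lemma holo_fun_on_continuous_on: "holo_fun_on h U \<Longrightarrow> continuous_on U h"
  by (meson holo_fun_on_has_derivative has_derivative_continuous
      continuous_at_imp_continuous_on)

lemma bounded_linear_scale_vec: "bounded_linear (\<lambda>t::complex. t *s (v :: complex^'k))"
proof -
  have "(\<lambda>t::complex. t *s v) = (\<lambda>t. \<chi> i. t * vec_nth v i)"
    by (simp add: fun_eq_iff Finite_Cartesian_Product.vec_eq_iff)
  moreover have "linear (\<lambda>t::complex. (\<chi> i. t * vec_nth v i) :: complex^'k)"
    by (intro linearI) (auto simp: Finite_Cartesian_Product.vec_eq_iff algebra_simps)
  ultimately show ?thesis by (simp add: linear_conv_bounded_linear)
qed

lemma norm_scale_vec: "norm (t *s (v :: complex^'k)) = norm t * norm v"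
  by (simp add: norm_vec_def L2_set_right_distrib norm_mult)

lemma holo_fun_on_line:
  assumes h: "holo_fun_on h U" and x: "x + t *s v \<in> U"
  shows "((\<lambda>s. h (x + s *s v)) has_field_derivative frechet_derivative h (at (x + t *s v)) v) (at t)"
proof -
  have "((\<lambda>s. x + s *s v) has_derivative (\<lambda>s. s *s v)) (at t)"
    by (intro has_derivative_eq_rhs[OF has_derivative_add[OF has_derivative_const
          bounded_linear_imp_has_derivative[OF bounded_linear_scale_vec]]]) simp
  from diff_chain_at[OF this holo_fun_on_has_derivative[OF h x]]
  have "((\<lambda>s. h (x + s *s v)) has_derivative
      (\<lambda>s. frechet_derivative h (at (x + t *s v)) (s *s v))) (at t)"
    by (simp add: o_def)
  then show ?thesis
    by (simp add: has_field_derivative_def holo_fun_on_derivative_scale[OF h x] mult_commute_abs)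
qed

text \<open>
  A holomorphic function is continuously differentiable: a Cauchy estimate on the complex lines
  through nearby points bounds the variation of the derivative by that of the function.
\<close>

lemma holo_fun_on_derivative_continuous_on:
  assumes h: "holo_fun_on h U"
  shows "continuous_on U (\<lambda>x. frechet_derivative h (at x) v)"
proof (rule continuous_at_imp_continuous_on, rule ballI)
  fix x0 assume x0: "x0 \<in> U"
  obtain \<rho> where \<rho>: "\<rho> > 0" "cball x0 (2 * \<rho>) \<subseteq> U"
  proof -
    obtain e where "e > 0" "cball x0 e \<subseteq> U"
      using x0 holo_fun_on_open[OF h] open_contains_cball by blast
    then show ?thesis using that[of "e / 2"] by auto
  qed
  define r where "r = \<rho> / (norm v + 1)"
  have "norm v + 1 > 0" by (rule add_nonneg_pos) auto
  then have r: "r > 0" "r * norm v \<le> \<rho>"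
    using \<rho>(1) by (auto simp: r_def divide_simps)
  have in_U: "x + t *s v \<in> cball x0 (2 * \<rho>)" if "x \<in> cball x0 \<rho>" "norm t \<le> r" for x t
  proof -
    have "norm (t *s v) \<le> r * norm v"
      unfolding norm_scale_vec by (rule mult_right_mono) (use that in auto)
    then have "norm (t *s v) \<le> \<rho>" using r(2) by linarith
    then show ?thesis using that(1) norm_triangle_ineq4[of "x0 - x" "t *s v"]
      by (auto simp: dist_norm diff_diff_eq)
  qed
  have uc: "uniformly_continuous_on (cball x0 (2 * \<rho>)) h"
    using h \<rho>(2) by (intro compact_uniformly_continuous)
      (auto intro: continuous_on_subset[OF holo_fun_on_continuous_on])
  show "isCont (\<lambda>x. frechet_derivative h (at x) v) x0"
    unfolding continuous_at_eps_delta
  proof (intro allI impI)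
    fix e :: real assume e: "e > 0"
    then obtain d where d: "d > 0" "\<And>x y. x \<in> cball x0 (2 * \<rho>) \<Longrightarrow> y \<in> cball x0 (2 * \<rho>) \<Longrightarrow>
        dist x y < d \<Longrightarrow> dist (h x) (h y) < r * e / 2"
      using uc r(1) unfolding uniformly_continuous_on_def
      by (metis dist_commute half_gt_zero mult_pos_pos)
    show "\<exists>d>0. \<forall>x. dist x x0 < d \<longrightarrow>
        dist (frechet_derivative h (at x) v) (frechet_derivative h (at x0) v) < e"
    proof (intro exI[of _ "min d \<rho>"] conjI allI impI)
      show "min d \<rho> > 0" using d \<rho> by simp
      fix x assume x: "dist x x0 < min d \<rho>"
      define k where "k = (\<lambda>t. h (x + t *s v) - h (x0 + t *s v))"
      have k: "(k has_field_derivative frechet_derivative h (at (x + t *s v)) v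
          - frechet_derivative h (at (x0 + t *s v)) v) (at t)" if "norm t \<le> r" for t
      proof -
        have "x + t *s v \<in> U" "x0 + t *s v \<in> U"
          using in_U[of x t] in_U[of x0 t] that x \<rho> by (auto simp: dist_commute)
        then show ?thesis unfolding k_def
          by (intro derivative_intros holo_fun_on_line[OF h])
      qed
      have "norm ((deriv ^^ 1) k 0) \<le> fact 1 * (r * e / 2) / r ^ 1"
      proof (rule Cauchy_inequality)
        have "k holomorphic_on cball 0 r"
          using k by (intro holomorphic_onI)
            (auto simp: field_differentiable_def intro: has_field_derivative_at_within)
        then show "k holomorphic_on ball 0 r" "continuous_on (cball 0 r) k"
          using holomorphic_on_subset[of k "cball 0 r" "ball 0 r"]
          by (simp_all add: holomorphic_on_imp_continuous_on)
        show "r > 0" by (rule r)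
        fix t :: complex assume "norm (0 - t) = r"
        then have "x + t *s v \<in> cball x0 (2 * \<rho>)" "x0 + t *s v \<in> cball x0 (2 * \<rho>)"
          using in_U[of x t] in_U[of x0 t] x \<rho> by (auto simp: dist_commute)
        moreover have "dist (x + t *s v) (x0 + t *s v) < d" using x by (simp add: dist_norm)
        ultimately show "norm (k t) \<le> r * e / 2"
          using d(2) by (fastforce simp: k_def dist_norm)
      qed
      moreover have "deriv k 0 = frechet_derivative h (at x) v - frechet_derivative h (at x0) v"
        using DERIV_imp_deriv[OF k[of 0]] r(1) by simp
      ultimately show "dist (frechet_derivative h (at x) v) (frechet_derivative h (at x0) v) < e"
        using r(1) e by (simp add: dist_norm)
    qed
  qed
qed

lemma holo_fun_on_blinfun_derivative:
  fixes h :: "complex^'k \<Rightarrow> complex"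
  assumes h: "holo_fun_on h U"
  obtains D :: "complex^'k \<Rightarrow> (complex^'k) \<Rightarrow>\<^sub>L complex"
  where "\<And>x. x \<in> U \<Longrightarrow> (h has_derivative blinfun_apply (D x)) (at x)"
    and "\<And>x c v. x \<in> U \<Longrightarrow> blinfun_apply (D x) (c *s v) = c * blinfun_apply (D x) v"
    and "continuous_on U D"
proof
  define D where "D = (\<lambda>x. Blinfun (frechet_derivative h (at x)))"
  have D: "blinfun_apply (D x) = frechet_derivative h (at x)" if "x \<in> U" for x
    using holo_fun_on_has_derivative[OF h that]
    by (simp add: D_def bounded_linear_Blinfun_apply has_derivative_bounded_linear)
  show "(h has_derivative blinfun_apply (D x)) (at x)" if "x \<in> U" for x
    using holo_fun_on_has_derivative[OF h that] D[OF that] by simp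
  show "blinfun_apply (D x) (c *s v) = c * blinfun_apply (D x) v" if "x \<in> U" for x c v
    using holo_fun_on_derivative_scale[OF h that] D[OF that] by simp
  show "continuous_on U D"
  proof (rule continuous_on_blinfun_componentwise)
    fix i :: "complex^'k"
    show "continuous_on U (\<lambda>x. blinfun_apply (D x) i)"
      using holo_fun_on_derivative_continuous_on[OF h, of i] D
      by (simp cong: continuous_on_cong)
  qed
qed

lemma holo_fun_on_component: "open U \<Longrightarrow> holo_fun_on (\<lambda>x. vec_nth x i) U"
  unfolding holo_fun_on_def
  by (auto intro!: exI[of _ "\<lambda>v. vec_nth v i"] bounded_linear_imp_has_derivative
      bounded_linear_vec_nth)

lemma holo_fun_on_sum:
  "open U \<Longrightarrow> (\<And>i. i \<in> I \<Longrightarrow> holo_fun_on (h i) U) \<Longrightarrow> holo_fun_on (\<lambda>x. \<Sum>i\<in>I. h i x) U"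
  by (induction I rule: infinite_finite_induct) (auto intro: holo_fun_on_const holo_fun_on_add)

lemma holo_fun_on_power: "holo_fun_on h U \<Longrightarrow> holo_fun_on (\<lambda>x. h x ^ k) U"
  by (induction k) (auto intro: holo_fun_on_const holo_fun_on_mult holo_fun_on_open)

lemma holo_fun_on_diff:
  assumes "holo_fun_on h U" "holo_fun_on k U" shows "holo_fun_on (\<lambda>x. h x - k x) U"
  using holo_fun_on_add[OF assms(1) holo_fun_on_mult[OF holo_fun_on_const[of U "-1"] assms(2)]]
    assms(1) by (simp add: holo_fun_on_open)

lemma holo_fun_on_inverse:
  assumes h: "holo_fun_on h U" and nz: "\<And>x. x \<in> U \<Longrightarrow> h x \<noteq> 0"
  shows "holo_fun_on (\<lambda>x. inverse (h x)) U"
proof -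
  have "\<exists>D. ((\<lambda>x. inverse (h x)) has_derivative D) (at x) \<and> (\<forall>c v. D (c *s v) = c * D v)"
    if x: "x \<in> U" for x
  proof -
    obtain D where D: "(h has_derivative D) (at x)" "\<forall>c v. D (c *s v) = c * D v"
      using h x unfolding holo_fun_on_def by blast
    show ?thesis using Deriv.has_derivative_inverse[OF nz[OF x] D(1)] D(2)
      by (intro exI[of _ "\<lambda>v. - (inverse (h x) * D v * inverse (h x))"]) auto
  qed
  then show ?thesis using h by (auto simp: holo_fun_on_def)
qed

lemma holo_fun_on_divide:
  "holo_fun_on h U \<Longrightarrow> holo_fun_on k U \<Longrightarrow> (\<And>x. x \<in> U \<Longrightarrow> k x \<noteq> 0) \<Longrightarrow>
    holo_fun_on (\<lambda>x. h x / k x) U"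
  unfolding divide_inverse by (intro holo_fun_on_mult holo_fun_on_inverse)

lemma holo_fun_on_compose':
  "holo_fun_on h V \<Longrightarrow> (\<And>i. holo_fun_on (\<lambda>x. vec_nth (f x) i) U) \<Longrightarrow> open U \<Longrightarrow>
    (\<And>x. x \<in> U \<Longrightarrow> f x \<in> V) \<Longrightarrow> holo_fun_on (\<lambda>x. h (f x)) U"
  using holo_fun_on_compose[of h V f U] by (auto simp: holo_map_on_def o_def)

text \<open>
  One more coordinate is adjoined to the point \<open>x\<close>; it serves as the variable of integration.
\<close>

definition extend_vec :: "complex^'k \<Rightarrow> complex \<Rightarrow> complex^('k::finite option)" where
  "extend_vec x \<zeta> = (\<chi> i. case i of None \<Rightarrow> \<zeta> | Some j \<Rightarrow> vec_nth x j)"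

lemma extend_vec_nth [simp]:
  "vec_nth (extend_vec x \<zeta>) None = \<zeta>" "vec_nth (extend_vec x \<zeta>) (Some j) = vec_nth x j"
  by (simp_all add: extend_vec_def)

lemma linear_extend_vec: "linear (\<lambda>v. extend_vec v 0)"
  by (intro linearI) (auto simp: extend_vec_def Finite_Cartesian_Product.vec_eq_iff split: option.split)

lemma extend_vec_split: "extend_vec x \<zeta> = extend_vec x 0 + extend_vec 0 \<zeta>"
  by (auto simp: extend_vec_def Finite_Cartesian_Product.vec_eq_iff split: option.split)

lemma extend_vec_scale: "extend_vec (c *s v) 0 = c *s extend_vec v 0"
  by (auto simp: extend_vec_def Finite_Cartesian_Product.vec_eq_iff split: option.split)

lemma continuous_on_extend_vec [continuous_intros]:
  assumes "continuous_on S a" "continuous_on S b"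
  shows "continuous_on S (\<lambda>s. extend_vec (a s) (b s))"
proof -
  have "continuous_on S (\<lambda>s. extend_vec (a s) 0)"
    using linear_extend_vec assms(1)
    by (intro bounded_linear.continuous_on[where f = "\<lambda>v. extend_vec v 0"])
      (auto simp: linear_conv_bounded_linear)
  moreover have "continuous_on S (\<lambda>s. b s *s extend_vec 0 1)"
    by (rule bounded_linear.continuous_on[OF bounded_linear_scale_vec assms(2)])
  ultimately have "continuous_on S (\<lambda>s. extend_vec (a s) 0 + b s *s extend_vec 0 1)"
    by (rule continuous_on_add)
  moreover have "extend_vec (a s) (b s) = extend_vec (a s) 0 + b s *s extend_vec 0 1" for s
    by (auto simp: extend_vec_def Finite_Cartesian_Product.vec_eq_iff split: option.split)
  ultimately show ?thesis by presburger
qed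

text \<open>
  Differentiation under the integral sign. As the variable of integration is one of the complex
  variables of \<open>E\<close>, the derivative is jointly continuous by the preceding lemmas.
\<close>

lemma holo_fun_on_integral:
  fixes E :: "complex^('k::finite option) \<Rightarrow> complex" and \<zeta> :: "real \<Rightarrow> complex"
  assumes E: "holo_fun_on E \<Omega>" and U: "open U" and \<zeta>: "continuous_on {0..1} \<zeta>"
    and in\<Omega>: "\<And>x t. x \<in> U \<Longrightarrow> t \<in> {0..1} \<Longrightarrow> extend_vec x (\<zeta> t) \<in> \<Omega>"
  shows "holo_fun_on (\<lambda>x. integral {0..1} (\<lambda>t. E (extend_vec x (\<zeta> t)))) U"
proof -
  obtain D where D: "\<And>z. z \<in> \<Omega> \<Longrightarrow> (E has_derivative blinfun_apply (D z)) (at z)"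
    "\<And>z c v. z \<in> \<Omega> \<Longrightarrow> blinfun_apply (D z) (c *s v) = c * blinfun_apply (D z) v"
    "continuous_on \<Omega> D"
    using holo_fun_on_blinfun_derivative[OF E] by blast
  define I where "I = Blinfun (\<lambda>v :: complex^'k. extend_vec v 0)"
  have I: "blinfun_apply I = (\<lambda>v. extend_vec v 0)"
    unfolding I_def using linear_extend_vec
    by (intro bounded_linear_Blinfun_apply) (simp add: linear_conv_bounded_linear)
  have cont_fix: "continuous_on {0..1} (\<lambda>t. extend_vec x (\<zeta> t))" for x :: "complex^'k"
    by (intro continuous_intros \<zeta>)
  have "\<exists>G. ((\<lambda>x. integral {0..1} (\<lambda>t. E (extend_vec x (\<zeta> t)))) has_derivative G) (at x) \<and>
      (\<forall>c v. G (c *s v) = c * G v)" if x: "x \<in> U" for x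
  proof -
    obtain e where e: "e > 0" "ball x e \<subseteq> U" using x U open_contains_ball by blast
    define fx where "fx = (\<lambda>x t. D (extend_vec x (\<zeta> t)) o\<^sub>L I)"
    have cont2: "continuous_on (ball x e \<times> {0..1}) (\<lambda>(x, t). fx x t)"
    proof -
      have "continuous_on (ball x e \<times> {0..1}) (\<lambda>p. extend_vec (fst p) (\<zeta> (snd p)))"
        by (intro continuous_intros continuous_on_compose2[OF \<zeta>]) auto
      then have "continuous_on (ball x e \<times> {0..1}) (\<lambda>p. D (extend_vec (fst p) (\<zeta> (snd p))))"
        by (rule continuous_on_compose2[OF D(3)]) (use e in\<Omega> in auto)
      then show ?thesis unfolding fx_def split_beta by (intro continuous_intros)
    qed
    have "((\<lambda>x. integral (cbox 0 1) (\<lambda>t. E (extend_vec x (\<zeta> t)))) has_derivative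
        integral (cbox 0 1) (fx x)) (at x within ball x e)"
    proof (rule leibniz_rule)
      fix y t assume yt: "y \<in> ball x e" "t \<in> cbox (0::real) 1"
      then have z: "extend_vec y (\<zeta> t) \<in> \<Omega>" using e in\<Omega> by auto
      have "((\<lambda>y. extend_vec y (\<zeta> t)) has_derivative (\<lambda>v. extend_vec v 0)) (at y)"
        using bounded_linear_imp_has_derivative[OF linear_extend_vec[unfolded linear_conv_bounded_linear]]
        by (subst extend_vec_split[of _ "\<zeta> t"]) (auto intro!: derivative_eq_intros)
      from diff_chain_at[OF this D(1)[OF z]]
      show "((\<lambda>y. E (extend_vec y (\<zeta> t))) has_derivative blinfun_apply (fx y t)) (at y within ball x e)"
        by (auto simp: fx_def I o_def blinfun_compose.rep_eq intro: has_derivative_at_withinI)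
    next
      fix y assume "y \<in> ball x e"
      then show "(\<lambda>t. E (extend_vec y (\<zeta> t))) integrable_on cbox 0 1"
        using e in\<Omega> by (intro integrable_continuous
            continuous_on_compose2[OF holo_fun_on_continuous_on[OF E]]) (auto intro: cont_fix)
    qed (use cont2 e in auto)
    then have 1: "((\<lambda>x. integral {0..1} (\<lambda>t. E (extend_vec x (\<zeta> t)))) has_derivative
        integral {0..1} (fx x)) (at x)"
      using e(1) by (simp add: at_within_open[of x "ball x e"])
    have int: "fx x integrable_on {0..1}"
    proof -
      have p: "continuous_on {0..1} (\<lambda>t::real. (x, t))"
        by (intro continuous_on_Pair continuous_on_const continuous_on_id)
      have "continuous_on {0..1} (fx x)"
        using continuous_on_compose2[OF cont2 p] e(1) by (simp add: image_subset_iff)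
      then show ?thesis by (rule integrable_continuous_interval)
    qed
    have "blinfun_apply (integral {0..1} (fx x)) (c *s v) = c * blinfun_apply (integral {0..1} (fx x)) v" for c v
    proof -
      have "blinfun_apply (integral {0..1} (fx x)) w = integral {0..1} (\<lambda>t. blinfun_apply (fx x t) w)" for w
        using integral_linear[OF int blinfun.bounded_linear_left, of w] by (simp add: o_def)
      moreover have "blinfun_apply (fx x t) (c *s v) = c * blinfun_apply (fx x t) v"
        if "t \<in> {0..1}" for t
        using D(2)[OF in\<Omega>[OF x that]] by (simp add: fx_def I extend_vec_scale)
      then have "integral {0..1} (\<lambda>t. blinfun_apply (fx x t) (c *s v)) =
          integral {0..1} (\<lambda>t. c * blinfun_apply (fx x t) v)"
        by (intro integral_cong) auto
      ultimately show ?thesis by simp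
    qed
    with 1 show ?thesis by blast
  qed
  then show ?thesis using U by (auto simp: holo_fun_on_def)
qed

section \<open>Weierstrass division\<close>

text \<open>
  Cauchy's formula on a circle, with the contour integral written out over the unit interval so that
  it can be differentiated in parameters.
\<close>

lemma Cauchy_mean_value:
  fixes k :: "complex \<Rightarrow> complex"
  assumes k: "k holomorphic_on cball 0 \<epsilon>" and w: "norm w < \<epsilon>"
  defines "\<zeta> \<equiv> \<lambda>t. of_real \<epsilon> * exp (2 * of_real pi * \<i> * of_real t)"
  shows "((\<lambda>t. k (\<zeta> t) * \<zeta> t / (\<zeta> t - w)) has_integral k w) {0..1}"
proof -
  have "((\<lambda>u. k u / (u - w)) has_contour_integral (2 * of_real pi * \<i> * k w)) (circlepath 0 \<epsilon>)"
    using Cauchy_integral_circlepath_simple[OF k, of w] w by simp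
  then have "((\<lambda>t. k (\<zeta> t) / (\<zeta> t - w) * (2 * pi * \<i> * \<epsilon> * exp (2 * of_real pi * \<i> * t)))
      has_integral (2 * of_real pi * \<i> * k w)) {0..1}"
    unfolding has_contour_integral_def
    by (rule has_integral_eq[rotated]) (simp add: vector_derivative_circlepath01, simp add: circlepath \<zeta>_def)
  from has_integral_mult_right[OF this, of "1 / (2 * of_real pi * \<i>)"]
  show ?thesis by (simp add: \<zeta>_def field_simps)
qed

definition upd_vec :: "complex^'k \<Rightarrow> 'k \<Rightarrow> complex \<Rightarrow> complex^'k" where
  "upd_vec z j t = (\<chi> i. if i = j then t else vec_nth z i)"

lemma upd_vec_nth [simp]: "vec_nth (upd_vec z j t) i = (if i = j then t else vec_nth z i)"
  by (simp add: upd_vec_def)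

lemma upd_vec_same [simp]: "upd_vec (upd_vec z j s) j t = upd_vec z j t"
  "upd_vec z j (vec_nth z j) = z"
  by (auto simp: Finite_Cartesian_Product.vec_eq_iff)

lemma upd_vec_commute: "i \<noteq> j \<Longrightarrow> upd_vec (upd_vec z i s) j t = upd_vec (upd_vec z j t) i s"
  by (auto simp: Finite_Cartesian_Product.vec_eq_iff)

lemma norm_upd_vec_le: "norm (upd_vec z j t) \<le> norm z + norm t"
proof -
  have "upd_vec z j t = upd_vec z j 0 + axis j t"
    by (simp add: Finite_Cartesian_Product.vec_eq_iff axis_def)
  moreover have "norm (upd_vec z j 0) \<le> norm z"
    unfolding norm_vec_def by (rule L2_set_mono) auto
  moreover have "norm (axis j t) = norm t"
    unfolding norm_vec_def by (simp add: axis_def L2_set_def if_distrib[of "\<lambda>x. norm x ^ 2"] cong: if_cong)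
  ultimately show ?thesis by (metis add_mono_thms_linordered_semiring(3) norm_triangle_le)
qed

lemma holo_fun_germ_ball:
  assumes "holo_fun_germ h"
  obtains e where "e > 0" "holo_fun_on h (ball 0 e)"
proof -
  obtain U where "0 \<in> U" "holo_fun_on h U" using assms by (auto simp: holo_fun_germ_def)
  moreover then obtain e where "e > 0" "ball 0 e \<subseteq> U"
    using holo_fun_on_open open_contains_ball by blast
  ultimately show ?thesis using that holo_fun_on_subset by blast
qed

lemma holo_fun_germI_ball: "e > 0 \<Longrightarrow> holo_fun_on h (ball 0 e) \<Longrightarrow> holo_fun_germ h"
  unfolding holo_fun_germ_def by (intro exI[of _ "ball 0 e"]) simp

lemma holo_fun_germ_ball_family:
  assumes "finite I" "\<And>i. i \<in> I \<Longrightarrow> holo_fun_germ (h i)"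
  obtains e where "e > 0" "\<And>i. i \<in> I \<Longrightarrow> holo_fun_on (h i) (ball 0 e)"
proof -
  have "\<exists>e>0. \<forall>i\<in>I. holo_fun_on (h i) (ball 0 e)"
    using assms
  proof (induction I)
    case empty
    then show ?case by (auto intro: exI[of _ 1])
  next
    case (insert i I)
    then obtain e where e: "e > 0" "\<forall>i\<in>I. holo_fun_on (h i) (ball 0 e)" by auto
    obtain e' where e': "e' > 0" "holo_fun_on (h i) (ball 0 e')"
      using holo_fun_germ_ball[of "h i"] insert.prems by blast
    have "holo_fun_on (h l) (ball 0 (min e e'))" if "l \<in> insert i I" for l
      using that e(2) e'(2) holo_fun_on_subset[of "h l" _ "ball 0 (min e e')"]
      by (metis ball_min_Int inf_le1 inf_le2 insert_iff open_ball)
    then show ?case using e(1) e'(1) by (intro exI[of _ "min e e'"]) simp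
  qed
  then show ?thesis using that by blast
qed

lemma holo_fun_germ_isCont:
  assumes "holo_fun_germ h" shows "isCont h 0"
proof -
  obtain e where "e > 0" "holo_fun_on h (ball 0 e)" using holo_fun_germ_ball[OF assms] .
  then show ?thesis
    using holo_fun_on_continuous_on continuous_on_eq_continuous_at[OF open_ball, of 0 e h] by auto
qed

text \<open>
  Division by a monic polynomial \<open>P\<close> in the coordinate \<open>z\<^sub>j\<close> whose other coefficients vanish at
  the origin. With \<open>\<kappa>\<^sub>b\<close> defined by \<open>P(\<zeta>) - P(s) = (\<zeta> - s) \<Sum>\<^sub>b \<kappa>\<^sub>b(\<zeta>) s\<^sup>b\<close>, the Cauchy kernel
  splits as \<open>1 / (\<zeta> - s) = P(s) / (P(\<zeta>) (\<zeta> - s)) + \<Sum>\<^sub>b \<kappa>\<^sub>b(\<zeta>) s\<^sup>b / P(\<zeta>)\<close>; integrating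
  \<open>H\<close> against it over a small circle gives quotient and remainder, and shows that the
  remainder does not depend on any coordinate that \<open>H\<close> and the coefficients do not depend on.
\<close>

lemma Weierstrass_division:
  fixes H :: "complex^'k \<Rightarrow> complex" and c :: "nat \<Rightarrow> complex^'k \<Rightarrow> complex"
  assumes H: "holo_fun_germ H" and c: "\<And>b. b < d \<Longrightarrow> holo_fun_germ (c b)"
    and c0: "\<And>b. b < d \<Longrightarrow> c b 0 = 0"
    and cj: "\<And>b z t. b < d \<Longrightarrow> c b (upd_vec z j t) = c b z"
  obtains Q R where "holo_fun_germ Q" "\<And>b. b < d \<Longrightarrow> holo_fun_germ (R b)"
    and "\<And>b z t. R b (upd_vec z j t) = R b z"
    and "\<And>l b z t. (\<And>z t. H (upd_vec z l t) = H z) \<Longrightarrow>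
      (\<And>b z t. b < d \<Longrightarrow> c b (upd_vec z l t) = c b z) \<Longrightarrow> R b (upd_vec z l t) = R b z"
    and "\<forall>\<^sub>F z in nhds 0. H z = (vec_nth z j ^ d + (\<Sum>b<d. c b z * vec_nth z j ^ b)) * Q z
      + (\<Sum>b<d. R b z * vec_nth z j ^ b)"
proof -
  define c' where "c' = (\<lambda>b z. if b < d then c b z else 1)"
  obtain \<rho> where \<rho>: "\<rho> > 0" "holo_fun_on H (ball 0 \<rho>)" "\<And>b. b < d \<Longrightarrow> holo_fun_on (c b) (ball 0 \<rho>)"
  proof -
    obtain e where e: "e > 0" "holo_fun_on H (ball 0 e)" using holo_fun_germ_ball[OF H] .
    obtain e' where e': "e' > 0" "\<And>b. b \<in> {..<d} \<Longrightarrow> holo_fun_on (c b) (ball 0 e')"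
      using holo_fun_germ_ball_family[of "{..<d}" c] c by auto
    show ?thesis
    proof (rule that[of "min e e'"])
      show "holo_fun_on H (ball 0 (min e e'))" by (rule holo_fun_on_subset[OF e(2)]) auto
      show "holo_fun_on (c b) (ball 0 (min e e'))" if "b < d" for b
        by (rule holo_fun_on_subset[OF e'(2)]) (use that in auto)
    qed (use e e' in auto)
  qed
  have c': "holo_fun_on (c' b) (ball 0 \<rho>)" for b
    using \<rho>(3) holo_fun_on_const by (cases "b < d") (auto simp: c'_def)
  define \<epsilon> where "\<epsilon> = min 1 (\<rho> / 3)"
  have \<epsilon>: "\<epsilon> > 0" "\<epsilon> \<le> 1" "\<epsilon> + \<epsilon> < \<rho>" using \<rho>(1) by (auto simp: \<epsilon>_def)
  define \<zeta> where "\<zeta> = (\<lambda>t::real. of_real \<epsilon> * exp (2 * of_real pi * \<i> * of_real t) :: complex)"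
  have norm_\<zeta>: "norm (\<zeta> t) = \<epsilon>" for t
    using \<epsilon>(1) by (simp add: \<zeta>_def norm_mult norm_exp_i_times[of "2 * pi * t", simplified] mult_ac)
  have cont_\<zeta>: "continuous_on A \<zeta>" for A
    unfolding \<zeta>_def by (intro continuous_intros)
  define P where "P = (\<lambda>z. vec_nth z j ^ d + (\<Sum>b<d. c b z * vec_nth z j ^ b))"
  have P: "holo_fun_on P (ball 0 \<rho>)"
    unfolding P_def
    by (intro holo_fun_on_add holo_fun_on_power holo_fun_on_sum holo_fun_on_mult
        holo_fun_on_component) (auto intro: \<rho>)
  have P_upd: "P (upd_vec z j s) = s ^ d + (\<Sum>b<d. c b z * s ^ b)" for z s
    using cj by (simp add: P_def)
  have P_poly: "P (upd_vec z j s) = (\<Sum>b\<le>d. c' b z * s ^ b)" for z s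
    by (simp add: P_upd c'_def lessThan_Suc_atMost[symmetric])
  define \<kappa> where "\<kappa> = (\<lambda>b z. \<Sum>k=Suc b..d. c' k z * vec_nth z j ^ (k - Suc b))"
  have \<kappa>: "holo_fun_on (\<kappa> b) (ball 0 \<rho>)" for b
    unfolding \<kappa>_def
    by (intro holo_fun_on_power holo_fun_on_sum holo_fun_on_mult holo_fun_on_component c') auto
  have c'_upd: "c' b (upd_vec z j t) = c' b z" for b z t
    using cj by (simp add: c'_def)
  have P_diff: "P (upd_vec z j u) - P z = (u - vec_nth z j) *
      (\<Sum>b<d. \<kappa> b (upd_vec z j u) * vec_nth z j ^ b)" for z u
  proof -
    have "P z = P (upd_vec z j (vec_nth z j))" by simp
    then have "P (upd_vec z j u) - P z =
        - ((\<Sum>b\<le>d. c' b z * vec_nth z j ^ b) - (\<Sum>b\<le>d. c' b z * u ^ b))"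
      unfolding P_poly by simp
    also have "\<dots> = (u - vec_nth z j) *
        (\<Sum>b<d. \<Sum>k=Suc b..d. c' k z * u ^ (k - Suc b) * vec_nth z j ^ b)"
      unfolding sub_polyfun by (simp add: algebra_simps)
    finally show ?thesis by (simp add: \<kappa>_def c'_upd sum_distrib_right)
  qed
  \<comment> \<open>On the circle the leading term of \<open>P\<close> dominates the others.\<close>
  obtain \<delta> where \<delta>: "0 < \<delta>" "\<delta> \<le> \<epsilon>"
    "\<And>z u. z \<in> ball 0 \<delta> \<Longrightarrow> norm u = \<epsilon> \<Longrightarrow> P (upd_vec z j u) \<noteq> 0"
  proof -
    have "((\<lambda>z. \<Sum>b<d. norm (c b z)) \<longlongrightarrow> (\<Sum>b<d. norm (c b 0))) (nhds 0)"
    proof (intro tendsto_sum tendsto_norm)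
      fix b assume "b \<in> {..<d}"
      then have "isCont (c b) 0" using holo_fun_germ_isCont[OF c] by simp
      then show "(c b \<longlongrightarrow> c b 0) (nhds 0)"
        by (simp add: isCont_def tendsto_at_iff_tendsto_nhds)
    qed
    then have "\<forall>\<^sub>F z in nhds 0. (\<Sum>b<d. norm (c b z)) < \<epsilon> ^ d"
      by (rule order_tendstoD) (use c0 \<epsilon> in auto)
    then obtain e where e: "e > 0" "\<And>z. dist z 0 < e \<Longrightarrow> (\<Sum>b<d. norm (c b z)) < \<epsilon> ^ d"
      unfolding eventually_nhds_metric by blast
    show ?thesis
    proof (rule that[of "min e \<epsilon>"])
      fix z :: "complex^'k" and u :: complex assume z: "z \<in> ball 0 (min e \<epsilon>)" and u: "norm u = \<epsilon>"
      have "norm (\<Sum>b<d. c b z * u ^ b) \<le> (\<Sum>b<d. norm (c b z * u ^ b))" by (rule norm_sum)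
      also have "\<dots> \<le> (\<Sum>b<d. norm (c b z))"
        using \<epsilon> u power_le_one[of "norm u"]
        by (intro sum_mono) (simp add: norm_mult norm_power mult_left_le del: mult_le_cancel_left1)
      also have "\<dots> < \<epsilon> ^ d" using e z by (simp add: dist_commute)
      also have "\<epsilon> ^ d = norm (u ^ d)" using u by (simp add: norm_power)
      finally show "P (upd_vec z j u) \<noteq> 0"
        unfolding P_upd by (metis add_eq_0_iff norm_minus_cancel order_less_irrefl)
    qed (use e \<epsilon> in auto)
  qed
  have upd_ball: "upd_vec z j u \<in> ball 0 \<rho>" if "z \<in> ball 0 \<delta>" "norm u \<le> \<epsilon>" for z u
    using norm_upd_vec_le[of z j u] that \<delta>(2) \<epsilon>(3) by simp
  \<comment> \<open>The integrands are holomorphic in the point and the integration variable together.\<close>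
  define \<Omega> :: "(complex^('k option)) set" where
    "\<Omega> = {p. (\<chi> i. vec_nth p (Some i)) \<in> ball 0 \<delta> \<and>
       upd_vec (\<chi> i. vec_nth p (Some i)) j (vec_nth p None) \<in> ball 0 \<rho> \<and>
       P (upd_vec (\<chi> i. vec_nth p (Some i)) j (vec_nth p None)) \<noteq> 0 \<and>
       vec_nth p None \<noteq> vec_nth p (Some j)}"
  define pr where "pr = (\<lambda>p :: complex^('k option). (\<chi> i. vec_nth p (Some i)) :: complex^'k)"
  define up where "up = (\<lambda>p :: complex^('k option). upd_vec (pr p) j (vec_nth p None))"
  have cont_pr: "continuous_on UNIV pr" unfolding pr_def
    by (intro continuous_on_vec_lambda continuous_intros)
  have cont_up: "continuous_on UNIV up" unfolding up_def upd_vec_def pr_def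
  proof (rule continuous_on_vec_lambda)
    show "continuous_on UNIV (\<lambda>p :: complex^('k option).
        if i = j then vec_nth p None else vec_nth (\<chi> i. vec_nth p (Some i)) i)" for i
      by (cases "i = j") (auto intro!: continuous_intros)
  qed
  have \<Omega>: "\<Omega> = {p. pr p \<in> ball 0 \<delta> \<and> up p \<in> ball 0 \<rho> \<and> P (up p) \<noteq> 0 \<and>
      vec_nth p None \<noteq> vec_nth p (Some j)}"
    by (simp add: \<Omega>_def up_def pr_def)
  have open_\<Omega>: "open \<Omega>"
  proof -
    have 1: "open (pr -` ball 0 \<delta>)" "open (up -` ball 0 \<rho>)"
      using cont_pr cont_up by (auto simp: continuous_on_open_vimage)
    have "continuous_on (up -` ball 0 \<rho>) (\<lambda>p. P (up p))"
      by (rule continuous_on_compose2[OF holo_fun_on_continuous_on[OF P] continuous_on_subset[OF cont_up]])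
        auto
    then have 2: "open (up -` ball 0 \<rho> \<inter> (\<lambda>p. P (up p)) -` (- {0}))"
      by (rule continuous_open_preimage[OF _ 1(2)]) auto
    have 3: "open {p :: complex^('k option). vec_nth p None \<noteq> vec_nth p (Some j)}"
      by (intro open_Collect_neq continuous_intros)
    have 4: "\<Omega> = pr -` ball 0 \<delta> \<inter> (up -` ball 0 \<rho> \<inter> (\<lambda>p. P (up p)) -` (- {0})) \<inter>
        {p. vec_nth p None \<noteq> vec_nth p (Some j)}"
      unfolding \<Omega> by auto
    show ?thesis unfolding 4 by (intro open_Int 1(1) 2 3)
  qed
  have in_\<Omega>: "extend_vec z (\<zeta> t) \<in> \<Omega>" if "z \<in> ball 0 \<delta>" for z t
  proof -
    have "norm (vec_nth z j) < \<epsilon>" using that \<delta>(2) Finite_Cartesian_Product.norm_nth_le[of z j] by simp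
    then have "\<zeta> t \<noteq> vec_nth z j" using norm_\<zeta>[of t] by auto
    then show ?thesis using that upd_ball[OF that] \<delta>(3)[OF that] norm_\<zeta> by (auto simp: \<Omega>_def)
  qed
  have holo_up: "holo_fun_on (\<lambda>p. F (up p)) \<Omega>" if "holo_fun_on F (ball 0 \<rho>)" for F
  proof (rule holo_fun_on_compose'[OF that])
    show "holo_fun_on (\<lambda>p. vec_nth (up p) i) \<Omega>" for i
      using open_\<Omega> by (cases "i = j") (simp_all add: up_def pr_def holo_fun_on_component)
    show "open \<Omega>" by (rule open_\<Omega>)
    show "up p \<in> ball 0 \<rho>" if "p \<in> \<Omega>" for p using that by (simp add: \<Omega>)
  qed
  have up_extend: "up (extend_vec z u) = upd_vec z j u" for z u
    by (simp add: up_def pr_def)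
  define R where "R = (\<lambda>b z. integral {0..1} (\<lambda>t. H (upd_vec z j (\<zeta> t)) * \<kappa> b (upd_vec z j (\<zeta> t)) *
      \<zeta> t / P (upd_vec z j (\<zeta> t))))"
  define Q where "Q = (\<lambda>z. integral {0..1} (\<lambda>t. H (upd_vec z j (\<zeta> t)) * \<zeta> t /
      (P (upd_vec z j (\<zeta> t)) * (\<zeta> t - vec_nth z j))))"
  have R_holo: "holo_fun_on (R b) (ball 0 \<delta>)" for b
  proof -
    have "holo_fun_on (\<lambda>p. H (up p) * \<kappa> b (up p) * vec_nth p None / P (up p)) \<Omega>"
      by (intro holo_fun_on_divide holo_fun_on_mult holo_up \<rho> \<kappa> P holo_fun_on_component open_\<Omega>)
        (auto simp: \<Omega>)
    from holo_fun_on_integral[OF this open_ball[of 0 \<delta>] cont_\<zeta> in_\<Omega>]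
    show ?thesis by (simp add: R_def up_extend)
  qed
  have Q_holo: "holo_fun_on Q (ball 0 \<delta>)"
  proof -
    have "holo_fun_on (\<lambda>p. H (up p) * vec_nth p None / (P (up p) * (vec_nth p None - vec_nth p (Some j)))) \<Omega>"
      by (intro holo_fun_on_divide holo_fun_on_mult holo_up \<rho> P holo_fun_on_component
          holo_fun_on_diff open_\<Omega>) (auto simp: \<Omega>)
    from holo_fun_on_integral[OF this open_ball[of 0 \<delta>] cont_\<zeta> in_\<Omega>]
    show ?thesis by (simp add: Q_def up_extend)
  qed
  have division: "H z = P z * Q z + (\<Sum>b<d. R b z * vec_nth z j ^ b)" if z: "z \<in> ball 0 \<delta>" for z
  proof -
    define k where "k = (\<lambda>u. H (upd_vec z j u))"
    have upd_line: "upd_vec z j u = upd_vec z j 0 + u *s axis j 1" for u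
      by (auto simp: Finite_Cartesian_Product.vec_eq_iff axis_def)
    have "(k has_field_derivative frechet_derivative H (at (upd_vec z j u)) (axis j 1)) (at u)"
      if "norm u \<le> \<epsilon>" for u
      using holo_fun_on_line[OF \<rho>(2), of "upd_vec z j 0" u "axis j 1"] upd_ball[OF z that]
      by (simp add: k_def upd_line[symmetric])
    then have "k holomorphic_on cball 0 \<epsilon>"
      by (intro holomorphic_onI)
        (auto simp: field_differentiable_def intro: has_field_derivative_at_within)
    moreover have zj: "norm (vec_nth z j) < \<epsilon>" using z \<delta>(2) Finite_Cartesian_Product.norm_nth_le[of z j] by simp
    ultimately have 1: "((\<lambda>t. k (\<zeta> t) * \<zeta> t / (\<zeta> t - vec_nth z j)) has_integral k (vec_nth z j)) {0..1}"
      unfolding \<zeta>_def by (rule Cauchy_mean_value)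
    have cont: "continuous_on {0..1} (\<lambda>t. F (upd_vec z j (\<zeta> t)))" if "holo_fun_on F (ball 0 \<rho>)" for F
    proof (rule continuous_on_compose2[OF holo_fun_on_continuous_on[OF that]])
      show "continuous_on {0..1} (\<lambda>t. upd_vec z j (\<zeta> t))"
        unfolding upd_vec_def
      proof (rule continuous_on_vec_lambda)
        show "continuous_on {0..1} (\<lambda>t. if i = j then \<zeta> t else vec_nth z i)" for i
          by (cases "i = j") (auto intro!: continuous_intros cont_\<zeta>)
      qed
    qed (use upd_ball[OF z] norm_\<zeta> in auto)
    have nz: "P (upd_vec z j (\<zeta> t)) \<noteq> 0" "\<zeta> t \<noteq> vec_nth z j" for t
      using \<delta>(3)[OF z] norm_\<zeta>[of t] zj by auto
    have iR: "(\<lambda>t. H (upd_vec z j (\<zeta> t)) * \<kappa> b (upd_vec z j (\<zeta> t)) * \<zeta> t / P (upd_vec z j (\<zeta> t)))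
        integrable_on {0..1}" for b
      by (intro integrable_continuous_interval continuous_intros cont \<rho> \<kappa> P cont_\<zeta>) (use nz in auto)
    have iQ: "(\<lambda>t. H (upd_vec z j (\<zeta> t)) * \<zeta> t / (P (upd_vec z j (\<zeta> t)) * (\<zeta> t - vec_nth z j)))
        integrable_on {0..1}"
      by (intro integrable_continuous_interval continuous_intros cont \<rho> P cont_\<zeta>) (use nz in auto)
    have "((\<lambda>t. P z * (H (upd_vec z j (\<zeta> t)) * \<zeta> t / (P (upd_vec z j (\<zeta> t)) * (\<zeta> t - vec_nth z j)))
        + (\<Sum>b<d. H (upd_vec z j (\<zeta> t)) * \<kappa> b (upd_vec z j (\<zeta> t)) * \<zeta> t / P (upd_vec z j (\<zeta> t))
            * vec_nth z j ^ b)) has_integral (P z * Q z + (\<Sum>b<d. R b z * vec_nth z j ^ b))) {0..1}"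
      unfolding Q_def R_def
      by (intro has_integral_add has_integral_mult_right has_integral_sum has_integral_mult_left
          integrable_integral iQ iR) auto
    also have "(\<lambda>t. P z * (H (upd_vec z j (\<zeta> t)) * \<zeta> t / (P (upd_vec z j (\<zeta> t)) * (\<zeta> t - vec_nth z j)))
        + (\<Sum>b<d. H (upd_vec z j (\<zeta> t)) * \<kappa> b (upd_vec z j (\<zeta> t)) * \<zeta> t / P (upd_vec z j (\<zeta> t))
            * vec_nth z j ^ b)) = (\<lambda>t. k (\<zeta> t) * \<zeta> t / (\<zeta> t - vec_nth z j))"
    proof
      fix t
      define p a h s where "p = P (upd_vec z j (\<zeta> t))" and "a = \<zeta> t - vec_nth z j"
        and "h = H (upd_vec z j (\<zeta> t)) * \<zeta> t"
        and "s = (\<Sum>b<d. \<kappa> b (upd_vec z j (\<zeta> t)) * vec_nth z j ^ b)"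
      have "(\<Sum>b<d. H (upd_vec z j (\<zeta> t)) * \<kappa> b (upd_vec z j (\<zeta> t)) * \<zeta> t / P (upd_vec z j (\<zeta> t))
            * vec_nth z j ^ b) = h * s / p"
        by (simp add: p_def h_def s_def sum_distrib_left sum_divide_distrib mult_ac)
      moreover have "p - P z = a * s"
        using P_diff[of z "\<zeta> t"] by (simp add: p_def a_def s_def)
      then have "P z = p - a * s" by (simp add: diff_eq_eq eq_diff_eq add.commute)
      moreover have "p \<noteq> 0" "a \<noteq> 0" using nz by (auto simp: p_def a_def)
      then have "(p - a * s) * (h / (p * a)) + h * s / p = h / a"
        by (simp add: divide_simps) (simp add: algebra_simps)
      ultimately show "P z * (H (upd_vec z j (\<zeta> t)) * \<zeta> t / (P (upd_vec z j (\<zeta> t)) * (\<zeta> t - vec_nth z j)))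
        + (\<Sum>b<d. H (upd_vec z j (\<zeta> t)) * \<kappa> b (upd_vec z j (\<zeta> t)) * \<zeta> t / P (upd_vec z j (\<zeta> t))
            * vec_nth z j ^ b) = k (\<zeta> t) * \<zeta> t / (\<zeta> t - vec_nth z j)"
        unfolding k_def p_def[symmetric] a_def[symmetric] h_def[symmetric] by simp
    qed
    finally have 2: "((\<lambda>t. k (\<zeta> t) * \<zeta> t / (\<zeta> t - vec_nth z j)) has_integral
        (P z * Q z + (\<Sum>b<d. R b z * vec_nth z j ^ b))) {0..1}" .
    show ?thesis using has_integral_unique[OF 1 2] by (simp add: k_def)
  qed
  show ?thesis
  proof (rule that[of Q R])
    show "holo_fun_germ Q" "holo_fun_germ (R b)" for b
      using Q_holo R_holo \<delta>(1) holo_fun_germI_ball by blast+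
    show R_j: "R b (upd_vec z j t) = R b z" for b z t by (simp add: R_def)
    show "R b (upd_vec z l t) = R b z"
      if Hl: "\<And>z t. H (upd_vec z l t) = H z"
        and cl: "\<And>b z t. b < d \<Longrightarrow> c b (upd_vec z l t) = c b z" for l b z t
    proof (cases "l = j")
      case False
      have "c' b (upd_vec z l t) = c' b z" for b z t using cl by (simp add: c'_def)
      moreover have "P (upd_vec z l t) = P z" for z t using cl False by (simp add: P_def)
      ultimately show ?thesis
        using Hl False by (simp add: R_def \<kappa>_def upd_vec_commute[of l j])
    qed (simp add: R_j)
    have "\<forall>\<^sub>F z in nhds 0. z \<in> ball 0 \<delta>" using \<delta>(1) by (intro eventually_nhds_in_open) auto
    then show "\<forall>\<^sub>F z in nhds 0. H z = (vec_nth z j ^ d + (\<Sum>b<d. c b z * vec_nth z j ^ b)) * Q z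
      + (\<Sum>b<d. R b z * vec_nth z j ^ b)"
      by eventually_elim (use division in \<open>simp add: P_def\<close>)
  qed
qed

section \<open>Injective holomorphic maps are generically immersive\<close>

lemma holo_map_on_component: "holo_map_on f U \<Longrightarrow> holo_fun_on (\<lambda>x. vec_nth (f x) k) U"
  by (simp add: holo_map_on_def)

text \<open>
  Consider the local coordinate systems of the source, at any point of \<open>W\<close>, that consist of
  components of \<open>f\<close> and of linear coordinates, and take one with the greatest number of components
  of \<open>f\<close>. If a linear coordinate is left in it, then no component of \<open>f\<close> varies along the curves on
  which only that coordinate changes, as it could replace the coordinate otherwise; so \<open>f\<close> is
  constant on such a curve. Hence the components of \<open>f\<close> alone are local coordinates.
\<close>

lemma injective_holo_map_immersive:
  fixes f :: "complex^'n \<Rightarrow> complex^'m"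
  assumes W: "open W" "W \<noteq> {}" and f: "holo_map_on f W" and inj: "inj_on f W"
  obtains x where "x \<in> W"
    and "\<And>\<xi>. (\<And>k. frechet_derivative (\<lambda>x. vec_nth (f x) k) (at x) \<xi> = 0) \<Longrightarrow> \<xi> = 0"
proof -
  define fd where "fd = (\<lambda>k x v. frechet_derivative (\<lambda>x. vec_nth (f x) k) (at x) v)"
  \<comment> \<open>The coordinates described by \<open>\<sigma>\<close>: a component of \<open>f\<close> at \<open>Some k\<close>, a linear one at \<open>None\<close>.\<close>
  define F where "F = (\<lambda>\<sigma> x. (\<chi> i. case \<sigma> i of None \<Rightarrow> vec_nth x i | Some k \<Rightarrow> vec_nth (f x) k) :: complex^'n)"
  define D where "D = (\<lambda>\<sigma> x v. (\<chi> i. case \<sigma> i of None \<Rightarrow> vec_nth v i | Some k \<Rightarrow> fd k x v) :: complex^'n)"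
  define good where "good = (\<lambda>p. snd p \<in> W \<and> (\<forall>v. D (fst p) (snd p) v = 0 \<longrightarrow> v = 0))"
  define count where "count = (\<lambda>p :: ('n \<Rightarrow> 'm option) \<times> (complex^'n). card {i. fst p i \<noteq> None})"
  obtain x1 where "x1 \<in> W" using W(2) by blast
  then have "good (\<lambda>_. None, x1)"
    by (simp add: good_def D_def Finite_Cartesian_Product.vec_eq_iff)
  moreover have "\<forall>p. good p \<longrightarrow> count p \<le> CARD('n)"
    by (auto simp: count_def intro: card_mono)
  ultimately obtain p where p: "good p" "\<And>q. good q \<Longrightarrow> count q \<le> count p"
    using ex_has_greatest_nat[of good "(\<lambda>_. None, x1)" count "Suc CARD('n)"] by (metis less_Suc_eq_le)
  obtain \<sigma> x0 where p_eq: "p = (\<sigma>, x0)" by (cases p)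
  have x0: "x0 \<in> W" and inj0: "\<And>v. D \<sigma> x0 v = 0 \<Longrightarrow> v = 0"
    using p(1) by (auto simp: good_def p_eq)
  have maximal: "card {i. \<tau> i \<noteq> None} \<le> card {i. \<sigma> i \<noteq> None}"
    if "x \<in> W" "\<And>v. D \<tau> x v = 0 \<Longrightarrow> v = 0" for \<tau> x
    using p(2)[of "(\<tau>, x)"] that by (simp add: good_def count_def p_eq)
  have fd: "((\<lambda>x. vec_nth (f x) k) has_derivative fd k x) (at x)" if "x \<in> W" for k x
    unfolding fd_def using holo_fun_on_has_derivative[OF holo_map_on_component[OF f] that]
    by (simp add: eta_contract_eq)
  have fd_scale: "fd k x (c *s v) = c * fd k x v" if "x \<in> W" for k x c v
    unfolding fd_def by (rule holo_fun_on_derivative_scale[OF holo_map_on_component[OF f] that])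
  have D_scale: "D \<sigma> x (c *s v) = c *s D \<sigma> x v" if "x \<in> W" for x c v
    by (simp add: D_def Finite_Cartesian_Product.vec_eq_iff fd_scale[OF that] split: option.split)
  have F_deriv: "(F \<sigma> has_derivative D \<sigma> x) (at x)" if x: "x \<in> W" for x
  proof -
    have "((\<lambda>x. \<Sum>i\<in>UNIV. axis i (vec_nth (F \<sigma> x) i)) has_derivative
        (\<lambda>v. \<Sum>i\<in>UNIV. axis i (vec_nth (D \<sigma> x v) i))) (at x)"
    proof (intro has_derivative_sum)
      fix i :: 'n
      have "linear (axis i :: complex \<Rightarrow> complex^'n)"
        by (intro linearI) (auto simp: axis_def Finite_Cartesian_Product.vec_eq_iff)
      then have "bounded_linear (axis i :: complex \<Rightarrow> complex^'n)"
        by (simp add: linear_conv_bounded_linear)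
      moreover have "((\<lambda>x. vec_nth (F \<sigma> x) i) has_derivative (\<lambda>v. vec_nth (D \<sigma> x v) i)) (at x)"
        by (cases "\<sigma> i") (simp_all add: F_def D_def fd[OF x]
            bounded_linear_imp_has_derivative[OF bounded_linear_vec_nth])
      ultimately show "((\<lambda>x. axis i (vec_nth (F \<sigma> x) i)) has_derivative
          (\<lambda>v. axis i (vec_nth (D \<sigma> x v) i))) (at x)"
        by (rule bounded_linear.has_derivative)
    qed
    moreover have "(\<Sum>i\<in>UNIV. axis i (vec_nth y i)) = y" for y :: "complex^'n"
      by (simp add: Finite_Cartesian_Product.vec_eq_iff axis_def)
    ultimately show ?thesis by (simp add: eta_contract_eq)
  qed
  show ?thesis
  proof (cases "\<exists>i. \<sigma> i = None")
    case False
    show ?thesis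
    proof (rule that[OF x0])
      fix \<xi> assume "\<And>k. frechet_derivative (\<lambda>x. vec_nth (f x) k) (at x0) \<xi> = 0"
      then have fd0: "fd k x0 \<xi> = 0" for k by (simp add: fd_def)
      have "vec_nth (D \<sigma> x0 \<xi>) i = 0" for i
      proof -
        have "\<sigma> i \<noteq> None" using False by (metis (full_types))
        then obtain k where "\<sigma> i = Some k" by auto
        then show ?thesis by (simp add: D_def fd0)
      qed
      then have "D \<sigma> x0 \<xi> = 0" by (simp add: Finite_Cartesian_Product.vec_eq_iff)
      then show "\<xi> = 0" by (rule inj0)
    qed
  next
    case True
    then obtain i where i: "\<sigma> i = None" by blast
    \<comment> \<open>Local coordinates in which \<open>f\<close> does not depend on the \<open>i\<close>-th one.\<close>
    define F' where "F' = (\<lambda>x. Blinfun (D \<sigma> x))"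
    have F': "blinfun_apply (F' x) = D \<sigma> x" if "x \<in> W" for x
      unfolding F'_def by (rule bounded_linear_Blinfun_apply[OF has_derivative_bounded_linear[OF F_deriv[OF that]]])
    have cont: "continuous_on W F'"
    proof (rule continuous_on_blinfun_componentwise)
      fix v :: "complex^'n"
      have "continuous_on W (\<lambda>x. D \<sigma> x v)"
        unfolding D_def
      proof (rule continuous_on_vec_lambda)
        fix l
        show "continuous_on W (\<lambda>x. case \<sigma> l of None \<Rightarrow> vec_nth v l | Some k \<Rightarrow> fd k x v)"
          unfolding fd_def using holo_fun_on_derivative_continuous_on[OF holo_map_on_component[OF f]]
          by (cases "\<sigma> l") auto
      qed
      then show "continuous_on W (\<lambda>x. blinfun_apply (F' x) v)"
        by (rule continuous_on_eq) (simp add: F')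
    qed
    have lin0: "linear (D \<sigma> x0)"
      using has_derivative_linear[OF F_deriv[OF x0]] .
    have "inj (D \<sigma> x0)" using linear_injective_0[OF lin0] inj0 by blast
    then obtain h where h: "linear h" "h \<circ> D \<sigma> x0 = id"
      using linear_injective_left_inverse[OF lin0] by blast
    have "Blinfun h o\<^sub>L F' x0 = id_blinfun"
    proof (rule blinfun_eqI)
      fix v
      have "blinfun_apply (Blinfun h) = h"
        using h(1) by (intro bounded_linear_Blinfun_apply) (simp add: linear_conv_bounded_linear)
      then show "blinfun_apply (Blinfun h o\<^sub>L F' x0) v = blinfun_apply id_blinfun v"
        using fun_cong[OF h(2), of v] by (simp add: F'[OF x0])
    qed
    then obtain U' V G G' where UV: "open U'" "U' \<subseteq> W" "x0 \<in> U'" "open V" "F \<sigma> x0 \<in> V"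
      "homeomorphism U' V (F \<sigma>) G"
      and G: "\<And>y. y \<in> V \<Longrightarrow> (G has_derivative (G' y)) (at y)"
      "\<And>y. y \<in> V \<Longrightarrow> G' y = inv_into UNIV (blinfun_apply (F' (G y)))"
      "\<And>y. y \<in> V \<Longrightarrow> bij (blinfun_apply (F' (G y)))"
      using inverse_function_theorem[OF W(1) _ cont x0, of "F \<sigma>" "Blinfun h"] F_deriv F' by metis
    have GW: "G y \<in> W" if "y \<in> V" for y
      using UV(2,6) that by (auto simp: homeomorphism_def)
    have Ginj: "y = y'" if "y \<in> V" "y' \<in> V" "G y = G y'" for y y'
      using UV(6) that by (metis homeomorphism_apply2)
    define e where "e = (\<lambda>y. G' y (axis i 1))"
    have De: "D \<sigma> (G y) (e y) = axis i 1" if "y \<in> V" for y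
      using G(2,3)[OF that] F'[OF GW[OF that]] by (simp add: e_def bij_is_surj surj_f_inv_f)
    have D_inj: "v = v'" if "y \<in> V" "D \<sigma> (G y) v = D \<sigma> (G y) v'" for y v v'
      using G(3)[OF that(1)] that(2) F'[OF GW[OF that(1)]] by (simp add: bij_is_inj inj_eq)
    have fd_e: "fd k (G y) (e y) = 0" if y: "y \<in> V" for k y
    proof (rule ccontr)
      assume nz: "fd k (G y) (e y) \<noteq> 0"
      have "v = 0" if v: "D (\<sigma>(i := Some k)) (G y) v = 0" for v
      proof -
        have *: "vec_nth (D (\<sigma>(i := Some k)) (G y) v) l = 0" for l using v by simp
        have "D \<sigma> (G y) v = vec_nth v i *s axis i 1"
        proof -
          have "vec_nth (D \<sigma> (G y) v) l = 0" if "l \<noteq> i" for l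
            using *[of l] that by (simp add: D_def)
          moreover have "vec_nth (D \<sigma> (G y) v) i = vec_nth v i" by (simp add: D_def i)
          ultimately show ?thesis
            by (auto simp: Finite_Cartesian_Product.vec_eq_iff axis_def)
        qed
        also have "\<dots> = D \<sigma> (G y) (vec_nth v i *s e y)"
          by (simp add: D_scale[OF GW[OF y]] De[OF y])
        finally have v_eq: "v = vec_nth v i *s e y" using D_inj[OF y] by blast
        have "fd k (G y) v = 0" using *[of i] by (simp add: D_def)
        then have "vec_nth v i * fd k (G y) (e y) = 0"
          by (subst (asm) v_eq) (simp add: fd_scale[OF GW[OF y]])
        then have "vec_nth v i = 0" using nz by simp
        then show "v = 0" by (subst v_eq) simp
      qed
      from maximal[OF GW[OF y] this]
      have "card {l. (\<sigma>(i := Some k)) l \<noteq> None} \<le> card {l. \<sigma> l \<noteq> None}" .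
      moreover have "{l. (\<sigma>(i := Some k)) l \<noteq> None} = insert i {l. \<sigma> l \<noteq> None}" by auto
      ultimately show False using i by simp
    qed
    define y0 where "y0 = F \<sigma> x0"
    obtain d where d: "d > 0" "cball y0 d \<subseteq> V"
      using UV(4,5) open_contains_cball y0_def by blast
    define \<gamma> where "\<gamma> = (\<lambda>t::real. y0 + t *\<^sub>R axis i (1::complex))"
    have norm_axis: "norm (axis i (1::complex) :: complex^'n) = 1"
      by (simp add: norm_axis_1)
    have \<gamma>V: "\<gamma> t \<in> V" if "t \<in> {0..d}" for t
      using d that by (intro subsetD[OF d(2)]) (simp add: \<gamma>_def dist_norm norm_axis)
    have const: "vec_nth (f (G (\<gamma> d))) k = vec_nth (f (G (\<gamma> 0))) k" for k
    proof -
      have "((\<lambda>t. vec_nth (f (G (\<gamma> t))) k) has_derivative (\<lambda>_. 0)) (at t within {0..d})"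
        if t: "t \<in> {0..d}" for t
      proof -
        have 1: "(\<gamma> has_derivative (\<lambda>s. s *\<^sub>R axis i 1)) (at t)"
          unfolding \<gamma>_def by (auto intro!: derivative_eq_intros)
        have 2: "((\<lambda>t. G (\<gamma> t)) has_derivative (\<lambda>s. G' (\<gamma> t) (s *\<^sub>R axis i 1))) (at t)"
          using diff_chain_at[OF 1 G(1)[OF \<gamma>V[OF t]]] by (simp add: o_def)
        have 3: "((\<lambda>t. vec_nth (f (G (\<gamma> t))) k) has_derivative
            (\<lambda>s. fd k (G (\<gamma> t)) (G' (\<gamma> t) (s *\<^sub>R axis i 1)))) (at t)"
          using diff_chain_at[OF 2 fd[OF GW[OF \<gamma>V[OF t]]]] by (simp add: o_def)
        have "fd k (G (\<gamma> t)) (G' (\<gamma> t) (s *\<^sub>R axis i 1)) = 0" for s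
        proof -
          have "G' (\<gamma> t) (s *\<^sub>R axis i 1) = s *\<^sub>R e (\<gamma> t)"
            unfolding e_def by (rule linear_scale[OF has_derivative_linear[OF G(1)[OF \<gamma>V[OF t]]]])
          then show ?thesis
            using linear_scale[OF has_derivative_linear[OF fd[OF GW[OF \<gamma>V[OF t]]]]] fd_e[OF \<gamma>V[OF t]]
            by simp
        qed
        with 3 show ?thesis by (simp add: has_derivative_at_withinI)
      qed
      then have "\<exists>c. \<forall>t\<in>{0..d}. vec_nth (f (G (\<gamma> t))) k = c"
        by (intro has_derivative_zero_constant) auto
      then show ?thesis using d(1) by fastforce
    qed
    then have "f (G (\<gamma> d)) = f (G (\<gamma> 0))" by (simp add: Finite_Cartesian_Product.vec_eq_iff)
    then have "G (\<gamma> d) = G (\<gamma> 0)" using inj GW \<gamma>V d(1) by (auto dest!: inj_onD)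
    then have "\<gamma> d = \<gamma> 0" using Ginj \<gamma>V d(1) by auto
    then have "d *\<^sub>R axis i (1::complex) = (0 :: complex^'n)" by (simp add: \<gamma>_def)
    then have False using d(1) norm_axis by auto
    then show ?thesis ..
  qed
qed

section \<open>Joint eigenvectors\<close>

text \<open>
  Vectors are functions on the natural numbers with pointwise operations, so that the forms on a
  fibre, whose number of entries is a variable, need no type of their own.
\<close>

definition closed_lin :: "(nat \<Rightarrow> complex) set \<Rightarrow> bool" where
  "closed_lin Z \<longleftrightarrow> (\<lambda>_. 0) \<in> Z \<and> (\<forall>u\<in>Z. \<forall>v\<in>Z. \<forall>a b. (\<lambda>i. a * u i + b * v i) \<in> Z)"

definition lin_op :: "((nat \<Rightarrow> complex) \<Rightarrow> (nat \<Rightarrow> complex)) \<Rightarrow> bool" where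
  "lin_op A \<longleftrightarrow> (\<forall>u v a b. A (\<lambda>i. a * u i + b * v i) = (\<lambda>i. a * A u i + b * A v i))"

definition poly_op :: "((nat \<Rightarrow> complex) \<Rightarrow> (nat \<Rightarrow> complex)) \<Rightarrow> complex poly \<Rightarrow> (nat \<Rightarrow> complex) \<Rightarrow> (nat \<Rightarrow> complex)" where
  "poly_op A p u = (\<lambda>i. \<Sum>b\<le>Polynomial.degree p. Polynomial.coeff p b * (A ^^ b) u i)"

lemma closed_linD: "closed_lin Z \<Longrightarrow> u \<in> Z \<Longrightarrow> v \<in> Z \<Longrightarrow> (\<lambda>i. a * u i + b * v i) \<in> Z"
  by (simp add: closed_lin_def)

lemma lin_opD: "lin_op A \<Longrightarrow> A (\<lambda>i. a * u i + b * v i) = (\<lambda>i. a * A u i + b * A v i)"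
  by (simp add: lin_op_def)

lemma lin_op_funpow: "lin_op A \<Longrightarrow> lin_op (A ^^ b)"
  by (induction b) (auto simp: lin_op_def)

lemma poly_op_superset: "Polynomial.degree p \<le> d \<Longrightarrow> poly_op A p u i = (\<Sum>b\<le>d. Polynomial.coeff p b * (A ^^ b) u i)"
  unfolding poly_op_def by (rule sum.mono_neutral_left) (auto simp: coeff_eq_0)

lemma poly_op_linear_factor:
  assumes A: "lin_op A"
  shows "poly_op A ([:- \<psi>, 1:] * q) u = poly_op A q (\<lambda>i. A u i - \<psi> * u i)"
proof
  fix i
  let ?p = "[:- \<psi>, 1:] * q" and ?d = "Polynomial.degree q"
  have Ab: "(A ^^ b) (\<lambda>i. A u i - \<psi> * u i) i = (A ^^ Suc b) u i - \<psi> * (A ^^ b) u i" for b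
    using lin_opD[OF lin_op_funpow[OF A, of b], of 1 "A u" "- \<psi>" u]
    by (simp add: funpow_swap1)
  have "Polynomial.degree ?p \<le> Suc ?d"
    using degree_mult_le[of "[:- \<psi>, 1:]" q] by (simp add: degree_pCons_eq_if)
  then have "poly_op A ?p u i = (\<Sum>b\<le>Suc ?d. Polynomial.coeff ?p b * (A ^^ b) u i)"
    by (rule poly_op_superset)
  also have "\<dots> = (\<Sum>b\<le>Suc ?d. Polynomial.coeff (pCons 0 q) b * (A ^^ b) u i) -
      (\<Sum>b\<le>Suc ?d. \<psi> * Polynomial.coeff q b * (A ^^ b) u i)"
    unfolding sum_subtractf[symmetric] by (intro sum.cong) (auto simp: left_diff_distrib)
  also have "(\<Sum>b\<le>Suc ?d. Polynomial.coeff (pCons 0 q) b * (A ^^ b) u i) = (\<Sum>b\<le>?d. Polynomial.coeff q b * (A ^^ Suc b) u i)"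
    by (subst sum.atMost_Suc_shift) simp
  also have "(\<Sum>b\<le>Suc ?d. \<psi> * Polynomial.coeff q b * (A ^^ b) u i) = (\<Sum>b\<le>?d. \<psi> * Polynomial.coeff q b * (A ^^ b) u i)"
    by (simp add: coeff_eq_0)
  finally show "poly_op A ?p u i = poly_op A q (\<lambda>i. A u i - \<psi> * u i) i"
    unfolding poly_op_def Ab by (simp add: sum_subtractf right_diff_distrib mult_ac)
qed

text \<open>
  The linear factors of \<open>p\<close> are applied to \<open>u\<close> one after the other; the last vector outside \<open>Y\<close> is an
  eigenvector modulo \<open>Y\<close>.
\<close>

lemma eigenvector_modulo:
  assumes A: "lin_op A" "\<And>u. u \<in> Z \<Longrightarrow> A u \<in> Z" and Z: "closed_lin Z" and Y: "closed_lin Y"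
    and p: "p \<noteq> 0" and u: "u \<in> Z" "u \<notin> Y" and pu: "poly_op A p u \<in> Y"
  shows "\<exists>v\<in>Z - Y. \<exists>\<psi>. (\<lambda>i. A v i - \<psi> * v i) \<in> Y"
  using p u pu
proof (induction "Polynomial.degree p" arbitrary: p u)
  case 0
  then obtain a where a: "p = [:a:]" "a \<noteq> 0" by (metis degree_eq_zeroE pCons_0_0)
  then have "poly_op A p u = (\<lambda>i. a * u i)" by (simp add: poly_op_def)
  then have "(\<lambda>i. a * u i) \<in> Y" using 0 by simp
  from closed_linD[OF Y this this, of "1 / a" 0] have "u \<in> Y" using a by simp
  then show ?case using 0 by simp
next
  case (Suc d)
  then have "\<not> constant (poly p)" by (simp add: constant_degree)
  then obtain \<psi> where "poly p \<psi> = 0" using fundamental_theorem_of_algebra by blast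
  then obtain q where q: "p = [:- \<psi>, 1:] * q" by (auto simp: poly_eq_0_iff_dvd elim: dvdE)
  have q0: "q \<noteq> 0" using Suc.prems q by auto
  have "Polynomial.degree p = Suc (Polynomial.degree q)" unfolding q using q0 by (subst degree_mult_eq) auto
  then have dq: "d = Polynomial.degree q" using Suc.hyps by simp
  define v where "v = (\<lambda>i. A u i - \<psi> * u i)"
  show ?case
  proof (cases "v \<in> Y")
    case True
    then show ?thesis using Suc.prems by (auto simp: v_def)
  next
    case False
    have "v \<in> Z" using closed_linD[OF Z A(2) , of u u 1 "- \<psi>"] Suc.prems by (simp add: v_def)
    moreover have "poly_op A q v \<in> Y"
      using Suc.prems poly_op_linear_factor[OF A(1)] by (simp add: q v_def)
    ultimately show ?thesis using Suc.hyps(1)[OF dq q0] False by blast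
  qed
qed

text \<open>
  The vectors that one of the operators multiplies by a fixed scalar modulo \<open>Y\<close> form a subspace,
  which the operators commuting with it preserve.
\<close>

lemma joint_eigenvector_modulo:
  assumes "finite J" and Y: "closed_lin Y" and lin: "\<And>j. j \<in> J \<Longrightarrow> lin_op (A j)"
    and AY: "\<And>j u. j \<in> J \<Longrightarrow> u \<in> Y \<Longrightarrow> A j u \<in> Y"
    and Z: "closed_lin Z" "\<And>j u. j \<in> J \<Longrightarrow> u \<in> Z \<Longrightarrow> A j u \<in> Z"
    and comm: "\<And>j l u. j \<in> J \<Longrightarrow> l \<in> J \<Longrightarrow> u \<in> Z \<Longrightarrow> A j (A l u) = A l (A j u)"
    and p: "\<And>j. j \<in> J \<Longrightarrow> p j \<noteq> 0" "\<And>j u. j \<in> J \<Longrightarrow> u \<in> Z \<Longrightarrow> poly_op (A j) (p j) u \<in> Y"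
    and w: "w \<in> Z" "w \<notin> Y"
  shows "\<exists>u\<in>Z - Y. \<exists>\<psi>. \<forall>j\<in>J. (\<lambda>i. A j u i - \<psi> j * u i) \<in> Y"
  using assms(1) lin AY Z comm p w
proof (induction J arbitrary: Z w rule: finite_induct)
  case empty
  then show ?case by blast
next
  case (insert j J)
  have "\<exists>v\<in>Z - Y. \<exists>\<psi>. (\<lambda>i. A j v i - \<psi> * v i) \<in> Y"
    by (rule eigenvector_modulo[of "A j" Z Y "p j" w]) (use insert.prems Y in auto)
  then obtain v \<psi> where v: "v \<in> Z" "v \<notin> Y" "(\<lambda>i. A j v i - \<psi> * v i) \<in> Y" by blast
  define Z' where "Z' = {z \<in> Z. (\<lambda>i. A j z i - \<psi> * z i) \<in> Y}"
  have "\<exists>u\<in>Z' - Y. \<exists>\<psi>. \<forall>j\<in>J. (\<lambda>i. A j u i - \<psi> j * u i) \<in> Y"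
  proof (rule insert.IH)
    show "closed_lin Z'"
      unfolding closed_lin_def
    proof (intro conjI ballI allI)
      have "A j (\<lambda>_. 0) = (\<lambda>_. 0)" using lin_opD[OF insert.prems(1)[of j], of 0 v 0 v] by simp
      then show "(\<lambda>_. 0) \<in> Z'" using insert.prems(3) Y by (simp add: Z'_def closed_lin_def)
      fix u z a b assume uz: "u \<in> Z'" "z \<in> Z'"
      have "(\<lambda>i. A j (\<lambda>i. a * u i + b * z i) i - \<psi> * (a * u i + b * z i)) =
          (\<lambda>i. a * (A j u i - \<psi> * u i) + b * (A j z i - \<psi> * z i))"
        using lin_opD[OF insert.prems(1)[of j], of a u b z] by (simp add: algebra_simps)
      moreover have "(\<lambda>i. a * (A j u i - \<psi> * u i) + b * (A j z i - \<psi> * z i)) \<in> Y"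
        using uz by (intro closed_linD[OF Y]) (auto simp: Z'_def)
      ultimately show "(\<lambda>i. a * u i + b * z i) \<in> Z'"
        using uz closed_linD[OF insert.prems(3)] by (simp add: Z'_def)
    qed
    show "A l u \<in> Z'" if l: "l \<in> J" "u \<in> Z'" for l u
    proof -
      have u: "u \<in> Z" using l by (simp add: Z'_def)
      have "A l (\<lambda>i. 1 * A j u i + (- \<psi>) * u i) \<in> Y"
        using l by (intro insert.prems(2)) (auto simp: Z'_def)
      also have "A l (\<lambda>i. 1 * A j u i + (- \<psi>) * u i) = (\<lambda>i. 1 * A l (A j u) i + (- \<psi>) * A l u i)"
        using l by (intro lin_opD insert.prems) auto
      also have "A l (A j u) = A j (A l u)" using l u by (intro insert.prems) auto
      finally show ?thesis using l u insert.prems(4)[of l u] by (simp add: Z'_def)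
    qed
    show "v \<in> Z'" using v by (simp add: Z'_def)
  qed (use insert.prems v in \<open>auto simp: Z'_def\<close>)
  then obtain u \<psi>' where u: "u \<in> Z'" "u \<notin> Y" "\<forall>j\<in>J. (\<lambda>i. A j u i - \<psi>' j * u i) \<in> Y" by blast
  have "\<forall>l\<in>insert j J. (\<lambda>i. A l u i - (\<psi>'(j := \<psi>)) l * u i) \<in> Y"
    using u insert.hyps by (auto simp: Z'_def)
  moreover have "u \<in> Z - Y" using u by (simp add: Z'_def)
  ultimately show ?case by blast
qed

text \<open>
  If a family of commuting operators has, up to scalars, a single joint eigenvector \<open>g\<close> but the
  space is larger than its span, then some vector is a generalised eigenvector of the second level.
  A joint eigenvector modulo \<open>g\<close> with other eigenvalues could be corrected by a multiple of \<open>g\<close>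
  to a joint eigenvector.
\<close>

lemma second_level_eigenvector:
  fixes A :: "'j::finite \<Rightarrow> (nat \<Rightarrow> complex) \<Rightarrow> (nat \<Rightarrow> complex)"
  assumes lin: "\<And>j. lin_op (A j)" and Z: "closed_lin Z" "\<And>j u. u \<in> Z \<Longrightarrow> A j u \<in> Z"
    and comm: "\<And>j l u. u \<in> Z \<Longrightarrow> A j (A l u) = A l (A j u)"
    and p: "\<And>j. p j \<noteq> 0" "\<And>j u. u \<in> Z \<Longrightarrow> poly_op (A j) (p j) u = (\<lambda>_. 0)"
    and g: "g \<in> Z" "g \<noteq> (\<lambda>_. 0)" "\<And>j. A j g = (\<lambda>i. x j * g i)"
    and single: "\<And>u \<psi>. u \<in> Z \<Longrightarrow> (\<And>j. A j u = (\<lambda>i. \<psi> j * u i)) \<Longrightarrow> \<exists>c. u = (\<lambda>i. c * g i)"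
    and w: "w \<in> Z" "\<And>c. w \<noteq> (\<lambda>i. c * g i)"
  shows "\<exists>u\<in>Z. \<exists>\<xi>. \<xi> \<noteq> (\<lambda>_. 0) \<and> (\<forall>j. A j u = (\<lambda>i. x j * u i + \<xi> j * g i))"
proof -
  define Y where "Y = {u. \<exists>c. u = (\<lambda>i. c * g i)}"
  have Y: "closed_lin Y"
    unfolding closed_lin_def
  proof (intro conjI ballI allI)
    show "(\<lambda>_. 0) \<in> Y" by (auto simp: Y_def intro: exI[of _ 0])
    fix u v a b assume "u \<in> Y" "v \<in> Y"
    then obtain c c' where "u = (\<lambda>i. c * g i)" "v = (\<lambda>i. c' * g i)" by (auto simp: Y_def)
    then show "(\<lambda>i. a * u i + b * v i) \<in> Y"
      by (auto simp: Y_def algebra_simps intro!: exI[of _ "a * c + b * c'"])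
  qed
  have scale: "A j (\<lambda>i. c * u i) = (\<lambda>i. c * A j u i)" for j c u
    using lin_opD[OF lin[of j], of c u 0 u] by simp
  have "\<exists>u\<in>Z - Y. \<exists>\<psi>. \<forall>j\<in>UNIV. (\<lambda>i. A j u i - \<psi> j * u i) \<in> Y"
  proof (rule joint_eigenvector_modulo[where p = p and w = w])
    show "A j u \<in> Y" if uY: "u \<in> Y" for j u
    proof -
      obtain c where "u = (\<lambda>i. c * g i)" using uY unfolding Y_def by blast
      then have "A j u = (\<lambda>i. (c * x j) * g i)" by (simp add: scale g(3) mult.assoc)
      then show ?thesis unfolding Y_def by blast
    qed
    show "poly_op (A j) (p j) u \<in> Y" if "u \<in> Z" for j u
      using p(2)[OF that] Y by (simp add: closed_lin_def)
  qed (use lin Y Z comm p w in \<open>auto simp: Y_def\<close>)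
  then obtain u \<psi> where u: "u \<in> Z" "u \<notin> Y" and "\<forall>j. \<exists>c. (\<lambda>i. A j u i - \<psi> j * u i) = (\<lambda>i. c * g i)"
    unfolding Y_def by blast
  then obtain \<xi> where "\<And>j. (\<lambda>i. A j u i - \<psi> j * u i) = (\<lambda>i. \<xi> j * g i)" by metis
  then have Au: "A j u = (\<lambda>i. \<psi> j * u i + \<xi> j * g i)" for j
    by (metis (no_types) add.commute diff_add_cancel)
  have not_single: "\<not> (\<forall>j. A j v = (\<lambda>i. \<psi> j * v i))" if "v = (\<lambda>i. u i + c * g i)" for v c \<psi>
  proof
    assume "\<forall>j. A j v = (\<lambda>i. \<psi> j * v i)"
    moreover have "v \<in> Z" using closed_linD[OF Z(1) u(1) g(1), of 1 c] that by simp
    ultimately obtain c' where "v = (\<lambda>i. c' * g i)" using single by blast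
    then have "u = (\<lambda>i. (c' - c) * g i)" using that by (auto simp: fun_eq_iff algebra_simps)
    then show False using u(2) by (auto simp: Y_def)
  qed
  have "\<psi> = x"
  proof (rule ccontr)
    assume "\<psi> \<noteq> x"
    then obtain j where j: "\<psi> j \<noteq> x j" by blast
    \<comment> \<open>The multiple of \<open>g\<close> that removes the correction term for the operator \<open>A j\<close>.\<close>
    define c where "c = \<xi> j / (\<psi> j - x j)"
    define v where "v = (\<lambda>i. u i + c * g i)"
    have v: "v \<in> Z" using closed_linD[OF Z(1) u(1) g(1), of 1 c] by (simp add: v_def)
    have Av: "A l v = (\<lambda>i. \<psi> l * v i + (\<xi> l + c * (x l - \<psi> l)) * g i)" for l
      using lin_opD[OF lin[of l], of 1 u c g]
      by (simp add: v_def Au g(3)) (simp add: algebra_simps)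
    have cj: "\<xi> j + c * (x j - \<psi> j) = 0" using j by (simp add: c_def field_simps)
    then have Ajv: "A j v = (\<lambda>i. \<psi> j * v i)" by (simp add: Av)
    obtain i where i: "g i \<noteq> 0" using g(2) by (auto simp: fun_eq_iff)
    have "\<xi> l + c * (x l - \<psi> l) = 0" for l
    proof -
      let ?\<eta> = "\<xi> l + c * (x l - \<psi> l)"
      have "A j (A l v) = (\<lambda>i. \<psi> l * A j v i + ?\<eta> * A j g i)"
        unfolding Av[of l] using lin_opD[OF lin[of j], of "\<psi> l" v ?\<eta> g] .
      moreover have "A l (A j v) = (\<lambda>i. \<psi> j * A l v i)" unfolding Ajv by (rule scale)
      ultimately have "\<psi> l * A j v i + ?\<eta> * A j g i = \<psi> j * A l v i"
        using comm[OF v, of j l] by metis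
      then have "?\<eta> * (x j * g i) = \<psi> j * (?\<eta> * g i)"
        unfolding Ajv g(3) Av[of l] by (simp add: algebra_simps)
      then have "?\<eta> * (x j - \<psi> j) * g i = 0" by (simp add: algebra_simps)
      then show ?thesis using i j by simp
    qed
    then have "\<forall>l. A l v = (\<lambda>i. \<psi> l * v i)" by (simp add: Av)
    then show False using not_single[OF v_def] by blast
  qed
  moreover have "\<xi> \<noteq> (\<lambda>_. 0)"
  proof
    assume "\<xi> = (\<lambda>_. 0)"
    then have "\<forall>j. A j (\<lambda>i. u i + 0 * g i) = (\<lambda>i. \<psi> j * (u i + 0 * g i))" using Au by simp
    then show False using not_single by blast
  qed
  ultimately show ?thesis using u(1) Au by blast
qed

section \<open>Germs and their representatives\<close>

lemma germ_eq_rep_germ: "germ_eq (rep_germ a) (rep_germ b) \<longleftrightarrow> a = b"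
  by (rule Quotient3_rel_rep[OF Quotient3_germ])

lemma holo_rep_germ: "holo_fun_germ (rep_germ a)"
  using germ_eq_rep_germ[of a a] by (simp add: germ_eq_def)

lemma germ_eq_iff: "a = b \<longleftrightarrow> (\<forall>\<^sub>F x in nhds 0. rep_germ a x = rep_germ b x)"
  using germ_eq_rep_germ[of a b] by (simp add: germ_eq_def holo_rep_germ)

lemma rep_abs_germ:
  assumes "holo_fun_germ h" shows "\<forall>\<^sub>F x in nhds 0. rep_germ (abs_germ h) x = h x"
proof -
  have "germ_eq h h" using assms by (simp add: germ_eq_def)
  then have "germ_eq (rep_germ (abs_germ h)) h" by (rule Quotient3_rep_abs[OF Quotient3_germ])
  then show ?thesis by (simp add: germ_eq_def)
qed

lemma rep_germ_zero: "\<forall>\<^sub>F x in nhds 0. rep_germ 0 x = 0"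
  unfolding zero_germ_def by (rule rep_abs_germ[OF holo_fun_germ_const])

lemma rep_germ_one: "\<forall>\<^sub>F x in nhds 0. rep_germ 1 x = 1"
  unfolding one_germ_def by (rule rep_abs_germ[OF holo_fun_germ_const])

lemma rep_germ_plus: "\<forall>\<^sub>F x in nhds 0. rep_germ (a + b) x = rep_germ a x + rep_germ b x"
  unfolding plus_germ_def map_fun_apply by (intro rep_abs_germ holo_fun_germ_add holo_rep_germ)

lemma rep_germ_times: "\<forall>\<^sub>F x in nhds 0. rep_germ (a * b) x = rep_germ a x * rep_germ b x"
  unfolding times_germ_def map_fun_apply by (intro rep_abs_germ holo_fun_germ_mult holo_rep_germ)

lemma rep_germ_sum:
  "finite I \<Longrightarrow> \<forall>\<^sub>F x in nhds 0. rep_germ (\<Sum>i\<in>I. a i) x = (\<Sum>i\<in>I. rep_germ (a i) x)"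
proof (induction I rule: finite_induct)
  case empty
  show ?case using rep_germ_zero by simp
next
  case (insert i I)
  show ?case using insert.IH rep_germ_plus[of "a i" "sum a I"]
    by eventually_elim (simp add: insert.hyps)
qed

lemma rep_germ_power: "\<forall>\<^sub>F x in nhds 0. rep_germ (a ^ b) x = rep_germ a x ^ b"
proof (induction b)
  case 0
  show ?case using rep_germ_one by simp
next
  case (Suc b)
  show ?case using Suc rep_germ_times[of a "a ^ b"] by eventually_elim simp
qed

lemma eventually_map_germ:
  assumes "holo_map_germ f" "\<forall>\<^sub>F y in nhds 0. P y" shows "\<forall>\<^sub>F x in nhds 0. P (f x)"
  using holo_map_germ_tendsto[OF assms(1)] assms(2) by (auto simp: filterlim_iff)

lemma rep_germ_pullback:
  assumes "holo_map_germ f"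
  shows "\<forall>\<^sub>F x in nhds 0. rep_germ (germ_pullback f a) x = rep_germ a (f x)"
proof -
  have "germ_pullback f a = abs_germ (rep_germ a \<circ> f)"
    unfolding germ_pullback_def map_fun_apply by (simp add: assms)
  then show ?thesis
    using rep_abs_germ[OF holo_fun_germ_compose[OF holo_rep_germ assms]] by simp
qed

lemma comm_ring_hom_pullback:
  assumes f: "holo_map_germ f" shows "comm_ring_hom (germ_pullback f)"
proof
  fix a b
  show "germ_pullback f (a + b) = germ_pullback f a + germ_pullback f b"
    unfolding germ_eq_iff
    using rep_germ_pullback[OF f, of "a + b"] rep_germ_pullback[OF f, of a] rep_germ_pullback[OF f, of b]
      rep_germ_plus[of "germ_pullback f a" "germ_pullback f b"]
      eventually_map_germ[OF f rep_germ_plus[of a b]]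
    by eventually_elim simp
  show "germ_pullback f (a * b) = germ_pullback f a * germ_pullback f b"
    unfolding germ_eq_iff
    using rep_germ_pullback[OF f, of "a * b"] rep_germ_pullback[OF f, of a] rep_germ_pullback[OF f, of b]
      rep_germ_times[of "germ_pullback f a" "germ_pullback f b"]
      eventually_map_germ[OF f rep_germ_times[of a b]]
    by eventually_elim simp
  show "germ_pullback f 1 = 1"
    unfolding germ_eq_iff
    using rep_germ_pullback[OF f, of 1] rep_germ_one eventually_map_germ[OF f rep_germ_one]
    by eventually_elim simp
  show "germ_pullback f 0 = 0"
    unfolding germ_eq_iff
    using rep_germ_pullback[OF f, of 0] rep_germ_zero eventually_map_germ[OF f rep_germ_zero]
    by eventually_elim simp
qed

definition germ_at_0 :: "'n::finite germ \<Rightarrow> complex" where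
  "germ_at_0 a = rep_germ a 0"

lemma comm_ring_hom_germ_at_0: "comm_ring_hom germ_at_0"
proof
  show "germ_at_0 (a + b) = germ_at_0 a + germ_at_0 b" for a b :: "'a germ"
    using eventually_nhds_x_imp_x[OF rep_germ_plus[of a b]] by (simp add: germ_at_0_def)
  show "germ_at_0 (a * b) = germ_at_0 a * germ_at_0 b" for a b :: "'a germ"
    using eventually_nhds_x_imp_x[OF rep_germ_times[of a b]] by (simp add: germ_at_0_def)
  show "germ_at_0 (1 :: 'a germ) = 1"
    using eventually_nhds_x_imp_x[OF rep_germ_one] by (simp add: germ_at_0_def)
  show "germ_at_0 (0 :: 'a germ) = 0"
    using eventually_nhds_x_imp_x[OF rep_germ_zero] by (simp add: germ_at_0_def)
qed

interpretation at_0: comm_ring_hom germ_at_0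
  by (rule comm_ring_hom_germ_at_0)

lemma germ_at_0_pullback:
  assumes "holo_map_germ f" shows "germ_at_0 (germ_pullback f a) = germ_at_0 a"
  using eventually_nhds_x_imp_x[OF rep_germ_pullback[OF assms, of a]] assms
  by (simp add: germ_at_0_def holo_map_germ_def)

definition const_germ :: "complex \<Rightarrow> 'n::finite germ" where
  "const_germ c = abs_germ (\<lambda>_. c)"

lemma rep_const_germ: "\<forall>\<^sub>F x in nhds 0. rep_germ (const_germ c) x = c"
  unfolding const_germ_def by (rule rep_abs_germ[OF holo_fun_germ_const])

lemma germ_at_0_const [simp]: "germ_at_0 (const_germ c) = c"
  using eventually_nhds_x_imp_x[OF rep_const_germ] by (simp add: germ_at_0_def)

lemma comm_ring_hom_const_germ: "comm_ring_hom const_germ"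
proof
  fix a b :: complex
  show "const_germ (a + b) = (const_germ a + const_germ b :: 'a germ)"
    unfolding germ_eq_iff
    using rep_const_germ[of "a + b"] rep_const_germ[of a] rep_const_germ[of b] rep_germ_plus[of "const_germ a" "const_germ b"]
    by eventually_elim simp
  show "const_germ (a * b) = (const_germ a * const_germ b :: 'a germ)"
    unfolding germ_eq_iff
    using rep_const_germ[of "a * b"] rep_const_germ[of a] rep_const_germ[of b] rep_germ_times[of "const_germ a" "const_germ b"]
    by eventually_elim simp
  show "const_germ 1 = (1 :: 'a germ)"
    unfolding germ_eq_iff using rep_const_germ[of 1] rep_germ_one by eventually_elim simp
  show "const_germ 0 = (0 :: 'a germ)"
    unfolding germ_eq_iff using rep_const_germ[of 0] rep_germ_zero by eventually_elim simp
qed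

lemma pullback_const_germ:
  assumes f: "holo_map_germ f" shows "germ_pullback f (const_germ c) = const_germ c"
  unfolding germ_eq_iff
  using rep_germ_pullback[OF f, of "const_germ c"] eventually_map_germ[OF f rep_const_germ[of c]]
    rep_const_germ[of c]
  by eventually_elim simp

lemma germ_unit:
  assumes "germ_at_0 a \<noteq> 0" obtains c where "a * c = 1"
proof -
  obtain e where e: "e > 0" "holo_fun_on (rep_germ a) (ball 0 e)"
    using holo_fun_germ_ball[OF holo_rep_germ] .
  have "\<forall>\<^sub>F x in nhds 0. rep_germ a x \<noteq> 0"
    using holo_fun_germ_isCont[OF holo_rep_germ, of a] assms
    by (intro tendsto_imp_eventually_ne[of _ "rep_germ a 0"])
      (auto simp: germ_at_0_def isCont_def tendsto_at_iff_tendsto_nhds)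
  then obtain e' where e': "e' > 0" "\<And>x. dist x 0 < e' \<Longrightarrow> rep_germ a x \<noteq> 0"
    unfolding eventually_nhds_metric by blast
  have "holo_fun_on (\<lambda>x. inverse (rep_germ a x)) (ball 0 (min e e'))"
    by (rule holo_fun_on_inverse, rule holo_fun_on_subset[OF e(2)]) (use e' in \<open>auto simp: dist_commute\<close>)
  then have h: "holo_fun_germ (\<lambda>x. inverse (rep_germ a x))"
    using e e' by (intro holo_fun_germI_ball[of "min e e'"]) auto
  have "a * abs_germ (\<lambda>x. inverse (rep_germ a x)) = 1"
    unfolding germ_eq_iff
    using rep_germ_times[of a "abs_germ (\<lambda>x. inverse (rep_germ a x))"] rep_abs_germ[OF h] rep_germ_one
      \<open>\<forall>\<^sub>F x in nhds 0. rep_germ a x \<noteq> 0\<close>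
    by eventually_elim simp
  then show ?thesis by (rule that)
qed

definition coord_germ :: "'n::finite \<Rightarrow> 'n germ" where
  "coord_germ j = abs_germ (\<lambda>x. vec_nth x j)"

lemma holo_fun_germ_component: "holo_fun_germ (\<lambda>x. vec_nth x j)"
  by (rule holo_fun_germI_ball[of 1]) (auto intro: holo_fun_on_component)

lemma rep_coord_germ: "\<forall>\<^sub>F x in nhds 0. rep_germ (coord_germ j) x = vec_nth x j"
  unfolding coord_germ_def by (rule rep_abs_germ[OF holo_fun_germ_component])

lemma germ_at_0_coord [simp]: "germ_at_0 (coord_germ j) = 0"
  using eventually_nhds_x_imp_x[OF rep_coord_germ[of j]] by (simp add: germ_at_0_def)

lemma holo_map_germI:
  assumes "f 0 = 0" "\<And>i. holo_fun_germ (\<lambda>x. vec_nth (f x) i)" shows "holo_map_germ f"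
proof -
  obtain e where "e > 0" "\<And>i. i \<in> UNIV \<Longrightarrow> holo_fun_on (\<lambda>x. vec_nth (f x) i) (ball 0 e)"
    using holo_fun_germ_ball_family[of UNIV "\<lambda>i x. vec_nth (f x) i"] assms(2) by auto
  then show ?thesis unfolding holo_map_germ_def holo_map_on_def using assms(1)
    by (intro conjI exI[of _ "ball 0 e"]) auto
qed

lemma holo_map_germ_component: "holo_map_germ f \<Longrightarrow> holo_fun_germ (\<lambda>x. vec_nth (f x) i)"
  unfolding holo_map_germ_def holo_map_on_def holo_fun_germ_def by blast

lemma eventually_has_derivative:
  assumes "holo_fun_germ h"
  shows "\<forall>\<^sub>F x in nhds 0. (h has_derivative frechet_derivative h (at x)) (at x)"
proof -
  obtain e where e: "e > 0" "holo_fun_on h (ball 0 e)" using holo_fun_germ_ball[OF assms] .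
  then have "\<forall>\<^sub>F x in nhds 0. x \<in> ball 0 e" by (intro eventually_nhds_in_open) auto
  then show ?thesis by eventually_elim (rule holo_fun_on_has_derivative[OF e(2)])
qed

section \<open>Integral equations\<close>

text \<open>
  The determinant trick: if \<open>s\<close> acts on the generators by a matrix, then the characteristic
  polynomial of the matrix is an equation for \<open>s\<close>. If the entries lie in the kernel of \<open>\<epsilon>\<close>, the
  image of this polynomial is the characteristic polynomial of the zero matrix.
\<close>

lemma integral_equation:
  fixes \<phi> :: "'r::comm_ring_1 \<Rightarrow> 's::comm_ring_1" and \<epsilon> :: "'r \<Rightarrow> 'k::comm_ring_1"
  assumes \<phi>: "comm_ring_hom \<phi>" and \<epsilon>: "comm_ring_hom \<epsilon>" and gen0: "gen 0 = 1" and N: "N > 0"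
    and m: "\<And>k. k < N \<Longrightarrow> s * gen k = (\<Sum>i<N. gen i * \<phi> (m i k))"
  obtains p where "Polynomial.degree p = N" "Polynomial.coeff p N = 1"
    "(\<Sum>b\<le>N. \<phi> (Polynomial.coeff p b) * s ^ b) = 0"
    "(\<And>i k. i < N \<Longrightarrow> k < N \<Longrightarrow> \<epsilon> (m i k) = 0) \<Longrightarrow> \<forall>b<N. \<epsilon> (Polynomial.coeff p b) = 0"
proof -
  interpret \<phi>: comm_ring_hom \<phi> by (rule \<phi>)
  interpret \<epsilon>: comm_ring_hom \<epsilon> by (rule \<epsilon>)
  define A where "A = Matrix.mat N N (\<lambda>(i, k). m i k)"
  have A: "A \<in> carrier_mat N N" by (simp add: A_def)
  define p where "p = char_poly A"
  have deg: "Polynomial.degree p = N" "Polynomial.coeff p N = 1"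
    using degree_monic_char_poly[OF A] by (auto simp: p_def)
  define ev where "ev = (\<lambda>q. poly (map_poly \<phi> q) s)"
  interpret mp: map_poly_comm_ring_hom \<phi> ..
  have ev: "comm_ring_hom ev"
  proof
    show "ev (q + q') = ev q + ev q'" for q q' by (simp add: ev_def mp.hom_add)
    show "ev (q * q') = ev q * ev q'" for q q' by (simp add: ev_def mp.hom_mult)
  qed (simp_all add: ev_def)
  interpret ev: comm_ring_hom ev by (rule ev)
  define B where "B = map_mat ev (char_poly_matrix A)"
  have B: "B \<in> carrier_mat N N" using A by (simp add: B_def)
  have const: "map_poly \<phi> [:c:] = [:\<phi> c:]" for c
    by (intro poly_eqI) (auto simp: coeff_map_poly coeff_pCons split: nat.split)
  have lin: "map_poly \<phi> [:c, 1:] = [:\<phi> c, 1:]" for c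
    by (intro poly_eqI) (auto simp: coeff_map_poly coeff_pCons split: nat.split)
  have B_entry: "B $$ (i, k) = (if i = k then s else 0) - \<phi> (m i k)" if "i < N" "k < N" for i k
    using that A by (auto simp: B_def char_poly_matrix_def ev_def A_def \<phi>.hom_uminus const lin)
  have gen_B: "(\<Sum>i<N. gen i * B $$ (i, k)) = 0" if k: "k < N" for k
  proof -
    have "(\<Sum>i<N. gen i * B $$ (i, k)) = (\<Sum>i<N. gen i * (if i = k then s else 0)) - (\<Sum>i<N. gen i * \<phi> (m i k))"
      using k by (simp add: B_entry right_diff_distrib sum_subtractf)
    also have "(\<Sum>i<N. gen i * (if i = k then s else 0)) = s * gen k"
      using k by (simp add: if_distrib[of "\<lambda>x. _ * x"] mult.commute cong: if_cong)
    finally show ?thesis using m[OF k] by simp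
  qed
  have "det B = 0"
  proof -
    define C where "C = adj_mat B"
    have C: "C \<in> carrier_mat N N" "B * C = det B \<cdot>\<^sub>m 1\<^sub>m N"
      using adj_mat[OF B] by (auto simp: C_def)
    have "(\<Sum>i<N. gen i * (B * C) $$ (i, 0)) = (\<Sum>i<N. \<Sum>k<N. gen i * B $$ (i, k) * C $$ (k, 0))"
      using B C(1) N by (intro sum.cong) (auto simp: scalar_prod_def atLeast0LessThan sum_distrib_left mult.assoc)
    also have "\<dots> = (\<Sum>k<N. (\<Sum>i<N. gen i * B $$ (i, k)) * C $$ (k, 0))"
      by (subst sum.swap) (simp add: sum_distrib_right)
    also have "\<dots> = 0" using gen_B by simp
    finally have "(\<Sum>i<N. gen i * (B * C) $$ (i, 0)) = 0" .
    moreover have "(\<Sum>i<N. gen i * (B * C) $$ (i, 0)) = (\<Sum>i<N. if i = 0 then det B else 0)"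
      unfolding C(2) using N gen0 by (intro sum.cong) auto
    ultimately show ?thesis using N by simp
  qed
  moreover have "det B = ev p"
    unfolding B_def p_def char_poly_def by (rule ev.hom_det)
  ultimately have "ev p = 0" by simp
  moreover have "ev p = (\<Sum>b\<le>N. \<phi> (Polynomial.coeff p b) * s ^ b)"
  proof -
    have "Polynomial.degree (map_poly \<phi> p) \<le> N" using deg degree_map_poly_le[of \<phi> p] by simp
    then have "poly (map_poly \<phi> p) s = poly (\<Sum>b\<le>N. Polynomial.monom (Polynomial.coeff (map_poly \<phi> p) b) b) s"
      by (subst poly_as_sum_of_monoms') auto
    also have "\<dots> = (\<Sum>b\<le>N. Polynomial.coeff (map_poly \<phi> p) b * s ^ b)"
      by (simp add: poly_sum poly_monom)
    finally have "poly (map_poly \<phi> p) s = (\<Sum>b\<le>N. Polynomial.coeff (map_poly \<phi> p) b * s ^ b)" .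
    then show ?thesis by (simp add: ev_def coeff_map_poly)
  qed
  ultimately have eq: "(\<Sum>b\<le>N. \<phi> (Polynomial.coeff p b) * s ^ b) = 0" by simp
  have small: "\<forall>b<N. \<epsilon> (Polynomial.coeff p b) = 0" if m0: "\<And>i k. i < N \<Longrightarrow> k < N \<Longrightarrow> \<epsilon> (m i k) = 0"
  proof -
    interpret me: map_poly_comm_ring_hom \<epsilon> ..
    have const: "map_poly \<epsilon> [:c:] = [:\<epsilon> c:]" for c
      by (intro poly_eqI) (auto simp: coeff_map_poly coeff_pCons split: nat.split)
    have lin: "map_poly \<epsilon> [:c, 1:] = [:\<epsilon> c, 1:]" for c
      by (intro poly_eqI) (auto simp: coeff_map_poly coeff_pCons split: nat.split)
    have "map_mat (map_poly \<epsilon>) (char_poly_matrix A) = [:0, 1:] \<cdot>\<^sub>m 1\<^sub>m N"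
      using A m0 by (intro eq_matI) (auto simp: char_poly_matrix_def A_def \<epsilon>.hom_uminus const lin)
    then have "map_poly \<epsilon> p = det ([:0, 1:] \<cdot>\<^sub>m 1\<^sub>m N)"
      unfolding p_def char_poly_def by (metis me.hom_det)
    also have "\<dots> = Polynomial.monom 1 N" by (simp add: det_smult monom_altdef)
    finally have "Polynomial.coeff (map_poly \<epsilon> p) b = Polynomial.coeff (Polynomial.monom 1 N) b" for b by simp
    then show ?thesis by (auto simp: coeff_map_poly)
  qed
  show ?thesis by (rule that[OF deg eq small])
qed

section \<open>Presentations of the ring of germs on the source\<close>

locale germ_presentation =
  fixes f :: "complex^'n \<Rightarrow> complex^'m" and N :: nat
    and L :: "nat \<Rightarrow> nat \<Rightarrow> 'm germ" and gen :: "nat \<Rightarrow> 'n germ"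
  assumes f: "holo_map_germ f" and N: "N > 0" and gen0: "gen 0 = 1"
    and generating: "\<exists>a. (\<Sum>i<N. gen i * germ_pullback f (a i)) = h"
    and relation: "(\<Sum>i<N. gen i * germ_pullback f (a i)) = 0 \<Longrightarrow>
      \<exists>b. \<forall>i<N. a i = (\<Sum>k<N. L i k * b k)"
    and column: "k < N \<Longrightarrow> (\<Sum>i<N. gen i * germ_pullback f (L i k)) = 0"
begin

abbreviation "\<phi> \<equiv> germ_pullback f"

sublocale \<phi>: comm_ring_hom \<phi>
  by (rule comm_ring_hom_pullback[OF f])

definition comb :: "(nat \<Rightarrow> 'm germ) \<Rightarrow> 'n germ" where
  "comb a = (\<Sum>i<N. gen i * \<phi> (a i))"

lemma comb_add: "comb (\<lambda>i. a i + b i) = comb a + comb b"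
  by (simp add: comb_def \<phi>.hom_add distrib_left sum.distrib)

lemma comb_diff: "comb (\<lambda>i. a i - b i) = comb a - comb b"
  by (simp add: comb_def \<phi>.hom_minus right_diff_distrib sum_subtractf)

lemma comb_scale: "comb (\<lambda>i. c * a i) = \<phi> c * comb a"
  by (simp add: comb_def \<phi>.hom_mult sum_distrib_left mult.left_commute)

lemma comb_zero [simp]: "comb (\<lambda>_. 0) = 0"
  by (simp add: comb_def)

lemma comb_sum: "finite I \<Longrightarrow> comb (\<lambda>i. \<Sum>k\<in>I. a k i) = (\<Sum>k\<in>I. comb (a k))"
  by (induction I rule: finite_induct) (simp_all add: comb_add)

definition unit_coeff :: "nat \<Rightarrow> nat \<Rightarrow> 'm germ" where
  "unit_coeff k i = (if i = k then 1 else 0)"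

lemma comb_unit: "k < N \<Longrightarrow> comb (unit_coeff k) = gen k"
  by (simp add: comb_def unit_coeff_def if_distrib[of \<phi>] if_distrib[of "\<lambda>x. _ * x"] cong: if_cong)

text \<open>
  Multiplication by \<open>s\<close> on the generators. Such a matrix is determined only up to relations; the
  choices for different \<open>s\<close> commute on the forms introduced below.
\<close>

definition mult_mat :: "'n germ \<Rightarrow> nat \<Rightarrow> nat \<Rightarrow> 'm germ" where
  "mult_mat s = (\<lambda>i k. (SOME a. comb a = s * gen k) i)"

lemma comb_mult_mat: "comb (\<lambda>i. mult_mat s i k) = s * gen k"
  using someI_ex[OF generating[of "s * gen k", folded comb_def]] by (simp add: mult_mat_def)

definition mat_apply :: "(nat \<Rightarrow> nat \<Rightarrow> 'm germ) \<Rightarrow> (nat \<Rightarrow> 'm germ) \<Rightarrow> (nat \<Rightarrow> 'm germ)" where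
  "mat_apply m a = (\<lambda>i. \<Sum>k<N. m i k * a k)"

lemma comb_mat_apply: "comb (mat_apply (mult_mat s) a) = s * comb a"
proof -
  have "comb (mat_apply (mult_mat s) a) = (\<Sum>k<N. comb (\<lambda>i. a k * mult_mat s i k))"
    unfolding mat_apply_def by (subst comb_sum[symmetric]) (simp_all add: mult.commute)
  also have "\<dots> = (\<Sum>k<N. \<phi> (a k) * (s * gen k))"
    by (simp add: comb_scale comb_mult_mat)
  finally show ?thesis by (simp add: comb_def sum_distrib_left mult_ac)
qed

lemma comb_mat_apply_funpow: "comb ((mat_apply (mult_mat s) ^^ b) a) = s ^ b * comb a"
  by (induction b) (simp_all add: comb_mat_apply mult.assoc)

subsection \<open>Equations of the coordinates\<close>

text \<open>
  An element vanishing at the origin is nilpotent modulo the maximal ideal of the target ring,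
  since in any integral equation for it the coefficients that do not vanish at the origin make up a
  power of the element times a unit. The determinant trick for that power then gives an equation
  all of whose lower coefficients vanish at the origin.
\<close>

lemma Weierstrass_equation:
  assumes s0: "germ_at_0 s = 0"
  shows "\<exists>d c. s ^ d + (\<Sum>b<d. \<phi> (c b) * s ^ b) = 0 \<and> (\<forall>b<d. germ_at_0 (c b) = 0)"
proof -
  interpret cn: comm_ring_hom "const_germ :: complex \<Rightarrow> 'n germ" by (rule comm_ring_hom_const_germ)
  obtain p where p: "Polynomial.degree p = N" "Polynomial.coeff p N = 1"
    "(\<Sum>b\<le>N. \<phi> (Polynomial.coeff p b) * s ^ b) = 0"
    using integral_equation[of \<phi> germ_at_0 gen N s "mult_mat s",
        OF \<phi>.comm_ring_hom_axioms comm_ring_hom_germ_at_0 gen0 N] comb_mult_mat[of s] unfolding comb_def by metis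
  define q where "q = map_poly germ_at_0 p"
  have q_coeff: "Polynomial.coeff q b = germ_at_0 (Polynomial.coeff p b)" for b
    by (simp add: q_def coeff_map_poly)
  have "Polynomial.coeff q N = 1" by (simp add: q_coeff p)
  then have q0: "q \<noteq> 0" by auto
  obtain q1 where q1: "q = [:- 0, 1:] ^ Polynomial.order 0 q * q1" "\<not> [:- 0, 1:] dvd q1"
    using order_decomp[OF q0, of 0] by blast
  define e where "e = Polynomial.order 0 q"
  have q1_0: "poly q1 0 \<noteq> 0" using q1(2) by (simp add: poly_eq_0_iff_dvd)
  define v where "v = poly (map_poly const_germ q1) s"
  \<comment> \<open>The part of the coefficients that vanishes at the origin; the rest gives \<open>s\<^sup>e\<close> times the unit \<open>v\<close>.\<close>
  define \<mu> where "\<mu> = (\<lambda>b. Polynomial.coeff p b - const_germ (germ_at_0 (Polynomial.coeff p b)))"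
  have \<mu>0: "germ_at_0 (\<mu> b) = 0" for b by (simp add: \<mu>_def at_0.hom_minus)
  have qv: "(\<Sum>b\<le>N. const_germ (Polynomial.coeff q b) * s ^ b) = s ^ e * v"
  proof -
    interpret mc: map_poly_comm_ring_hom "const_germ :: complex \<Rightarrow> 'n germ" ..
    have "Polynomial.degree (map_poly (const_germ :: complex \<Rightarrow> 'n germ) q) \<le> N"
      using degree_map_poly_le[of "const_germ :: complex \<Rightarrow> 'n germ" q] degree_map_poly_le[of germ_at_0 p] p(1)
      by (simp add: q_def)
    then have "poly (map_poly const_germ q) s =
        poly (\<Sum>b\<le>N. Polynomial.monom (Polynomial.coeff (map_poly const_germ q) b) b) s"
      by (subst poly_as_sum_of_monoms') auto
    also have "\<dots> = (\<Sum>b\<le>N. const_germ (Polynomial.coeff q b) * s ^ b)"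
      by (simp add: poly_sum poly_monom coeff_map_poly)
    finally have "(\<Sum>b\<le>N. const_germ (Polynomial.coeff q b) * s ^ b) = poly (map_poly const_germ q) s" ..
    moreover have "map_poly (const_germ :: complex \<Rightarrow> 'n germ) q = map_poly const_germ ([:0, 1:] ^ e) * map_poly const_germ q1"
      using q1(1) by (simp add: e_def mc.hom_mult[symmetric])
    moreover have "map_poly (const_germ :: complex \<Rightarrow> 'n germ) ([:0, 1:] ^ e) = ([:0, 1:] ^ e :: 'n germ poly)"
    proof -
      have "map_poly const_germ [:0, 1:] = ([:0, 1:] :: 'n germ poly)"
        by (intro poly_eqI) (auto simp: coeff_map_poly coeff_pCons split: nat.split)
      then show ?thesis by (simp add: mc.hom_power)
    qed
    ultimately show ?thesis by (simp add: v_def poly_power)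
  qed
  have split: "s ^ e * v = - (\<Sum>b\<le>N. \<phi> (\<mu> b) * s ^ b)"
  proof -
    have "(\<Sum>b\<le>N. \<phi> (\<mu> b) * s ^ b) = (\<Sum>b\<le>N. \<phi> (Polynomial.coeff p b) * s ^ b) -
        (\<Sum>b\<le>N. const_germ (Polynomial.coeff q b) * s ^ b)"
      by (simp add: \<mu>_def \<phi>.hom_minus pullback_const_germ[OF f] q_coeff left_diff_distrib sum_subtractf)
    then show ?thesis using p(3) qv by simp
  qed
  have v0: "germ_at_0 v = poly q1 0"
  proof -
    have "germ_at_0 (poly (map_poly (const_germ :: complex \<Rightarrow> 'n germ) h) s) = poly h 0" for h
      by (induction h) (simp_all add: map_poly_pCons cn.hom_zero at_0.hom_add at_0.hom_mult s0)
    then show ?thesis by (simp add: v_def)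
  qed
  then obtain c where c: "v * c = 1" using germ_unit[of v] q1_0 by auto
  have e: "e > 0"
  proof (rule ccontr)
    assume "\<not> e > 0"
    then have "v = - (\<Sum>b\<le>N. \<phi> (\<mu> b) * s ^ b)" using split by simp
    then have "germ_at_0 v = 0"
      by (simp add: at_0.hom_uminus at_0.hom_sum at_0.hom_mult germ_at_0_pullback[OF f] \<mu>0)
    then show False using v0 q1_0 by simp
  qed
  define m where "m = (\<lambda>i k. - (\<Sum>b\<le>N. \<mu> b * mult_mat (s ^ b * c) i k))"
  have m: "s ^ e * gen k = (\<Sum>i<N. gen i * \<phi> (m i k))" for k
  proof -
    have "comb (\<lambda>i. m i k) = comb (\<lambda>i. 0 - (\<Sum>b\<in>{..N}. \<mu> b * mult_mat (s ^ b * c) i k))"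
      by (simp add: m_def)
    also have "\<dots> = - (\<Sum>b\<le>N. \<phi> (\<mu> b) * (s ^ b * c * gen k))"
      by (subst comb_diff, subst comb_sum) (simp_all add: comb_scale comb_mult_mat)
    also have "\<dots> = - (\<Sum>b\<le>N. \<phi> (\<mu> b) * s ^ b) * c * gen k"
      by (simp add: sum_distrib_right mult.assoc)
    also have "\<dots> = s ^ e * (v * c) * gen k" by (simp add: split[symmetric] mult.assoc)
    finally show ?thesis by (simp add: c comb_def)
  qed
  have m0: "germ_at_0 (m i k) = 0" for i k
    by (simp add: m_def at_0.hom_uminus at_0.hom_sum at_0.hom_mult \<mu>0)
  obtain p' where p': "Polynomial.coeff p' N = 1"
    "(\<Sum>b\<le>N. \<phi> (Polynomial.coeff p' b) * (s ^ e) ^ b) = 0"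
    "\<forall>b<N. germ_at_0 (Polynomial.coeff p' b) = 0"
    using integral_equation[of \<phi> germ_at_0 gen N "s ^ e" m,
        OF \<phi>.comm_ring_hom_axioms comm_ring_hom_germ_at_0 gen0 N] m m0 by metis
  \<comment> \<open>The equation of \<open>s\<^sup>e\<close> as a polynomial in \<open>s\<close>.\<close>
  define c' where "c' = (\<lambda>b. if e dvd b then Polynomial.coeff p' (b div e) else 0)"
  have "(\<Sum>b<e * N. \<phi> (c' b) * s ^ b) = (\<Sum>b\<in>(\<lambda>i. e * i) ` {..<N}. \<phi> (c' b) * s ^ b)"
  proof (rule sum.mono_neutral_right)
    show "(\<lambda>i. e * i) ` {..<N} \<subseteq> {..<e * N}" using e by auto
    show "\<forall>b\<in>{..<e * N} - (\<lambda>i. e * i) ` {..<N}. \<phi> (c' b) * s ^ b = 0"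
      using e by (auto simp: c'_def elim!: dvdE)
  qed simp
  also have "\<dots> = (\<Sum>i<N. \<phi> (Polynomial.coeff p' i) * (s ^ e) ^ i)"
    using e by (subst sum.reindex) (auto simp: inj_on_def c'_def power_mult)
  finally have "s ^ (e * N) + (\<Sum>b<e * N. \<phi> (c' b) * s ^ b) = 0"
    using p'(1,2) by (simp add: lessThan_Suc_atMost[symmetric] power_mult add.commute)
  moreover have "\<forall>b<e * N. germ_at_0 (c' b) = 0"
  proof (intro allI impI)
    fix b assume "b < e * N"
    then have "b div e < N" using e by (simp add: less_mult_imp_div_less mult.commute)
    then show "germ_at_0 (c' b) = 0" using p'(3) by (simp add: c'_def)
  qed
  ultimately show ?thesis by blast
qed

definition "equation_ex = (\<lambda>j dc. coord_germ j ^ fst dc + (\<Sum>b<fst dc. \<phi> (snd dc b) * coord_germ j ^ b) = 0 \<and>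
    (\<forall>b<fst dc. germ_at_0 (snd dc b) = 0))"

definition deg :: "'n \<Rightarrow> nat" where
  "deg j = fst (SOME dc. equation_ex j dc)"

definition low_coeff :: "'n \<Rightarrow> nat \<Rightarrow> 'm germ" where
  "low_coeff j = snd (SOME dc. equation_ex j dc)"

lemma equation_ex: "equation_ex j (deg j, low_coeff j)"
proof -
  have "\<exists>dc. equation_ex j dc"
    using Weierstrass_equation[OF germ_at_0_coord[of j]] by (auto simp: equation_ex_def)
  from someI_ex[OF this] show ?thesis by (simp add: deg_def low_coeff_def)
qed

lemma coord_equation: "coord_germ j ^ deg j + (\<Sum>b<deg j. \<phi> (low_coeff j b) * coord_germ j ^ b) = 0"
  using equation_ex[of j] by (simp add: equation_ex_def)

lemma low_coeff_0: "b < deg j \<Longrightarrow> rep_germ (low_coeff j b) 0 = 0"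
  using equation_ex[of j] by (simp add: equation_ex_def germ_at_0_def)

subsection \<open>The operators on the fibres\<close>

text \<open>
  The linear forms on the fibre at \<open>y\<close> of the presented module, in terms of their values on the
  generators.
\<close>

definition forms :: "complex^'m \<Rightarrow> (nat \<Rightarrow> complex) set" where
  "forms y = {u. (\<forall>i\<ge>N. u i = 0) \<and> (\<forall>k<N. (\<Sum>i<N. u i * rep_germ (L i k) y) = 0)}"

definition pair :: "(nat \<Rightarrow> complex) \<Rightarrow> (nat \<Rightarrow> 'm germ) \<Rightarrow> complex^'m \<Rightarrow> complex" where
  "pair u a y = (\<Sum>i<N. u i * rep_germ (a i) y)"

definition oper :: "(nat \<Rightarrow> nat \<Rightarrow> 'm germ) \<Rightarrow> complex^'m \<Rightarrow> (nat \<Rightarrow> complex) \<Rightarrow> (nat \<Rightarrow> complex)" where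
  "oper m y u = (\<lambda>k. if k < N then pair u (\<lambda>i. m i k) y else 0)"

lemma formsD: "u \<in> forms y \<Longrightarrow> i \<ge> N \<Longrightarrow> u i = 0"
  by (simp add: forms_def)

lemma pair_lin: "pair (\<lambda>i. a * u i + b * v i) c y = a * pair u c y + b * pair v c y"
  by (simp add: pair_def sum.distrib sum_distrib_left distrib_right mult.assoc)

lemma lin_op_oper: "lin_op (oper m y)"
  by (auto simp: lin_op_def oper_def pair_lin fun_eq_iff)

lemma closed_lin_forms: "closed_lin (forms y)"
  unfolding closed_lin_def forms_def pair_def[symmetric, of _ "\<lambda>i. L i _"]
  using pair_lin[unfolded pair_def]
  by (auto simp: pair_def)

lemma eventually_pair_sum:
  assumes "finite I"
  shows "\<forall>\<^sub>F y in nhds 0. \<forall>u. pair u (\<lambda>i. \<Sum>k\<in>I. a k i * b k i) y =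
    (\<Sum>k\<in>I. \<Sum>i<N. u i * rep_germ (a k i) y * rep_germ (b k i) y)"
proof -
  have "\<forall>\<^sub>F y in nhds 0. \<forall>i\<in>{..<N}. rep_germ (\<Sum>k\<in>I. a k i * b k i) y = (\<Sum>k\<in>I. rep_germ (a k i * b k i) y)"
    by (intro eventually_ball_finite ballI rep_germ_sum assms) auto
  moreover have "\<forall>\<^sub>F y in nhds 0. \<forall>i\<in>{..<N}. \<forall>k\<in>I. rep_germ (a k i * b k i) y = rep_germ (a k i) y * rep_germ (b k i) y"
    by (intro eventually_ball_finite ballI rep_germ_times assms) auto
  ultimately show ?thesis
  proof eventually_elim
    case (elim y)
    show ?case
    proof
      fix u
      have "pair u (\<lambda>i. \<Sum>k\<in>I. a k i * b k i) y = (\<Sum>i<N. \<Sum>k\<in>I. u i * rep_germ (a k i) y * rep_germ (b k i) y)"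
        using elim by (simp add: pair_def sum_distrib_left mult.assoc)
      then show "pair u (\<lambda>i. \<Sum>k\<in>I. a k i * b k i) y = (\<Sum>k\<in>I. \<Sum>i<N. u i * rep_germ (a k i) y * rep_germ (b k i) y)"
        by (simp add: sum.swap[of _ I])
    qed
  qed
qed

lemma eventually_pair_add:
  "\<forall>\<^sub>F y in nhds 0. \<forall>u. pair u (\<lambda>i. a i + b i) y = pair u a y + pair u b y"
proof -
  have "\<forall>\<^sub>F y in nhds 0. \<forall>i\<in>{..<N}. rep_germ (a i + b i) y = rep_germ (a i) y + rep_germ (b i) y"
    by (intro eventually_ball_finite ballI rep_germ_plus) auto
  then show ?thesis
    by eventually_elim (simp add: pair_def distrib_left sum.distrib)
qed

lemma eventually_pair_zero: "\<forall>\<^sub>F y in nhds 0. \<forall>u. pair u (\<lambda>_. 0) y = 0"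
  using rep_germ_zero by eventually_elim (simp add: pair_def)

lemma eventually_pair_scale:
  "\<forall>\<^sub>F y in nhds 0. \<forall>u. pair u (\<lambda>i. c * a i) y = rep_germ c y * pair u a y"
proof -
  have "\<forall>\<^sub>F y in nhds 0. \<forall>i\<in>{..<N}. rep_germ (c * a i) y = rep_germ c y * rep_germ (a i) y"
    by (intro eventually_ball_finite ballI rep_germ_times) auto
  then show ?thesis
    by eventually_elim (simp add: pair_def sum_distrib_left mult.left_commute)
qed

lemma eventually_pair_unit: "\<forall>\<^sub>F y in nhds 0. \<forall>u. \<forall>k<N. pair u (unit_coeff k) y = u k"
  using rep_germ_zero rep_germ_one
proof eventually_elim
  case (elim y)
  have "pair u (unit_coeff k) y = (\<Sum>i<N. if i = k then u k else 0)" for u k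
    unfolding pair_def unit_coeff_def using elim by (intro sum.cong) auto
  then show ?case by simp
qed

lemma eventually_pair_oper:
  "\<forall>\<^sub>F y in nhds 0. \<forall>u. pair (oper m y u) a y = pair u (mat_apply m a) y"
  using eventually_pair_sum[OF finite_lessThan[of N], of "\<lambda>k i. m i k" "\<lambda>k i. a k"]
proof eventually_elim
  case (elim y)
  show ?case
  proof
    fix u
    have "pair (oper m y u) a y = (\<Sum>k<N. (\<Sum>i<N. u i * rep_germ (m i k) y) * rep_germ (a k) y)"
      by (simp add: pair_def[of "oper m y u"]) (simp add: oper_def pair_def)
    then show "pair (oper m y u) a y = pair u (mat_apply m a) y"
      using elim by (simp add: mat_apply_def sum_distrib_right)
  qed
qed

text \<open>
  Two expressions of the same germ differ by a combination of columns of \<open>L\<close>, on which forms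
  vanish. The neighbourhood depends on the two expressions.
\<close>

lemma eventually_pair_eq:
  assumes "comb a = comb b"
  shows "\<forall>\<^sub>F y in nhds 0. \<forall>u\<in>forms y. pair u a y = pair u b y"
proof -
  have "comb (\<lambda>i. a i - b i) = 0" using assms by (simp add: comb_diff)
  then obtain c where c: "\<forall>i<N. a i - b i = (\<Sum>k<N. L i k * c k)"
    using relation[of "\<lambda>i. a i - b i"] unfolding comb_def by blast
  have a: "\<forall>i<N. a i = b i + (\<Sum>k<N. L i k * c k)"
    using c by (metis add.commute diff_add_cancel)
  have "\<forall>\<^sub>F y in nhds 0. \<forall>u. pair u (\<lambda>i. b i + (\<Sum>k\<in>{..<N}. L i k * c k)) y =
      pair u b y + pair u (\<lambda>i. \<Sum>k\<in>{..<N}. L i k * c k) y"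
    by (rule eventually_pair_add)
  moreover have "\<forall>\<^sub>F y in nhds 0. \<forall>u. pair u (\<lambda>i. \<Sum>k\<in>{..<N}. L i k * c k) y =
      (\<Sum>k<N. \<Sum>i<N. u i * rep_germ (L i k) y * rep_germ (c k) y)"
    using eventually_pair_sum[of "{..<N}" "\<lambda>k i. L i k" "\<lambda>k i. c k"] by simp
  ultimately show ?thesis
  proof eventually_elim
    case (elim y)
    show ?case
    proof
      fix u assume u: "u \<in> forms y"
      have "pair u a y = pair u (\<lambda>i. b i + (\<Sum>k\<in>{..<N}. L i k * c k)) y"
        unfolding pair_def using a by (intro sum.cong) auto
      also have "\<dots> = pair u b y + (\<Sum>k<N. (\<Sum>i<N. u i * rep_germ (L i k) y) * rep_germ (c k) y)"
        using elim by (simp add: sum_distrib_right)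
      also have "(\<Sum>k<N. (\<Sum>i<N. u i * rep_germ (L i k) y) * rep_germ (c k) y) = 0"
        using u by (simp add: forms_def)
      finally show "pair u a y = pair u b y" by simp
    qed
  qed
qed

text \<open>
  Multiplying a relation by \<open>s\<close> gives a relation again.
\<close>

lemma eventually_oper_forms:
  "\<forall>\<^sub>F y in nhds 0. \<forall>u\<in>forms y. oper (mult_mat s) y u \<in> forms y"
proof -
  have 1: "\<forall>\<^sub>F y in nhds 0. \<forall>k\<in>{..<N}. \<forall>u. pair (oper (mult_mat s) y u) (\<lambda>i. L i k) y =
      pair u (mat_apply (mult_mat s) (\<lambda>i. L i k)) y"
    by (intro eventually_ball_finite ballI eventually_pair_oper) auto
  have 2: "\<forall>\<^sub>F y in nhds 0. \<forall>k\<in>{..<N}. \<forall>u\<in>forms y. pair u (mat_apply (mult_mat s) (\<lambda>i. L i k)) y =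
      pair u (\<lambda>_. 0) y"
    using column unfolding comb_def[symmetric]
    by (intro eventually_ball_finite ballI eventually_pair_eq) (auto simp: comb_mat_apply)
  show ?thesis using 1 2 eventually_pair_zero
  proof eventually_elim
    case (elim y)
    then have "pair (oper (mult_mat s) y u) (\<lambda>i. L i k) y = 0" if "u \<in> forms y" "k < N" for u k
      using that by simp
    then show ?case by (auto simp: forms_def pair_def oper_def)
  qed
qed

lemma eventually_oper_commute:
  "\<forall>\<^sub>F y in nhds 0. \<forall>u\<in>forms y. oper (mult_mat s) y (oper (mult_mat t) y u) =
    oper (mult_mat t) y (oper (mult_mat s) y u)"
proof -
  have 1: "\<forall>\<^sub>F y in nhds 0. \<forall>k\<in>{..<N}. \<forall>u. pair (oper (mult_mat t) y u) (\<lambda>i. mult_mat s i k) y =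
      pair u (mat_apply (mult_mat t) (\<lambda>i. mult_mat s i k)) y" for s t
    by (intro eventually_ball_finite ballI eventually_pair_oper) auto
  have 2: "\<forall>\<^sub>F y in nhds 0. \<forall>k\<in>{..<N}. \<forall>u\<in>forms y. pair u (mat_apply (mult_mat t) (\<lambda>i. mult_mat s i k)) y =
      pair u (mat_apply (mult_mat s) (\<lambda>i. mult_mat t i k)) y"
    by (intro eventually_ball_finite ballI eventually_pair_eq)
      (auto simp: comb_mat_apply comb_mult_mat mult.left_commute)
  show ?thesis using 1[of t s] 1[of s t] 2
  proof eventually_elim
    case (elim y)
    show ?case
    proof (intro ballI ext)
      fix u k assume "u \<in> forms y"
      then show "oper (mult_mat s) y (oper (mult_mat t) y u) k = oper (mult_mat t) y (oper (mult_mat s) y u) k"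
        using elim by (cases "k < N") (simp_all add: oper_def[of "mult_mat s" y "oper _ _ _"] oper_def[of "mult_mat t" y "oper _ _ _"])
    qed
  qed
qed

abbreviation coord_oper :: "'n \<Rightarrow> complex^'m \<Rightarrow> (nat \<Rightarrow> complex) \<Rightarrow> (nat \<Rightarrow> complex)" where
  "coord_oper j \<equiv> oper (mult_mat (coord_germ j))"

definition coord_poly :: "'n \<Rightarrow> complex^'m \<Rightarrow> complex poly" where
  "coord_poly j y = Polynomial.monom 1 (deg j) + (\<Sum>b<deg j. Polynomial.monom (rep_germ (low_coeff j b) y) b)"

lemma coeff_coord_poly:
  "Polynomial.coeff (coord_poly j y) b =
    (if b = deg j then 1 else if b < deg j then rep_germ (low_coeff j b) y else 0)"
proof -
  have "Polynomial.coeff (coord_poly j y) b = (if b = deg j then 1 else 0) +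
      (\<Sum>k<deg j. if k = b then rep_germ (low_coeff j k) y else 0)"
    by (simp add: coord_poly_def coeff_sum)
  then show ?thesis by simp
qed

lemma coord_poly_nonzero: "coord_poly j y \<noteq> 0"
  using coeff_coord_poly[of j y "deg j"] by auto

lemma degree_coord_poly: "Polynomial.degree (coord_poly j y) \<le> deg j"
  by (rule degree_le) (simp add: coeff_coord_poly)

lemma poly_coord_poly: "poly (coord_poly j y) s = s ^ deg j + (\<Sum>b<deg j. rep_germ (low_coeff j b) y * s ^ b)"
  by (simp add: coord_poly_def poly_sum poly_monom)

text \<open>
  The powers of the operator pair a form with the columns of the powers of the matrix, and the
  equation of the coordinate makes the corresponding combination of columns a relation.
\<close>

lemma eventually_coord_poly_oper:
  "\<forall>\<^sub>F y in nhds 0. \<forall>u\<in>forms y. poly_op (coord_oper j y) (coord_poly j y) u = (\<lambda>_. 0)"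
proof -
  define m where "m = mult_mat (coord_germ j)"
  define d where "d = deg j"
  define c where "c = (\<lambda>b. if b < d then low_coeff j b else 1)"
  define col where "col = (\<lambda>b k. (mat_apply m ^^ b) (unit_coeff k))"
  have pow: "\<forall>\<^sub>F y in nhds 0. \<forall>u. pair ((oper m y ^^ b) u) a y = pair u ((mat_apply m ^^ b) a) y" for a b
  proof (induction b arbitrary: a)
    case (Suc b)
    show ?case using Suc[of "mat_apply m a"] eventually_pair_oper[of m a]
      by eventually_elim (simp add: funpow_swap1[of "mat_apply m"])
  qed simp
  have 1: "\<forall>\<^sub>F y in nhds 0. \<forall>b\<in>{..d}. \<forall>k\<in>{..<N}. \<forall>u. pair ((oper m y ^^ b) u) (unit_coeff k) y = pair u (col b k) y"
    unfolding col_def by (intro eventually_ball_finite ballI pow) auto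
  have 2: "\<forall>\<^sub>F y in nhds 0. \<forall>k\<in>{..<N}. \<forall>u\<in>forms y. pair u (\<lambda>i. \<Sum>b\<in>{..d}. c b * col b k i) y = pair u (\<lambda>_. 0) y"
  proof (intro eventually_ball_finite ballI eventually_pair_eq)
    fix k assume k: "k \<in> {..<N}"
    have "comb (\<lambda>i. \<Sum>b\<in>{..d}. c b * col b k i) = (\<Sum>b\<le>d. \<phi> (c b) * coord_germ j ^ b) * gen k"
      using k by (subst comb_sum)
        (simp_all add: comb_scale col_def m_def comb_mat_apply_funpow comb_unit sum_distrib_right mult.assoc)
    also have "(\<Sum>b\<le>d. \<phi> (c b) * coord_germ j ^ b) = 0"
      using coord_equation[of j] by (simp add: lessThan_Suc_atMost[symmetric] c_def d_def add.commute)
    finally show "comb (\<lambda>i. \<Sum>b\<in>{..d}. c b * col b k i) = comb (\<lambda>_. 0)" by simp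
  qed auto
  have 3: "\<forall>\<^sub>F y in nhds 0. \<forall>k\<in>{..<N}. \<forall>u. pair u (\<lambda>i. \<Sum>b\<in>{..d}. c b * col b k i) y =
      (\<Sum>b\<le>d. \<Sum>i<N. u i * rep_germ (c b) y * rep_germ (col b k i) y)"
    by (intro eventually_ball_finite ballI eventually_pair_sum[of "{..d}" "\<lambda>b i. c b"]) auto
  show ?thesis
    using 1 2 3 eventually_pair_zero eventually_pair_unit rep_germ_one eventually_oper_forms[of "coord_germ j"]
  proof eventually_elim
    case (elim y)
    show ?case
    proof (intro ballI ext)
      fix u k assume u: "u \<in> forms y"
      have powu: "(oper m y ^^ b) u \<in> forms y" for b
        using u elim(7) by (induction b) (auto simp: m_def)
      have "poly_op (coord_oper j y) (coord_poly j y) u k = (\<Sum>b\<le>d. rep_germ (c b) y * (oper m y ^^ b) u k)"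
        unfolding poly_op_superset[OF degree_coord_poly] using elim(6)
        by (intro sum.cong) (auto simp: coeff_coord_poly c_def d_def m_def)
      also have "\<dots> = 0"
      proof (cases "k < N")
        case True
        have "(\<Sum>b\<le>d. rep_germ (c b) y * (oper m y ^^ b) u k) = (\<Sum>b\<le>d. rep_germ (c b) y * pair u (col b k) y)"
          using elim(1,5) True by (intro sum.cong) auto
        also have "\<dots> = (\<Sum>b\<le>d. \<Sum>i<N. u i * rep_germ (c b) y * rep_germ (col b k i) y)"
          by (simp add: pair_def sum_distrib_left mult_ac)
        also have "\<dots> = 0" using elim(2,3,4) True u by simp
        finally show ?thesis .
      next
        case False
        then have "(oper m y ^^ b) u k = 0" for b using formsD[OF powu] by simp
        then show ?thesis by simp
      qed
      finally show "poly_op (coord_oper j y) (coord_poly j y) u k = 0" .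
    qed
  qed
qed

text \<open>
  Near the origin the lower coefficients are small, and then so are the roots.
\<close>

lemma eventually_small_roots:
  assumes "\<epsilon> > 0"
  shows "\<forall>\<^sub>F y in nhds 0. \<forall>j s. poly (coord_poly j y) s = 0 \<longrightarrow> norm s < \<epsilon>"
proof -
  define \<eta> where "\<eta> = min \<epsilon> 1"
  have \<eta>: "\<eta> > 0" "\<eta> \<le> 1" "\<eta> \<le> \<epsilon>" using assms by (auto simp: \<eta>_def)
  have "\<forall>\<^sub>F y in nhds 0. (\<Sum>b<deg j. norm (rep_germ (low_coeff j b) y)) < \<eta> ^ deg j" for j
  proof -
    have "((\<lambda>y. \<Sum>b<deg j. norm (rep_germ (low_coeff j b) y)) \<longlongrightarrow>
        (\<Sum>b<deg j. norm (rep_germ (low_coeff j b) 0))) (nhds 0)"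
      using holo_fun_germ_isCont[OF holo_rep_germ]
      by (intro tendsto_sum tendsto_norm) (simp add: isCont_def tendsto_at_iff_tendsto_nhds)
    then show ?thesis by (rule order_tendstoD) (use low_coeff_0 \<eta> in auto)
  qed
  then have "\<forall>\<^sub>F y in nhds 0. \<forall>j\<in>UNIV. (\<Sum>b<deg j. norm (rep_germ (low_coeff j b) y)) < \<eta> ^ deg j"
    by (intro eventually_ball_finite) auto
  then show ?thesis
  proof eventually_elim
    case (elim y)
    show ?case
    proof (intro allI impI, rule ccontr)
      fix j s assume root: "poly (coord_poly j y) s = 0" and large: "\<not> norm s < \<epsilon>"
      let ?d = "deg j" and ?c = "\<lambda>b. norm (rep_germ (low_coeff j b) y)"
      have s: "\<eta> \<le> norm s" using large \<eta> by simp
      have d: "?d > 0"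
        using root by (cases "?d") (auto simp: poly_coord_poly)
      have "norm s ^ ?d = norm (\<Sum>b<?d. rep_germ (low_coeff j b) y * s ^ b)"
        using root unfolding poly_coord_poly by (metis add_eq_0_iff norm_minus_cancel norm_power)
      also have "\<dots> \<le> (\<Sum>b<?d. ?c b * norm s ^ b)"
        by (rule order_trans[OF norm_sum]) (simp add: norm_mult norm_power)
      also have "\<dots> \<le> (\<Sum>b<?d. ?c b * max 1 (norm s ^ (?d - 1)))"
      proof (intro sum_mono mult_left_mono)
        fix b assume b: "b \<in> {..<?d}"
        show "norm s ^ b \<le> max 1 (norm s ^ (?d - 1))"
        proof (cases "norm s \<le> 1")
          case True
          then show ?thesis by (simp add: power_le_one max.coboundedI1)
        next
          case False
          then show ?thesis using b power_increasing[of b "?d - 1" "norm s"] by auto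
        qed
      qed simp
      also have "\<dots> = (\<Sum>b<?d. ?c b) * max 1 (norm s ^ (?d - 1))" by (simp add: sum_distrib_right)
      also have "\<dots> < \<eta> ^ ?d * max 1 (norm s ^ (?d - 1))"
        using elim by (intro mult_strict_right_mono) auto
      also have "\<dots> \<le> norm s ^ ?d"
      proof (cases "norm s \<le> 1")
        case True
        then have "max 1 (norm s ^ (?d - 1)) = 1" by (simp add: power_le_one max_absorb1)
        then show ?thesis using s \<eta> by (simp add: power_mono)
      next
        case False
        then have "max 1 (norm s ^ (?d - 1)) = norm s ^ (?d - 1)"
          by (simp add: max_def one_le_power)
        moreover have "\<eta> ^ ?d \<le> norm s" using False \<eta> power_le_one[of \<eta> ?d] by linarith
        moreover have "norm s * norm s ^ (?d - 1) = norm s ^ ?d" using d by (simp add: power_eq_if)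
        ultimately show ?thesis by (metis mult_right_mono norm_ge_zero zero_le_power)
      qed
      finally show False by simp
    qed
  qed
qed

end

section \<open>Functional calculus\<close>

text \<open>
  The product of source and target is modelled on the sum of the index types, so that holomorphic
  functions on it need no new definition.
\<close>

definition src :: "complex^('n::finite + 'm::finite) \<Rightarrow> complex^'n" where
  "src z = (\<chi> j. vec_nth z (Inl j))"

definition tgt :: "complex^('n::finite + 'm::finite) \<Rightarrow> complex^'m" where
  "tgt z = (\<chi> k. vec_nth z (Inr k))"

definition join :: "complex^'n \<Rightarrow> complex^'m \<Rightarrow> complex^('n::finite + 'm::finite)" where
  "join x y = (\<chi> i. case i of Inl j \<Rightarrow> vec_nth x j | Inr k \<Rightarrow> vec_nth y k)"

lemma src_nth [simp]: "vec_nth (src z) j = vec_nth z (Inl j)"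
  by (simp add: src_def)

lemma tgt_nth [simp]: "vec_nth (tgt z) k = vec_nth z (Inr k)"
  by (simp add: tgt_def)

lemma join_nth [simp]: "vec_nth (join x y) (Inl j) = vec_nth x j" "vec_nth (join x y) (Inr k) = vec_nth y k"
  by (simp_all add: join_def)

lemma src_join [simp]: "src (join x y) = x" and tgt_join [simp]: "tgt (join x y) = y"
  by (simp_all add: Finite_Cartesian_Product.vec_eq_iff)

lemma holo_map_germ_src: "holo_map_germ (src :: complex^('n::finite + 'm::finite) \<Rightarrow> complex^'n)"
  by (rule holo_map_germI) (simp_all add: Finite_Cartesian_Product.vec_eq_iff holo_fun_germ_component)

lemma holo_map_germ_tgt: "holo_map_germ (tgt :: complex^('n::finite + 'm::finite) \<Rightarrow> complex^'m)"
  by (rule holo_map_germI) (simp_all add: Finite_Cartesian_Product.vec_eq_iff holo_fun_germ_component)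

lemma bounded_linear_src: "bounded_linear (src :: complex^('n::finite + 'm::finite) \<Rightarrow> complex^'n)"
  unfolding linear_conv_bounded_linear[symmetric]
  by (intro linearI) (simp_all add: Finite_Cartesian_Product.vec_eq_iff)

lemma bounded_linear_tgt: "bounded_linear (tgt :: complex^('n::finite + 'm::finite) \<Rightarrow> complex^'m)"
  unfolding linear_conv_bounded_linear[symmetric]
  by (intro linearI) (simp_all add: Finite_Cartesian_Product.vec_eq_iff)

lemma holo_fun_germ_compose': "holo_fun_germ h \<Longrightarrow> holo_map_germ f \<Longrightarrow> holo_fun_germ (\<lambda>x. h (f x))"
  using holo_fun_germ_compose[of h f] by (simp add: o_def)

context germ_presentation
begin

lemma holo_map_germ_graph: "holo_map_germ (\<lambda>x. join x (f x))"
proof (rule holo_map_germI)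
  show "join (0 :: complex^'n) (f 0) = 0"
  proof -
    have "vec_nth (join (0 :: complex^'n) (f 0)) i = 0" for i
      using f by (cases i) (simp_all add: holo_map_germ_def)
    then show ?thesis by (simp add: Finite_Cartesian_Product.vec_eq_iff)
  qed
  show "holo_fun_germ (\<lambda>x. vec_nth (join x (f x)) i)" for i
    by (cases i) (simp_all add: holo_fun_germ_component holo_map_germ_component[OF f])
qed

text \<open>
  At \<open>z = (x, y)\<close>, the form \<open>g\<close> is a joint eigenvector of the coordinates with eigenvalues \<open>x\<close>, and
  \<open>u\<close> is one modulo \<open>g\<close>. The vector \<open>\<xi>\<close> of correction terms acts as a tangent direction.
\<close>

definition second_level :: "complex^('n + 'm) \<Rightarrow> (nat \<Rightarrow> complex) \<Rightarrow> (nat \<Rightarrow> complex) \<Rightarrow> complex^'n \<Rightarrow> bool" where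
  "second_level z u g \<xi> \<longleftrightarrow> u \<in> forms (tgt z) \<and> g \<in> forms (tgt z) \<and>
     (\<forall>j. coord_oper j (tgt z) g = (\<lambda>i. vec_nth z (Inl j) * g i)) \<and>
     (\<forall>j. coord_oper j (tgt z) u = (\<lambda>i. vec_nth z (Inl j) * u i + vec_nth \<xi> j * g i))"

definition tangent :: "complex^'n \<Rightarrow> complex^('n + 'm)" where
  "tangent \<xi> = join \<xi> 0"

text \<open>
  A combination of the generators that lifts \<open>H\<close>: forms take on it the value of \<open>H\<close> at the joint
  eigenvalues, up to the first order in the tangent direction. With \<open>H\<close> a function of the source and
  target coordinates, multiplication by a coordinate and division by its equation stay within the
  class of functions considered.
\<close>

definition lifts :: "(complex^('n + 'm) \<Rightarrow> complex) \<Rightarrow> (nat \<Rightarrow> 'm germ) \<Rightarrow> bool" where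
  "lifts H a \<longleftrightarrow> holo_fun_germ H \<and> (\<forall>\<^sub>F z in nhds 0. \<forall>u g \<xi>. second_level z u g \<xi> \<longrightarrow>
     pair u a (tgt z) = H z * u 0 + frechet_derivative H (at z) (tangent \<xi>) * g 0)"

lemma second_level_eigenvector_refl: "second_level z u g \<xi> \<Longrightarrow> second_level z g g 0"
  by (simp add: second_level_def)

lemma tangent_0: "tangent 0 = 0"
proof -
  have "vec_nth (tangent 0) i = 0" for i by (cases i) (simp_all add: tangent_def)
  then show ?thesis by (simp add: Finite_Cartesian_Product.vec_eq_iff)
qed

lemma frechet_derivative_eqI: "(H has_derivative D) (at z) \<Longrightarrow> frechet_derivative H (at z) v = D v"
  using frechet_derivative_at by metis

lemma eventually_lifts:
  assumes "lifts H a"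
  shows "\<forall>\<^sub>F z in nhds 0. \<forall>u g \<xi>. second_level z u g \<xi> \<longrightarrow>
    pair u a (tgt z) = H z * u 0 + frechet_derivative H (at z) (tangent \<xi>) * g 0 \<and>
    pair g a (tgt z) = H z * g 0"
proof -
  have H: "holo_fun_germ H" using assms by (simp add: lifts_def)
  have 1: "\<forall>\<^sub>F z in nhds 0. \<forall>u g \<xi>. second_level z u g \<xi> \<longrightarrow>
     pair u a (tgt z) = H z * u 0 + frechet_derivative H (at z) (tangent \<xi>) * g 0"
    using assms by (simp add: lifts_def)
  show ?thesis using 1 eventually_has_derivative[OF H]
  proof eventually_elim
    case (elim z)
    have "frechet_derivative H (at z) (tangent 0) = 0"
      using linear_0[OF has_derivative_linear[OF elim(2)]] by (simp add: tangent_0)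
    then show ?case using elim(1) second_level_eigenvector_refl by fastforce
  qed
qed

lemma eventually_tgt: "\<forall>\<^sub>F y in nhds 0. P y \<Longrightarrow> \<forall>\<^sub>F z :: complex^('n + 'm) in nhds 0. P (tgt z)"
  by (rule eventually_map_germ[OF holo_map_germ_tgt])

lemma lifts_target: "lifts (\<lambda>z. rep_germ A (tgt z)) (\<lambda>i. A * unit_coeff 0 i)"
  unfolding lifts_def
proof
  show holo: "holo_fun_germ (\<lambda>z :: complex^('n + 'm). rep_germ A (tgt z))"
    by (rule holo_fun_germ_compose'[OF holo_rep_germ holo_map_germ_tgt])
  show "\<forall>\<^sub>F z in nhds 0. \<forall>u g \<xi>. second_level z u g \<xi> \<longrightarrow> pair u (\<lambda>i. A * unit_coeff 0 i) (tgt z) =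
      rep_germ A (tgt z) * u 0 + frechet_derivative (\<lambda>z. rep_germ A (tgt z)) (at z) (tangent \<xi>) * g 0"
    using eventually_tgt[OF eventually_pair_scale[of A "unit_coeff 0"]] eventually_tgt[OF eventually_pair_unit]
      eventually_tgt[OF eventually_has_derivative[OF holo_rep_germ[of A]]]
  proof eventually_elim
    case (elim z)
    have "((\<lambda>z. rep_germ A (tgt z)) has_derivative (\<lambda>v. frechet_derivative (rep_germ A) (at (tgt z)) (tgt v))) (at z)"
      using diff_chain_at[OF bounded_linear_imp_has_derivative[OF bounded_linear_tgt] elim(3)]
      by (simp add: o_def)
    then have "frechet_derivative (\<lambda>z. rep_germ A (tgt z)) (at z) (tangent \<xi>) = 0" for \<xi>
      using linear_0[OF has_derivative_linear[OF elim(3)]]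
      by (simp add: frechet_derivative_eqI tangent_def)
    then show ?case using elim(1,2) N by simp
  qed
qed

lemma lifts_add:
  assumes "lifts H a" "lifts K b" shows "lifts (\<lambda>z. H z + K z) (\<lambda>i. a i + b i)"
  unfolding lifts_def
proof
  have HK: "holo_fun_germ H" "holo_fun_germ K" using assms by (auto simp: lifts_def)
  then show "holo_fun_germ (\<lambda>z. H z + K z)" by (rule holo_fun_germ_add)
  show "\<forall>\<^sub>F z in nhds 0. \<forall>u g \<xi>. second_level z u g \<xi> \<longrightarrow> pair u (\<lambda>i. a i + b i) (tgt z) =
      (H z + K z) * u 0 + frechet_derivative (\<lambda>z. H z + K z) (at z) (tangent \<xi>) * g 0"
    using eventually_lifts[OF assms(1)] eventually_lifts[OF assms(2)] eventually_tgt[OF eventually_pair_add[of a b]]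
      eventually_has_derivative[OF HK(1)] eventually_has_derivative[OF HK(2)]
  proof eventually_elim
    case (elim z)
    have "frechet_derivative (\<lambda>z. H z + K z) (at z) v = frechet_derivative H (at z) v + frechet_derivative K (at z) v" for v
      by (rule frechet_derivative_eqI[OF has_derivative_add[OF elim(4,5)]])
    then show ?case using elim(1-3) by (simp add: algebra_simps)
  qed
qed

lemma lifts_zero: "lifts (\<lambda>_. 0) (\<lambda>_. 0)"
  unfolding lifts_def
proof
  show "\<forall>\<^sub>F z in nhds 0. \<forall>u g \<xi>. second_level z u g \<xi> \<longrightarrow> pair u (\<lambda>_. 0) (tgt z) =
      0 * u 0 + frechet_derivative (\<lambda>_. 0) (at z) (tangent \<xi>) * g 0"
    using eventually_tgt[OF eventually_pair_zero]
    by eventually_elim (simp add: frechet_derivative_eqI[OF has_derivative_const])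
qed (rule holo_fun_germ_const)

lemma lifts_sum:
  "finite I \<Longrightarrow> (\<And>b. b \<in> I \<Longrightarrow> \<exists>a. lifts (H b) a) \<Longrightarrow> \<exists>a. lifts (\<lambda>z. \<Sum>b\<in>I. H b z) a"
proof (induction I rule: finite_induct)
  case empty
  show ?case using lifts_zero by auto
next
  case (insert b I)
  obtain a a' where "lifts (H b) a" "lifts (\<lambda>z. \<Sum>b\<in>I. H b z) a'" using insert by blast
  then have "lifts (\<lambda>z. H b z + (\<Sum>b\<in>I. H b z)) (\<lambda>i. a i + a' i)" by (rule lifts_add)
  then show ?case using insert.hyps by auto
qed

lemma lifts_coord:
  assumes "lifts H a"
  shows "lifts (\<lambda>z. vec_nth z (Inl j) * H z) (mat_apply (mult_mat (coord_germ j)) a)"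
  unfolding lifts_def
proof
  have H: "holo_fun_germ H" using assms by (simp add: lifts_def)
  then show "holo_fun_germ (\<lambda>z. vec_nth z (Inl j) * H z)"
    by (intro holo_fun_germ_mult holo_fun_germ_component)
  show "\<forall>\<^sub>F z in nhds 0. \<forall>u g \<xi>. second_level z u g \<xi> \<longrightarrow>
      pair u (mat_apply (mult_mat (coord_germ j)) a) (tgt z) =
      vec_nth z (Inl j) * H z * u 0 +
      frechet_derivative (\<lambda>z. vec_nth z (Inl j) * H z) (at z) (tangent \<xi>) * g 0"
    using eventually_lifts[OF assms] eventually_has_derivative[OF H]
      eventually_tgt[OF eventually_pair_oper[of "mult_mat (coord_germ j)" a]]
  proof eventually_elim
    case (elim z)
    show ?case
    proof (intro allI impI)
      fix u g \<xi> assume s: "second_level z u g \<xi>"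
      have "((\<lambda>z. vec_nth z (Inl j)) has_derivative (\<lambda>v. vec_nth v (Inl j))) (at z)"
        by (rule bounded_linear_imp_has_derivative[OF bounded_linear_vec_nth])
      note D' = frechet_derivative_eqI[OF has_derivative_mult[OF this elim(2)], of "tangent \<xi>"]
      have D: "frechet_derivative (\<lambda>z. vec_nth z (Inl j) * H z) (at z) (tangent \<xi>) =
          vec_nth z (Inl j) * frechet_derivative H (at z) (tangent \<xi>) + vec_nth \<xi> j * H z"
        using D' by (simp add: tangent_def)
      have "pair u (mat_apply (mult_mat (coord_germ j)) a) (tgt z) = pair (coord_oper j (tgt z) u) a (tgt z)"
        using elim(3) by simp
      also have "\<dots> = vec_nth z (Inl j) * pair u a (tgt z) + vec_nth \<xi> j * pair g a (tgt z)"
        using s by (simp add: second_level_def pair_lin)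
      also have "\<dots> = vec_nth z (Inl j) * (H z * u 0 + frechet_derivative H (at z) (tangent \<xi>) * g 0)
          + vec_nth \<xi> j * (H z * g 0)"
        using elim(1) s by simp
      finally show "pair u (mat_apply (mult_mat (coord_germ j)) a) (tgt z) = vec_nth z (Inl j) * H z * u 0 +
          frechet_derivative (\<lambda>z. vec_nth z (Inl j) * H z) (at z) (tangent \<xi>) * g 0"
        unfolding D by (simp add: algebra_simps)
    qed
  qed
qed

lemma lifts_coord_power:
  assumes "\<exists>a. lifts H a" shows "\<exists>a. lifts (\<lambda>z. H z * vec_nth z (Inl j) ^ b) a"
proof (induction b)
  case 0
  show ?case using assms by simp
next
  case (Suc b)
  then obtain a where "lifts (\<lambda>z. H z * vec_nth z (Inl j) ^ b) a" by blast
  from lifts_coord[OF this, of j] show ?case by (auto simp: mult_ac)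
qed

lemma lifts_cong:
  assumes "lifts H a" "holo_fun_germ K" "\<forall>\<^sub>F z in nhds 0. H z = K z" shows "lifts K a"
  unfolding lifts_def
proof
  have H: "holo_fun_germ H" using assms(1) by (simp add: lifts_def)
  have "\<forall>\<^sub>F z in nhds 0. \<forall>\<^sub>F z' in nhds z. H z' = K z'"
    using assms(3) by (simp add: eventually_eventually)
  then show "\<forall>\<^sub>F z in nhds 0. \<forall>u g \<xi>. second_level z u g \<xi> \<longrightarrow>
     pair u a (tgt z) = K z * u 0 + frechet_derivative K (at z) (tangent \<xi>) * g 0"
    using eventually_lifts[OF assms(1)] eventually_has_derivative[OF H]
  proof eventually_elim
    case (elim z)
    have "H z = K z" using eventually_nhds_x_imp_x[OF elim(1)] .
    moreover have "(K has_derivative frechet_derivative H (at z)) (at z)"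
      using has_derivative_transform_eventually[OF elim(3), of K] elim(1) \<open>H z = K z\<close>
      by (simp add: eventually_nhds_conv_at)
    ultimately show ?case using elim(2) by (simp add: frechet_derivative_eqI)
  qed
qed (rule assms(2))

subsection \<open>Points of the source as eigenvectors\<close>

definition point_form :: "complex^'n \<Rightarrow> nat \<Rightarrow> complex" where
  "point_form x = (\<lambda>i. if i < N then rep_germ (gen i) x else 0)"

lemma eventually_pair_point_form: "\<forall>\<^sub>F x in nhds 0. pair (point_form x) a (f x) = rep_germ (comb a) x"
proof -
  have "\<forall>\<^sub>F x in nhds 0. \<forall>i\<in>{..<N}. rep_germ (gen i * \<phi> (a i)) x = rep_germ (gen i) x * rep_germ (\<phi> (a i)) x"
    by (intro eventually_ball_finite ballI rep_germ_times) auto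
  moreover have "\<forall>\<^sub>F x in nhds 0. \<forall>i\<in>{..<N}. rep_germ (\<phi> (a i)) x = rep_germ (a i) (f x)"
    by (intro eventually_ball_finite ballI rep_germ_pullback f) auto
  moreover have "\<forall>\<^sub>F x in nhds 0. rep_germ (comb a) x = (\<Sum>i<N. rep_germ (gen i * \<phi> (a i)) x)"
    unfolding comb_def by (rule rep_germ_sum) simp
  ultimately show ?thesis
    by eventually_elim (simp add: pair_def point_form_def)
qed

lemma eventually_point_form_forms: "\<forall>\<^sub>F x in nhds 0. point_form x \<in> forms (f x)"
proof -
  have "\<forall>\<^sub>F x in nhds 0. \<forall>k\<in>{..<N}. pair (point_form x) (\<lambda>i. L i k) (f x) = rep_germ (comb (\<lambda>i. L i k)) x"
    by (intro eventually_ball_finite ballI eventually_pair_point_form) auto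
  then show ?thesis using rep_germ_zero
    by eventually_elim (use column in \<open>auto simp: forms_def pair_def comb_def point_form_def\<close>)
qed

lemma eventually_point_form_eigenvector:
  "\<forall>\<^sub>F x in nhds 0. \<forall>j. coord_oper j (f x) (point_form x) = (\<lambda>i. vec_nth x j * point_form x i)"
proof -
  have "\<forall>\<^sub>F x in nhds 0. \<forall>i. coord_oper j (f x) (point_form x) i = vec_nth x j * point_form x i" for j
  proof -
    have 1: "\<forall>\<^sub>F x in nhds 0. \<forall>k\<in>{..<N}. pair (point_form x) (\<lambda>i. mult_mat (coord_germ j) i k) (f x) =
        rep_germ (comb (\<lambda>i. mult_mat (coord_germ j) i k)) x"
      by (intro eventually_ball_finite ballI eventually_pair_point_form) auto
    have 2: "\<forall>\<^sub>F x in nhds 0. \<forall>k\<in>{..<N}. rep_germ (coord_germ j * gen k) x = rep_germ (coord_germ j) x * rep_germ (gen k) x"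
      by (intro eventually_ball_finite ballI rep_germ_times) auto
    show ?thesis using 1 2 rep_coord_germ[of j]
      by eventually_elim (simp add: oper_def point_form_def comb_mult_mat)
  qed
  then have "\<forall>\<^sub>F x in nhds 0. \<forall>j\<in>UNIV. \<forall>i. coord_oper j (f x) (point_form x) i = vec_nth x j * point_form x i"
    by (intro eventually_ball_finite) auto
  then show ?thesis by eventually_elim (auto simp: fun_eq_iff)
qed

lemma eventually_point_form_0: "\<forall>\<^sub>F x in nhds 0. point_form x 0 = 1"
  using rep_germ_one by eventually_elim (simp add: point_form_def N gen0)

lemma eventually_second_level_point:
  "\<forall>\<^sub>F x in nhds 0. second_level (join x (f x)) (point_form x) (point_form x) 0"
  using eventually_point_form_forms eventually_point_form_eigenvector
  by eventually_elim (simp add: second_level_def)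

lemma rep_comb_lift:
  assumes "lifts H a"
  shows "\<forall>\<^sub>F x in nhds 0. rep_germ (comb a) x = H (join x (f x))"
  using eventually_map_germ[OF holo_map_germ_graph eventually_lifts[OF assms]]
    eventually_second_level_point eventually_pair_point_form[of a] eventually_point_form_0
  by eventually_elim fastforce

text \<open>
  If \<open>P\<close> vanishes on the graph of \<open>f\<close>, then a combination lifting it is a relation and takes the
  value zero on forms; by the product rule, this carries over to the multiples of \<open>P\<close>.
\<close>

lemma lifts_equation:
  assumes P: "lifts P a" and vanish: "\<forall>\<^sub>F x in nhds 0. P (join x (f x)) = 0" and Q: "holo_fun_germ Q"
  shows "lifts (\<lambda>z. P z * Q z) (\<lambda>_. 0)"
  unfolding lifts_def
proof
  have holo: "holo_fun_germ P" using P by (simp add: lifts_def)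
  then show "holo_fun_germ (\<lambda>z. P z * Q z)" using Q by (rule holo_fun_germ_mult)
  have "comb a = comb (\<lambda>_. 0)"
    unfolding germ_eq_iff comb_zero using rep_comb_lift[OF P] vanish rep_germ_zero
    by eventually_elim simp
  note pair_a = eventually_tgt[OF eventually_pair_eq[OF this]]
  show "\<forall>\<^sub>F z in nhds 0. \<forall>u g \<xi>. second_level z u g \<xi> \<longrightarrow> pair u (\<lambda>_. 0) (tgt z) =
      P z * Q z * u 0 + frechet_derivative (\<lambda>z. P z * Q z) (at z) (tangent \<xi>) * g 0"
    using eventually_lifts[OF P] pair_a eventually_tgt[OF eventually_pair_zero]
      eventually_has_derivative[OF holo] eventually_has_derivative[OF Q]
  proof eventually_elim
    case (elim z)
    show ?case
    proof (intro allI impI)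
      fix u g \<xi> assume s: "second_level z u g \<xi>"
      then have uv: "u \<in> forms (tgt z)" "g \<in> forms (tgt z)" by (auto simp: second_level_def)
      have 1: "P z * u 0 + frechet_derivative P (at z) (tangent \<xi>) * g 0 = 0" "P z * g 0 = 0"
        using elim(1-3) s uv by metis+
      have D: "frechet_derivative (\<lambda>z. P z * Q z) (at z) (tangent \<xi>) =
          P z * frechet_derivative Q (at z) (tangent \<xi>) + frechet_derivative P (at z) (tangent \<xi>) * Q z"
        by (rule frechet_derivative_eqI[OF has_derivative_mult[OF elim(4,5)]])
      have "P z * Q z * u 0 + frechet_derivative (\<lambda>z. P z * Q z) (at z) (tangent \<xi>) * g 0 =
          Q z * (P z * u 0 + frechet_derivative P (at z) (tangent \<xi>) * g 0) +
          frechet_derivative Q (at z) (tangent \<xi>) * (P z * g 0)"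
        unfolding D by (simp add: algebra_simps)
      also have "\<dots> = 0" using 1 by simp
      finally show "pair u (\<lambda>_. 0) (tgt z) = P z * Q z * u 0 +
          frechet_derivative (\<lambda>z. P z * Q z) (at z) (tangent \<xi>) * g 0"
        using elim(3) by simp
    qed
  qed
qed

lemma tgt_upd [simp]: "tgt (upd_vec z (Inl j) t) = tgt z"
  by (simp add: Finite_Cartesian_Product.vec_eq_iff)

text \<open>
  The dependence on the coordinates of the source is removed one variable at a time, by division by
  the equation of the coordinate: the coefficients of the remainder do not depend on it, and the
  multiple of the equation lifts to zero. What depends on the target only lifts to a multiple of the
  first generator.
\<close>

lemma lifts_exists_aux:
  assumes "finite J" "holo_fun_germ H" "\<And>l z t. l \<notin> J \<Longrightarrow> H (upd_vec z (Inl l) t) = H z"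
  shows "\<exists>a. lifts H a"
  using assms
proof (induction J arbitrary: H rule: finite_induct)
  case empty
  \<comment> \<open>The coordinates of the source can be set to zero without changing \<open>H\<close>.\<close>
  have zero_out: "H z = H (\<chi> i. case i of Inl l \<Rightarrow> if l \<in> K then 0 else vec_nth z i | Inr k \<Rightarrow> vec_nth z i)"
    if "finite K" for K z
    using that
  proof (induction K rule: finite_induct)
    case empty
    have "(\<chi> i. case i of Inl l \<Rightarrow> if l \<in> {} then 0 else vec_nth z i | Inr k \<Rightarrow> vec_nth z i) = z"
      by (simp add: Finite_Cartesian_Product.vec_eq_iff split: sum.split)
    then show ?case by simp
  next
    case (insert l K)
    have "(\<chi> i. case i of Inl l' \<Rightarrow> if l' \<in> insert l K then 0 else vec_nth z i | Inr k \<Rightarrow> vec_nth z i) =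
        upd_vec (\<chi> i. case i of Inl l \<Rightarrow> if l \<in> K then 0 else vec_nth z i | Inr k \<Rightarrow> vec_nth z i) (Inl l) 0"
      by (auto simp: Finite_Cartesian_Product.vec_eq_iff split: sum.split)
    then show ?case using insert.IH empty.prems(2)[of l] by simp
  qed
  have "H z = H (join 0 (tgt z))" for z
  proof -
    have "(\<chi> i. case i of Inl l \<Rightarrow> if l \<in> UNIV then 0 else vec_nth z i | Inr k \<Rightarrow> vec_nth z i) = join 0 (tgt z)"
      by (simp add: Finite_Cartesian_Product.vec_eq_iff join_def split: sum.split)
    then show ?thesis using zero_out[of UNIV z] by simp
  qed
  moreover define A where "A = abs_germ (\<lambda>y. H (join 0 y))"
  have "holo_map_germ (\<lambda>y :: complex^'m. join (0 :: complex^'n) y)"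
  proof (rule holo_map_germI)
    have "vec_nth (join (0 :: complex^'n) (0 :: complex^'m)) i = 0" for i by (cases i) simp_all
    then show "join (0 :: complex^'n) (0 :: complex^'m) = 0" by (simp add: Finite_Cartesian_Product.vec_eq_iff)
    show "holo_fun_germ (\<lambda>y :: complex^'m. vec_nth (join (0 :: complex^'n) y) i)" for i
      by (cases i) (simp_all add: holo_fun_germ_component holo_fun_germ_const)
  qed
  then have "\<forall>\<^sub>F y in nhds 0. rep_germ A y = H (join 0 y)"
    unfolding A_def by (intro rep_abs_germ holo_fun_germ_compose'[OF empty.prems(1)])
  from eventually_tgt[OF this] have "\<forall>\<^sub>F z in nhds 0. rep_germ A (tgt z) = H z"
    by eventually_elim (simp add: \<open>\<And>z. H z = H (join 0 (tgt z))\<close>[symmetric])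
  then show ?case using lifts_cong[OF lifts_target empty.prems(1)] by blast
next
  case (insert j J)
  define c where "c = (\<lambda>b (z :: complex^('n + 'm)). rep_germ (low_coeff j b) (tgt z))"
  define P where "P = (\<lambda>z :: complex^('n + 'm). vec_nth z (Inl j) ^ deg j + (\<Sum>b<deg j. c b z * vec_nth z (Inl j) ^ b))"
  have tgt0: "tgt (0 :: complex^('n + 'm)) = 0" by (simp add: Finite_Cartesian_Product.vec_eq_iff)
  obtain Q R where Q: "holo_fun_germ Q" and R: "\<And>b. b < deg j \<Longrightarrow> holo_fun_germ (R b)"
    and Rj: "\<And>b z t. R b (upd_vec z (Inl j) t) = R b z"
    and Rl: "\<And>l b z t. (\<And>z t. H (upd_vec z l t) = H z) \<Longrightarrow>
      (\<And>b z t. b < deg j \<Longrightarrow> c b (upd_vec z l t) = c b z) \<Longrightarrow> R b (upd_vec z l t) = R b z"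
    and div: "\<forall>\<^sub>F z in nhds 0. H z = (vec_nth z (Inl j) ^ deg j + (\<Sum>b<deg j. c b z * vec_nth z (Inl j) ^ b)) * Q z
      + (\<Sum>b<deg j. R b z * vec_nth z (Inl j) ^ b)"
  proof (rule Weierstrass_division[of H "deg j" c "Inl j"])
    show "holo_fun_germ (c b)" for b
      unfolding c_def by (rule holo_fun_germ_compose'[OF holo_rep_germ holo_map_germ_tgt])
    show "c b 0 = 0" if "b < deg j" for b using low_coeff_0[OF that] by (simp add: c_def tgt0)
    show "c b (upd_vec z (Inl j) t) = c b z" for b z t by (simp add: c_def)
  qed (use insert.prems(1) in auto)
  have "\<exists>a. lifts (R b) a" if b: "b < deg j" for b
  proof (rule insert.IH[OF R[OF b]])
    fix l z t assume "l \<notin> J"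
    then show "R b (upd_vec z (Inl l) t) = R b z"
      using Rj Rl[of "Inl l"] insert.prems(2)[of l] by (cases "l = j") (auto simp: c_def)
  qed
  then have "\<exists>a. lifts (\<lambda>z. \<Sum>b<deg j. R b z * vec_nth z (Inl j) ^ b) a"
    by (intro lifts_sum lifts_coord_power) auto
  moreover have "lifts (\<lambda>z. P z * Q z) (\<lambda>_. 0)"
  proof -
    have "\<exists>a. lifts (\<lambda>z. \<Sum>b<deg j. c b z * vec_nth z (Inl j) ^ b) a"
      unfolding c_def by (intro lifts_sum lifts_coord_power) (auto intro: lifts_target)
    then obtain a where a: "lifts (\<lambda>z. \<Sum>b<deg j. c b z * vec_nth z (Inl j) ^ b) a" by blast
    have "lifts (\<lambda>z. 1) (\<lambda>i. 1 * unit_coeff 0 i)"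
      by (rule lifts_cong[OF lifts_target holo_fun_germ_const eventually_tgt[OF rep_germ_one]])
    then have "\<exists>a. lifts (\<lambda>z. 1 * vec_nth z (Inl j) ^ deg j) a"
      by (intro lifts_coord_power) blast
    then obtain a' where a': "lifts (\<lambda>z. vec_nth z (Inl j) ^ deg j) a'" by auto
    have P: "lifts P (\<lambda>i. a' i + a i)" unfolding P_def by (rule lifts_add[OF a' a])
    have "\<forall>\<^sub>F x in nhds 0. P (join x (f x)) = 0"
    proof -
      have 1: "\<forall>\<^sub>F x in nhds 0. rep_germ (coord_germ j ^ deg j + (\<Sum>b<deg j. \<phi> (low_coeff j b) * coord_germ j ^ b)) x =
          rep_germ (coord_germ j ^ deg j) x + rep_germ (\<Sum>b<deg j. \<phi> (low_coeff j b) * coord_germ j ^ b) x"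
        by (rule rep_germ_plus)
      have 2: "\<forall>\<^sub>F x in nhds 0. rep_germ (\<Sum>b<deg j. \<phi> (low_coeff j b) * coord_germ j ^ b) x =
          (\<Sum>b<deg j. rep_germ (\<phi> (low_coeff j b) * coord_germ j ^ b) x)"
        by (rule rep_germ_sum) simp
      have 3: "\<forall>\<^sub>F x in nhds 0. \<forall>b\<in>{..<deg j}. rep_germ (\<phi> (low_coeff j b) * coord_germ j ^ b) x =
          rep_germ (\<phi> (low_coeff j b)) x * rep_germ (coord_germ j ^ b) x"
        by (intro eventually_ball_finite ballI rep_germ_times) auto
      have 4: "\<forall>\<^sub>F x in nhds 0. \<forall>b\<in>{..deg j}. rep_germ (coord_germ j ^ b) x = rep_germ (coord_germ j) x ^ b"
        by (intro eventually_ball_finite ballI rep_germ_power) auto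
      have 5: "\<forall>\<^sub>F x in nhds 0. \<forall>b\<in>{..<deg j}. rep_germ (\<phi> (low_coeff j b)) x = rep_germ (low_coeff j b) (f x)"
        by (intro eventually_ball_finite ballI rep_germ_pullback f) auto
      show ?thesis using 1 2 3 4 5 rep_coord_germ[of j] rep_germ_zero
        by eventually_elim (simp add: coord_equation P_def c_def)
    qed
    then show ?thesis by (rule lifts_equation[OF P _ Q])
  qed
  ultimately obtain a where "lifts (\<lambda>z. P z * Q z + (\<Sum>b<deg j. R b z * vec_nth z (Inl j) ^ b)) a"
    using lifts_add by blast
  moreover have "\<forall>\<^sub>F z in nhds 0. P z * Q z + (\<Sum>b<deg j. R b z * vec_nth z (Inl j) ^ b) = H z"
    using div by eventually_elim (simp add: P_def)
  ultimately show ?case using lifts_cong insert.prems(1) by blast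
qed

lemma lifts_exists: "holo_fun_germ H \<Longrightarrow> \<exists>a. lifts H a"
  by (rule lifts_exists_aux[of UNIV]) auto

text \<open>
  The lift of \<open>h\<close> and the given combination represent the same germ, so forms do not distinguish
  them.
\<close>

lemma eventually_calculus:
  assumes h: "holo_fun_germ h" and a: "\<forall>\<^sub>F x in nhds 0. rep_germ (comb a) x = h x"
  shows "\<forall>\<^sub>F z in nhds 0. \<forall>u g \<xi>. second_level z u g \<xi> \<longrightarrow>
    pair u a (tgt z) = h (src z) * u 0 + frechet_derivative h (at (src z)) \<xi> * g 0"
proof -
  define H where "H = (\<lambda>z :: complex^('n + 'm). h (src z))"
  have "holo_fun_germ H" unfolding H_def by (rule holo_fun_germ_compose'[OF h holo_map_germ_src])
  then obtain b where b: "lifts H b" using lifts_exists by blast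
  have "comb b = comb a"
    unfolding germ_eq_iff using rep_comb_lift[OF b] a by eventually_elim (simp add: H_def)
  note pair_b = eventually_tgt[OF eventually_pair_eq[OF this]]
  show ?thesis
    using eventually_lifts[OF b] pair_b eventually_map_germ[OF holo_map_germ_src eventually_has_derivative[OF h]]
  proof eventually_elim
    case (elim z)
    have "(H has_derivative (\<lambda>v. frechet_derivative h (at (src z)) (src v))) (at z)"
      using diff_chain_at[OF bounded_linear_imp_has_derivative[OF bounded_linear_src] elim(3)]
      by (simp add: o_def H_def)
    then have "frechet_derivative H (at z) (tangent \<xi>) = frechet_derivative h (at (src z)) \<xi>" for \<xi>
      by (simp add: frechet_derivative_eqI tangent_def)
    then show ?case using elim(1,2) by (simp add: H_def second_level_def)
  qed
qed

section \<open>Forms at a generic point\<close>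

text \<open>
  Suppose that a form with first value zero does not vanish identically, and let \<open>x\<close> be a point near
  the origin that is alone in its fibre and where it does not vanish. The joint eigenvectors among
  the forms at \<open>f x\<close> are multiples of evaluations at points of the fibre, that is, of the
  evaluation at \<open>x\<close>. The given form is not one of them, so there is an eigenvector of the second
  level; the functional calculus applied to the components of \<open>f\<close> turns it into a nonzero tangent
  vector at \<open>x\<close> that the derivative of \<open>f\<close> annihilates. Such points \<open>x\<close> form a nonempty open set
  on which \<open>f\<close> is injective, so the derivative of \<open>f\<close> is injective at some of them.
\<close>

theorem form_vanishes:
  assumes generic: "generically_one_to_one f" and w0: "w 0 = 0"
    and w: "\<And>k. k < N \<Longrightarrow> (\<Sum>i<N. w i * \<phi> (L i k)) = 0" and i0: "i0 < N"
  shows "w i0 = 0"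
proof (rule ccontr)
  assume nz: "w i0 \<noteq> 0"
  define W where "W = (\<lambda>x i. if i < N then rep_germ (w i) x else 0)"
  \<comment> \<open>The components of \<open>f\<close> and the generators in terms of forms.\<close>
  have calc_f: "\<forall>\<^sub>F z in nhds 0. \<forall>k\<in>UNIV. \<forall>u g \<xi>. second_level z u g \<xi> \<longrightarrow>
      pair u (\<lambda>i. coord_germ k * unit_coeff 0 i) (tgt z) = vec_nth (f (src z)) k * u 0 +
        frechet_derivative (\<lambda>x. vec_nth (f x) k) (at (src z)) \<xi> * g 0"
  proof (intro eventually_ball_finite ballI eventually_calculus holo_map_germ_component f)
    fix k
    show "\<forall>\<^sub>F x in nhds 0. rep_germ (comb (\<lambda>i. coord_germ k * unit_coeff 0 i)) x = vec_nth (f x) k"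
      using rep_germ_pullback[OF f, of "coord_germ k"] eventually_map_germ[OF f rep_coord_germ[of k]]
      by eventually_elim (simp add: comb_scale comb_unit N gen0)
  qed auto
  have calc_gen: "\<forall>\<^sub>F z in nhds 0. \<forall>i\<in>{..<N}. \<forall>u g \<xi>. second_level z u g \<xi> \<longrightarrow>
      pair u (unit_coeff i) (tgt z) = rep_germ (gen i) (src z) * u 0 +
        frechet_derivative (rep_germ (gen i)) (at (src z)) \<xi> * g 0"
    by (intro eventually_ball_finite ballI eventually_calculus holo_rep_germ) (auto simp: comb_unit)
  have pair_coord: "\<forall>\<^sub>F y in nhds 0. \<forall>k\<in>UNIV. \<forall>u. pair u (\<lambda>i. coord_germ k * unit_coeff 0 i) y =
      rep_germ (coord_germ k) y * pair u (unit_coeff 0) y"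
    by (intro eventually_ball_finite ballI eventually_pair_scale) auto
  have coords: "\<forall>\<^sub>F y in nhds 0. \<forall>k\<in>UNIV. rep_germ (coord_germ k :: 'm germ) y = vec_nth y k"
    by (intro eventually_ball_finite ballI rep_coord_germ) auto
  have "\<forall>\<^sub>F z in nhds 0. \<forall>u g \<xi>. second_level z u g \<xi> \<longrightarrow>
      (\<forall>k. vec_nth (tgt z) k * u 0 = vec_nth (f (src z)) k * u 0 +
        frechet_derivative (\<lambda>x. vec_nth (f x) k) (at (src z)) \<xi> * g 0) \<and>
      (\<forall>i<N. u i = rep_germ (gen i) (src z) * u 0 +
        frechet_derivative (rep_germ (gen i)) (at (src z)) \<xi> * g 0)"
    using calc_f calc_gen eventually_tgt[OF pair_coord] eventually_tgt[OF coords] eventually_tgt[OF eventually_pair_unit]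
  proof eventually_elim
    case (elim z)
    show ?case
    proof (intro allI impI conjI)
      fix u g \<xi> k assume s: "second_level z u g \<xi>"
      have "pair u (\<lambda>i. coord_germ k * unit_coeff 0 i) (tgt z) = vec_nth (tgt z) k * u 0"
        using elim(3-5) N by simp
      then show "vec_nth (tgt z) k * u 0 = vec_nth (f (src z)) k * u 0 +
          frechet_derivative (\<lambda>x. vec_nth (f x) k) (at (src z)) \<xi> * g 0"
        using elim(1) s by auto
    next
      fix u g \<xi> i assume s: "second_level z u g \<xi>" and "i < N"
      then show "u i = rep_germ (gen i) (src z) * u 0 +
          frechet_derivative (rep_germ (gen i)) (at (src z)) \<xi> * g 0"
        using elim(2,5) by auto
    qed
  qed
  then obtain \<delta> where \<delta>: "\<delta> > 0" and calculus: "\<And>z u g \<xi>. dist z 0 < \<delta> \<Longrightarrow> second_level z u g \<xi> \<Longrightarrow>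
      (\<forall>k. vec_nth (tgt z) k * u 0 = vec_nth (f (src z)) k * u 0 +
        frechet_derivative (\<lambda>x. vec_nth (f x) k) (at (src z)) \<xi> * g 0) \<and>
      (\<forall>i<N. u i = rep_germ (gen i) (src z) * u 0 +
        frechet_derivative (rep_germ (gen i)) (at (src z)) \<xi> * g 0)"
    unfolding eventually_nhds_metric by metis
  from generic obtain U U1 where U: "open U" "0 \<in> U" "holo_map_on f U"
    and U1: "open U1" "U1 \<subseteq> U" "U \<subseteq> closure U1" "\<And>x x'. x \<in> U1 \<Longrightarrow> x' \<in> U \<Longrightarrow> f x' = f x \<Longrightarrow> x' = x"
    unfolding generically_one_to_one_def by metis
  obtain \<rho> where \<rho>: "\<rho> > 0" "ball 0 \<rho> \<subseteq> U" using U open_contains_ball by blast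
  define C where "C = real (CARD('n + 'm))"
  have C: "C > 0" by (simp only: C_def of_nat_0_less_iff zero_less_card_finite)
  define \<epsilon> where "\<epsilon> = min (\<delta> / C) (\<rho> / C)"
  have \<epsilon>: "\<epsilon> > 0" "\<epsilon> * C \<le> \<delta>" "\<epsilon> * C \<le> \<rho>"
    using \<delta> \<rho> C by (auto simp: \<epsilon>_def min_def field_simps)
  \<comment> \<open>A point with all coordinates below \<open>\<epsilon>\<close> lies in the balls of radius \<open>\<delta>\<close> and \<open>\<rho>\<close>.\<close>
  have small: "dist z 0 < \<delta> \<and> src z \<in> U" if "\<And>i. norm (vec_nth z i) < \<epsilon>" for z :: "complex^('n + 'm)"
  proof -
    have "norm z \<le> (\<Sum>i\<in>UNIV. norm (vec_nth z i))"
      unfolding norm_vec_def by (rule L2_set_le_sum) auto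
    also have "\<dots> < (\<Sum>i\<in>(UNIV :: ('n + 'm) set). \<epsilon>)" by (rule sum_strict_mono) (use that in auto)
    also have "\<dots> = \<epsilon> * C" by (simp add: C_def)
    finally have "norm z < \<epsilon> * C" .
    moreover have "norm (src z) \<le> norm z"
    proof -
      have "norm (src z) = L2_set (\<lambda>i. norm (vec_nth z i)) (range Inl)"
        unfolding norm_vec_def L2_set_def by (simp add: sum.reindex)
      also have "\<dots> \<le> norm z"
        unfolding norm_vec_def L2_set_def by (intro real_sqrt_le_mono sum_mono2) auto
      finally show ?thesis .
    qed
    ultimately show ?thesis using \<epsilon> \<rho>(2) by (auto simp: subset_iff)
  qed
  \<comment> \<open>What holds near the origin is collected before a point is chosen.\<close>
  have forms_W: "\<forall>\<^sub>F x in nhds 0. W x \<in> forms (f x)"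
  proof -
    have 1: "\<forall>\<^sub>F x in nhds 0. \<forall>k\<in>{..<N}. \<forall>i\<in>{..<N}. rep_germ (w i * \<phi> (L i k)) x = rep_germ (w i) x * rep_germ (\<phi> (L i k)) x"
      by (intro eventually_ball_finite ballI rep_germ_times) auto
    have 2: "\<forall>\<^sub>F x in nhds 0. \<forall>k\<in>{..<N}. \<forall>i\<in>{..<N}. rep_germ (\<phi> (L i k)) x = rep_germ (L i k) (f x)"
      by (intro eventually_ball_finite ballI rep_germ_pullback f) auto
    have 3: "\<forall>\<^sub>F x in nhds 0. \<forall>k\<in>{..<N}. rep_germ (\<Sum>i<N. w i * \<phi> (L i k)) x = (\<Sum>i<N. rep_germ (w i * \<phi> (L i k)) x)"
      by (intro eventually_ball_finite ballI rep_germ_sum) auto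
    show ?thesis using 1 2 3 rep_germ_zero
      by eventually_elim (use w in \<open>auto simp: forms_def W_def\<close>)
  qed
  have W0: "\<forall>\<^sub>F x in nhds 0. W x 0 = 0"
    using rep_germ_zero by eventually_elim (simp add: W_def w0)
  have near: "\<forall>\<^sub>F y :: complex^'m in nhds 0. \<forall>k. norm (vec_nth y k) < \<epsilon>"
    unfolding eventually_nhds_metric
    by (intro exI[of _ \<epsilon>]) (auto simp: \<epsilon>(1) intro: le_less_trans[OF Finite_Cartesian_Product.norm_nth_le])
  have near_x: "\<forall>\<^sub>F x :: complex^'n in nhds 0. \<forall>k. norm (vec_nth x k) < \<epsilon>"
    unfolding eventually_nhds_metric
    by (intro exI[of _ \<epsilon>]) (auto simp: \<epsilon>(1) intro: le_less_trans[OF Finite_Cartesian_Product.norm_nth_le])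
  have inv: "\<forall>\<^sub>F y in nhds 0. \<forall>j\<in>UNIV. \<forall>u\<in>forms y. coord_oper j y u \<in> forms y"
    by (intro eventually_ball_finite ballI eventually_oper_forms) auto
  have comm: "\<forall>\<^sub>F y in nhds 0. \<forall>j\<in>UNIV. \<forall>l\<in>UNIV. \<forall>u\<in>forms y.
      coord_oper j y (coord_oper l y u) = coord_oper l y (coord_oper j y u)"
    by (intro eventually_ball_finite ballI eventually_oper_commute) auto
  have ann: "\<forall>\<^sub>F y in nhds 0. \<forall>j\<in>UNIV. \<forall>u\<in>forms y. poly_op (coord_oper j y) (coord_poly j y) u = (\<lambda>_. 0)"
    by (intro eventually_ball_finite ballI eventually_coord_poly_oper) auto
  have degenerate: "\<forall>\<^sub>F x in nhds 0. x \<in> U1 \<longrightarrow> rep_germ (w i0) x \<noteq> 0 \<longrightarrow>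
      (\<exists>\<xi>. \<xi> \<noteq> 0 \<and> (\<forall>k. frechet_derivative (\<lambda>x. vec_nth (f x) k) (at x) \<xi> = 0))"
    using forms_W W0 near_x eventually_map_germ[OF f near] eventually_map_germ[OF f inv] eventually_map_germ[OF f comm]
      eventually_map_germ[OF f ann] eventually_map_germ[OF f eventually_small_roots[OF \<epsilon>(1)]]
      eventually_point_form_forms eventually_point_form_eigenvector eventually_point_form_0
  proof eventually_elim
    case (elim x)
    show ?case
    proof (intro impI)
      assume x: "x \<in> U1" and wx: "rep_germ (w i0) x \<noteq> 0"
      have "\<exists>u\<in>forms (f x). \<exists>\<xi>. \<xi> \<noteq> (\<lambda>_. 0) \<and>
          (\<forall>j. coord_oper j (f x) u = (\<lambda>i. vec_nth x j * u i + \<xi> j * point_form x i))"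
      proof (rule second_level_eigenvector[where p = "\<lambda>j. coord_poly j (f x)" and w = "W x"])
        show "lin_op (coord_oper j (f x))" for j by (rule lin_op_oper)
        show "closed_lin (forms (f x))" by (rule closed_lin_forms)
        show "coord_poly j (f x) \<noteq> 0" for j by (rule coord_poly_nonzero)
        show "point_form x \<noteq> (\<lambda>_. 0)" using elim(11) by (metis zero_neq_one)
        show "W x \<noteq> (\<lambda>i. c * point_form x i)" for c
        proof
          assume *: "W x = (\<lambda>i. c * point_form x i)"
          then have "c = 0" using elim(2,11) by (metis mult.right_neutral)
          then have "W x i0 = 0" using * by simp
          then show False using wx i0 by (simp add: W_def)
        qed
        fix u \<psi> assume u: "u \<in> forms (f x)" and eig: "\<And>j. coord_oper j (f x) u = (\<lambda>i. \<psi> j * u i)"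
        show "\<exists>c. u = (\<lambda>i. c * point_form x i)"
        proof (cases "u = (\<lambda>_. 0)")
          case True
          then show ?thesis by (intro exI[of _ 0]) simp
        next
          case False
          then obtain i1 where i1: "u i1 \<noteq> 0" by (auto simp: fun_eq_iff)
          have root: "poly (coord_poly j (f x)) (\<psi> j) = 0" for j
          proof -
            have pow: "(coord_oper j (f x) ^^ b) u = (\<lambda>i. \<psi> j ^ b * u i)" for b
            proof (induction b)
              case (Suc b)
              have "coord_oper j (f x) (\<lambda>i. \<psi> j ^ b * u i + 0 * u i) = (\<lambda>i. \<psi> j ^ b * (\<psi> j * u i) + 0 * (\<psi> j * u i))"
                unfolding lin_opD[OF lin_op_oper] eig ..
              then show ?case by (simp add: Suc mult_ac)
            qed simp
            have "poly_op (coord_oper j (f x)) (coord_poly j (f x)) u i1 = 0"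
              using elim(7) u by simp
            then have "poly (coord_poly j (f x)) (\<psi> j) * u i1 = 0"
              by (simp add: poly_op_def pow poly_altdef sum_distrib_right mult.assoc)
            then show ?thesis using i1 by simp
          qed
          define z where "z = join (\<chi> j. \<psi> j) (f x)"
          have "norm (vec_nth z i) < \<epsilon>" for i
            using root elim(4,8) by (cases i) (auto simp: z_def)
          then have z: "dist z 0 < \<delta>" "src z \<in> U" using small by auto
          have "second_level z u (\<lambda>_. 0) 0"
            using u eig closed_lin_forms[of "f x"] lin_opD[OF lin_op_oper, of _ "f x" 0 u 0 u]
            by (simp add: second_level_def z_def closed_lin_def)
          note calc = calculus[OF z(1) this]
          have tz: "tgt z = f x" by (simp add: z_def)
          have fz: "vec_nth (f x) k * u 0 = vec_nth (f (src z)) k * u 0" for k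
            using conjunct1[OF calc, rule_format, of k] by (simp only: tz mult_zero_right add_0_right)
          have uz: "u i = rep_germ (gen i) (src z) * u 0" if "i < N" for i
            using conjunct2[OF calc, rule_format, OF that] by (simp only: mult_zero_right add_0_right)
          have "i1 < N" using formsD[OF u, of i1] i1 by (meson leI)
          from uz[OF this] have "u 0 \<noteq> 0" using i1 by (metis mult_zero_right)
          then have "f (src z) = f x" using fz by (simp add: Finite_Cartesian_Product.vec_eq_iff)
          then have "src z = x" using U1(4)[OF x z(2)] by simp
          then have "u i = u 0 * point_form x i" for i
            using uz[of i] formsD[OF u, of i] by (simp add: point_form_def)
          then show ?thesis by blast
        qed
      qed (use elim in auto)
      then obtain u \<xi> where u: "u \<in> forms (f x)" and \<xi>: "\<xi> \<noteq> (\<lambda>_. 0)"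
        and eig: "\<And>j. coord_oper j (f x) u = (\<lambda>i. vec_nth x j * u i + \<xi> j * point_form x i)" by blast
      define z where "z = join x (f x)"
      have "norm (vec_nth z i) < \<epsilon>" for i using elim(3,4) by (cases i) (auto simp: z_def)
      then have z: "dist z 0 < \<delta>" using small by auto
      have "second_level z u (point_form x) (\<chi> j. \<xi> j)"
        using u eig elim by (simp add: second_level_def z_def)
      note calc = calculus[OF z this]
      have st: "tgt z = f x" "src z = x" by (simp_all add: z_def)
      have "\<forall>k. frechet_derivative (\<lambda>x. vec_nth (f x) k) (at x) (\<chi> j. \<xi> j) = 0"
        using conjunct1[OF calc] elim(11) unfolding st by simp
      moreover have "(\<chi> j. \<xi> j) \<noteq> 0" using \<xi> by (auto simp: Finite_Cartesian_Product.vec_eq_iff fun_eq_iff)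
      ultimately show "\<exists>\<xi>. \<xi> \<noteq> 0 \<and> (\<forall>k. frechet_derivative (\<lambda>x. vec_nth (f x) k) (at x) \<xi> = 0)" by blast
    qed
  qed
  \<comment> \<open>This contradicts the existence of immersive points.\<close>
  obtain e where e: "e > 0" "holo_fun_on (rep_germ (w i0)) (ball 0 e)"
    using holo_fun_germ_ball[OF holo_rep_germ] .
  obtain e' where e': "e' > 0" "\<And>x. dist x 0 < e' \<Longrightarrow> x \<in> U1 \<Longrightarrow> rep_germ (w i0) x \<noteq> 0 \<Longrightarrow>
      (\<exists>\<xi>. \<xi> \<noteq> 0 \<and> (\<forall>k. frechet_derivative (\<lambda>x. vec_nth (f x) k) (at x) \<xi> = 0))"
    using degenerate unfolding eventually_nhds_metric by blast
  define r where "r = min (min e e') \<rho>"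
  have r: "r > 0" "r \<le> e" "r \<le> e'" "r \<le> \<rho>" using e e' \<rho> by (auto simp: r_def)
  have "holo_fun_on (rep_germ (w i0)) (ball 0 r)"
    by (rule holo_fun_on_subset[OF e(2)]) (use r in auto)
  then have "open (ball 0 r \<inter> rep_germ (w i0) -` (- {0}))"
    by (intro continuous_open_preimage) (auto intro: holo_fun_on_continuous_on)
  define V where "V = ball 0 r \<inter> rep_germ (w i0) -` (- {0})"
  have V: "open V" by (simp add: V_def \<open>open (ball 0 r \<inter> rep_germ (w i0) -` (- {0}))\<close>)
  have "V \<noteq> {}"
  proof
    assume "V = {}"
    have "\<forall>\<^sub>F x in nhds 0. x \<in> ball 0 r" using r(1) by (intro eventually_nhds_in_open) auto
    then have "\<forall>\<^sub>F x in nhds 0. rep_germ (w i0) x = 0"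
      by eventually_elim (use \<open>V = {}\<close> in \<open>auto simp: V_def\<close>)
    then have "w i0 = 0" unfolding germ_eq_iff using rep_germ_zero by eventually_elim simp
    then show False using nz by simp
  qed
  then obtain p where p: "p \<in> V" by blast
  then have "p \<in> ball 0 \<rho>" using r(4) by (simp add: V_def)
  then have "p \<in> closure U1" using U1(3) \<rho>(2) by blast
  then have "V \<inter> closure U1 \<noteq> {}" using p by blast
  then have "U1 \<inter> V \<noteq> {}" using open_Int_closure_eq_empty[OF V] by blast
  moreover have "open (U1 \<inter> V)" using U1(1) V by auto
  moreover have "holo_map_on f (U1 \<inter> V)"
    unfolding holo_map_on_def
  proof
    fix i
    show "holo_fun_on (\<lambda>x. vec_nth (f x) i) (U1 \<inter> V)"
      by (rule holo_fun_on_subset[OF holo_map_on_component[OF U(3)]]) (use U1(1,2) V in auto)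
  qed
  moreover have "inj_on f (U1 \<inter> V)"
  proof (rule inj_onI)
    fix x x' assume "x \<in> U1 \<inter> V" "x' \<in> U1 \<inter> V" "f x = f x'"
    then show "x = x'" using U1(2) U1(4)[of x' x] by auto
  qed
  ultimately obtain x where x: "x \<in> U1 \<inter> V"
    "\<And>\<xi>. (\<And>k. frechet_derivative (\<lambda>x. vec_nth (f x) k) (at x) \<xi> = 0) \<Longrightarrow> \<xi> = 0"
    using injective_holo_map_immersive[of "U1 \<inter> V" f] by metis
  have "dist x 0 < e'" "rep_germ (w i0) x \<noteq> 0" using x(1) r(3) by (auto simp: V_def dist_commute)
  then show False using e'(2)[of x] x by blast
qed

end

section \<open>The tensor square of a ring extension\<close>

\<comment> \<open>From here on, the dollar sign only indexes vectors of variable dimension.\<close>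
unbundle no vec_syntax
no_notation fps_nth (infixl \<open>$\<close> 75)

lemma frag_extend_frag_of_id: "frag_extend frag_of c = c"
  by (metis frag_expansion)

definition frag_eval :: "('p \<Rightarrow> 'b::comm_ring_1) \<Rightarrow> ('p \<Rightarrow>\<^sub>0 int) \<Rightarrow> 'b" where
  "frag_eval w c = (\<Sum>k\<in>Poly_Mapping.keys c. of_int (Poly_Mapping.lookup c k) * w k)"

lemma frag_eval_superset:
  "finite A \<Longrightarrow> Poly_Mapping.keys c \<subseteq> A \<Longrightarrow>
    frag_eval w c = (\<Sum>k\<in>A. of_int (Poly_Mapping.lookup c k) * w k)"
  unfolding frag_eval_def by (rule sum.mono_neutral_left) (auto simp: in_keys_iff)

lemma frag_eval_diff: "frag_eval w (a - b) = frag_eval w a - frag_eval w b"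
proof -
  let ?A = "Poly_Mapping.keys a \<union> Poly_Mapping.keys b"
  have "Poly_Mapping.keys (a - b) \<subseteq> ?A" by (rule keys_diff)
  then show ?thesis
    by (simp add: frag_eval_superset[of ?A] lookup_minus left_diff_distrib sum_subtractf)
qed

lemma frag_eval_0 [simp]: "frag_eval w 0 = 0"
  by (simp add: frag_eval_def)

lemma frag_eval_minus: "frag_eval w (- a) = - frag_eval w a"
  using frag_eval_diff[of w 0 a] by simp

lemma frag_eval_add: "frag_eval w (a + b) = frag_eval w a + frag_eval w b"
  using frag_eval_diff[of w a "- b"] by (simp add: frag_eval_minus)

lemma frag_eval_of [simp]: "frag_eval w (frag_of k) = w k"
  by (simp add: frag_eval_def)

lemma frag_eval_sum: "frag_eval w (sum h I) = (\<Sum>i\<in>I. frag_eval w (h i))"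
  by (induction I rule: infinite_finite_induct) (auto simp: frag_eval_add)

lemma frag_induct [case_names zero of diff]:
  assumes "P 0" "\<And>k. P (frag_of k)" "\<And>a b. P a \<Longrightarrow> P b \<Longrightarrow> P (a - b)"
  shows "P c"
  by (rule frag_induction[of c UNIV]) (use assms in auto)

text \<open>
  Elements of the tensor square are written as classes of formal sums of pairs. The action of
  \<open>s\<close> on the right-hand factor is defined on the formal sums themselves.
\<close>

definition tensor_class ::
  "('r::comm_ring_1 \<Rightarrow> 'a::comm_ring_1) \<Rightarrow> ('a \<times> 'a \<Rightarrow>\<^sub>0 int) \<Rightarrow> ('a \<times> 'a \<Rightarrow>\<^sub>0 int) set" where
  "tensor_class \<phi> = tensor_coset class_ring (restr_module \<phi>) (restr_module \<phi>)"

definition right_scale :: "'a::comm_ring_1 \<Rightarrow> ('a \<times> 'a \<Rightarrow>\<^sub>0 int) \<Rightarrow> ('a \<times> 'a \<Rightarrow>\<^sub>0 int)" where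
  "right_scale s = frag_extend (\<lambda>(x, y). frag_of (x, s * y))"

lemma right_scale_simps [simp]:
  "right_scale s 0 = 0" "right_scale s (frag_of (x, y)) = frag_of (x, s * y)"
  "right_scale s (a - b) = right_scale s a - right_scale s b"
  "right_scale s (a + b) = right_scale s a + right_scale s b"
  "right_scale s (- a) = - right_scale s a"
  by (simp_all add: right_scale_def frag_extend_diff frag_extend_add frag_extend_minus)

lemma right_scale_sum: "right_scale s (sum h I) = (\<Sum>i\<in>I. right_scale s (h i))"
  by (induction I rule: infinite_finite_induct) auto

lemma right_scale_mult: "right_scale (s * t) c = right_scale s (right_scale t c)"
proof (induction c rule: frag_induct)
  case (of k)
  then show ?case by (cases k) (simp add: mult.assoc)
qed auto

lemma right_scale_1: "right_scale 1 c = c"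
  by (simp add: right_scale_def frag_extend_frag_of_id case_prod_beta')

lemma restr_module_simps [simp]:
  "carrier (restr_module \<phi>) = UNIV" "ring.zero (restr_module \<phi>) = 0"
  "add (restr_module \<phi>) = (+)" "smult (restr_module \<phi>) r a = \<phi> r * a"
  by (simp_all add: restr_module_def)

locale ring_extension = comm_ring_hom \<phi> for \<phi> :: "'r::comm_ring_1 \<Rightarrow> 'a::comm_ring_1"
begin

definition null :: "('a \<times> 'a \<Rightarrow>\<^sub>0 int) set" where
  "null = tensor_null class_ring (restr_module \<phi>) (restr_module \<phi>)"

abbreviation "relations \<equiv> tensor_relations class_ring (restr_module \<phi>) (restr_module \<phi>)"

abbreviation "frags \<equiv> free_Abelian_group (UNIV :: ('a \<times> 'a) set)"

lemma null_eq: "null = generate frags relations"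
  by (simp add: null_def tensor_null_def)

lemma subgroup_null: "subgroup null frags"
  unfolding null_eq by (rule group.generate_is_subgroup) auto

lemma null_0: "0 \<in> null"
  using subgroup.one_closed[OF subgroup_null] by simp

lemma null_add: "a \<in> null \<Longrightarrow> b \<in> null \<Longrightarrow> a + b \<in> null"
  using subgroup.m_closed[OF subgroup_null] by simp

lemma null_minus: "a \<in> null \<Longrightarrow> - a \<in> null"
  using subgroup.m_inv_closed[OF subgroup_null] by simp

lemma null_diff: "a \<in> null \<Longrightarrow> b \<in> null \<Longrightarrow> a - b \<in> null"
  using null_add[OF _ null_minus] by fastforce

lemma null_sum: "(\<And>i. i \<in> I \<Longrightarrow> h i \<in> null) \<Longrightarrow> sum h I \<in> null"
  by (induction I rule: infinite_finite_induct) (auto intro: null_0 null_add)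

lemma null_add_left: "frag_of (x + x', y) - frag_of (x, y) - frag_of (x', y) \<in> null"
  unfolding null_eq proof (rule generate.incl)
  show "frag_of (x + x', y) - frag_of (x, y) - frag_of (x', y) \<in> relations"
    unfolding tensor_relations_def
    by (rule UnI1, rule UnI1, rule CollectI, rule exI[of _ x], rule exI[of _ x'], rule exI[of _ y]) simp
qed

lemma null_add_right: "frag_of (x, y + y') - frag_of (x, y) - frag_of (x, y') \<in> null"
  unfolding null_eq proof (rule generate.incl)
  show "frag_of (x, y + y') - frag_of (x, y) - frag_of (x, y') \<in> relations"
    unfolding tensor_relations_def
    by (rule UnI1, rule UnI2, rule CollectI, rule exI[of _ x], rule exI[of _ y], rule exI[of _ y']) simp
qed

lemma null_balanced: "frag_of (\<phi> r * x, y) - frag_of (x, \<phi> r * y) \<in> null"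
  unfolding null_eq proof (rule generate.incl)
  show "frag_of (\<phi> r * x, y) - frag_of (x, \<phi> r * y) \<in> relations"
    unfolding tensor_relations_def
    by (rule UnI2, rule CollectI, rule exI[of _ r], rule exI[of _ x], rule exI[of _ y]) simp
qed

lemma null_induct [consumes 1, case_names add_left add_right balanced diff]:
  assumes c: "c \<in> null"
    and "\<And>x x' y. P (frag_of (x + x', y) - frag_of (x, y) - frag_of (x', y))"
    and "\<And>x y y'. P (frag_of (x, y + y') - frag_of (x, y) - frag_of (x, y'))"
    and "\<And>r x y. P (frag_of (\<phi> r * x, y) - frag_of (x, \<phi> r * y))"
    and diff: "\<And>a b. P a \<Longrightarrow> P b \<Longrightarrow> P (a - b)"
  shows "P c"
proof -
  have gen: "P h" if "h \<in> relations" for h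
    using that assms(2-4) by (auto simp: tensor_relations_def)
  have zero: "P 0" using diff[OF assms(2) assms(2), of 0 0 0 0 0 0] by simp
  show ?thesis using c unfolding null_eq
  proof (induction rule: generate.induct)
    case (inv h)
    then show ?case using diff[OF zero gen] by simp
  next
    case (eng h1 h2)
    then show ?case using diff[OF eng.IH(1) diff[OF zero eng.IH(2)]] by simp
  qed (auto intro: gen zero)
qed

lemma null_right_scale: "c \<in> null \<Longrightarrow> right_scale s c \<in> null"
proof (induction rule: null_induct)
  case (balanced r x y)
  then show ?case using null_balanced[of r x "s * y"] by (simp add: mult.left_commute)
qed (auto simp: distrib_left intro: null_add_left null_add_right null_diff)

lemma null_right_scale_add: "right_scale (s + t) c - right_scale s c - right_scale t c \<in> null"
proof (induction c rule: frag_induct)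
  case zero
  then show ?case by (simp add: null_0)
next
  case (of k)
  then show ?case by (cases k) (simp add: distrib_right null_add_right)
next
  case (diff a b)
  from null_diff[OF this] show ?case by (simp add: algebra_simps)
qed

definition equiv :: "('a \<times> 'a \<Rightarrow>\<^sub>0 int) \<Rightarrow> ('a \<times> 'a \<Rightarrow>\<^sub>0 int) \<Rightarrow> bool" (infix \<open>\<doteq>\<close> 50) where
  "a \<doteq> b \<longleftrightarrow> a - b \<in> null"

lemma equiv_refl [simp]: "a \<doteq> a"
  by (simp add: equiv_def null_0)

lemma equiv_sym: "a \<doteq> b \<Longrightarrow> b \<doteq> a"
  using null_minus[of "a - b"] by (simp add: equiv_def)

lemma equiv_trans [trans]: "a \<doteq> b \<Longrightarrow> b \<doteq> c \<Longrightarrow> a \<doteq> c"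
  using null_add[of "a - b" "b - c"] by (simp add: equiv_def)

lemma equiv_add: "a \<doteq> a' \<Longrightarrow> b \<doteq> b' \<Longrightarrow> a + b \<doteq> a' + b'"
  using null_add[of "a - a'" "b - b'"] by (simp add: equiv_def algebra_simps)

lemma equiv_diff: "a \<doteq> a' \<Longrightarrow> b \<doteq> b' \<Longrightarrow> a - b \<doteq> a' - b'"
  using null_diff[of "a - a'" "b - b'"] by (simp add: equiv_def algebra_simps)

lemma equiv_sum: "(\<And>i. i \<in> I \<Longrightarrow> h i \<doteq> k i) \<Longrightarrow> sum h I \<doteq> sum k I"
  using null_sum[of I "\<lambda>i. h i - k i"] by (simp add: equiv_def sum_subtractf)

lemma equiv_right_scale: "a \<doteq> b \<Longrightarrow> right_scale s a \<doteq> right_scale s b"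
  using null_right_scale[of "a - b" s] by (simp add: equiv_def)

lemma equiv_right_scale_add: "right_scale (s + t) c \<doteq> right_scale s c + right_scale t c"
  using null_right_scale_add[of s t c] by (simp add: equiv_def algebra_simps)

lemma equiv_add_left: "frag_of (x + x', y) \<doteq> frag_of (x, y) + frag_of (x', y)"
  using null_add_left[of x x' y] by (simp add: equiv_def algebra_simps)

lemma equiv_add_right: "frag_of (x, y + y') \<doteq> frag_of (x, y) + frag_of (x, y')"
  using null_add_right[of x y y'] by (simp add: equiv_def algebra_simps)

lemma equiv_balanced: "frag_of (\<phi> r * x, y) \<doteq> frag_of (x, \<phi> r * y)"
  using null_balanced[of r x y] by (simp add: equiv_def)

lemma equiv_zero_left: "frag_of (0, y) \<doteq> 0"
  using equiv_sym[OF equiv_add_left[of 0 0 y]] null_minus by (simp add: equiv_def)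

lemma equiv_zero_right: "frag_of (x, 0) \<doteq> 0"
  using equiv_sym[OF equiv_add_right[of x 0 0]] null_minus by (simp add: equiv_def)

lemma equiv_sum_left: "finite I \<Longrightarrow> frag_of (sum h I, y) \<doteq> (\<Sum>i\<in>I. frag_of (h i, y))"
  by (induction I rule: finite_induct)
    (auto intro: equiv_zero_left equiv_trans[OF equiv_add_left equiv_add[OF equiv_refl]])

lemma equiv_sum_right: "finite I \<Longrightarrow> frag_of (x, sum h I) \<doteq> (\<Sum>i\<in>I. frag_of (x, h i))"
  by (induction I rule: finite_induct)
    (auto intro: equiv_zero_right equiv_trans[OF equiv_add_right equiv_add[OF equiv_refl]])

lemma tensor_class_eq: "tensor_class \<phi> c = {n + c |n. n \<in> null}"
  by (auto simp: tensor_class_def tensor_coset_def r_coset_def null_def)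

lemma tensor_class_eq_iff: "tensor_class \<phi> a = tensor_class \<phi> b \<longleftrightarrow> a \<doteq> b"
proof
  assume "tensor_class \<phi> a = tensor_class \<phi> b"
  moreover have "a \<in> tensor_class \<phi> a" using null_0 by (force simp: tensor_class_eq)
  ultimately show "a \<doteq> b" by (auto simp: tensor_class_eq equiv_def)
next
  have sub: "tensor_class \<phi> a \<subseteq> tensor_class \<phi> b" if "a \<doteq> b" for a b
  proof
    fix x assume "x \<in> tensor_class \<phi> a"
    then obtain n where "n \<in> null" "x = n + a" by (auto simp: tensor_class_eq)
    then show "x \<in> tensor_class \<phi> b"
      unfolding tensor_class_eq using that null_add[of n "a - b"]
      by (intro CollectI exI[of _ "n + (a - b)"]) (simp add: equiv_def)
  qed
  assume "a \<doteq> b"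
  then show "tensor_class \<phi> a = tensor_class \<phi> b" using sub equiv_sym by blast
qed

lemma mem_tensor_class: "x \<in> tensor_class \<phi> c \<longleftrightarrow> x \<doteq> c"
proof
  assume "x \<in> tensor_class \<phi> c"
  then obtain n where "n \<in> null" "x = n + c" unfolding tensor_class_eq by blast
  then show "x \<doteq> c" by (simp add: equiv_def)
next
  assume "x \<doteq> c"
  then show "x \<in> tensor_class \<phi> c"
    unfolding tensor_class_eq equiv_def by (intro CollectI exI[of _ "x - c"]) simp
qed

lemma the_elem_class:
  assumes "\<And>x. x \<doteq> c \<Longrightarrow> h x = h c"
  shows "the_elem (h ` tensor_class \<phi> c) = h c"
proof -
  have "h ` tensor_class \<phi> c = {h c}"
  proof
    show "h ` tensor_class \<phi> c \<subseteq> {h c}"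
    proof (rule image_subsetI)
      fix x assume "x \<in> tensor_class \<phi> c"
      then have "h x = h c" unfolding mem_tensor_class by (rule assms)
      then show "h x \<in> {h c}" by (rule ssubst) simp
    qed
    have "c \<in> tensor_class \<phi> c" by (simp add: mem_tensor_class)
    then show "{h c} \<subseteq> h ` tensor_class \<phi> c" by (simp add: imageI)
  qed
  then show ?thesis by simp
qed

lemma tensor_square_carrier: "carrier (tensor_square \<phi>) = range (tensor_class \<phi>)"
  by (simp add: tensor_square_def tensor_right_module_def Let_def FactGroup_def RCOSETS_def
      tensor_class_def tensor_coset_def) auto

lemma tensor_square_zero: "\<zero>\<^bsub>tensor_square \<phi>\<^esub> = tensor_class \<phi> 0"
  by (simp add: tensor_square_def tensor_right_module_def Let_def FactGroup_def tensor_class_eq null_def)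

lemma tensor_square_add:
  "tensor_class \<phi> a \<oplus>\<^bsub>tensor_square \<phi>\<^esub> tensor_class \<phi> b = tensor_class \<phi> (a + b)"
proof -
  have "tensor_class \<phi> a \<oplus>\<^bsub>tensor_square \<phi>\<^esub> tensor_class \<phi> b =
      {x + y |x y. x \<in> tensor_class \<phi> a \<and> y \<in> tensor_class \<phi> b}"
    by (auto simp: tensor_square_def tensor_right_module_def Let_def FactGroup_def set_mult_def)
  also have "\<dots> = tensor_class \<phi> (a + b)"
  proof (intro equalityI subsetI)
    fix x assume "x \<in> tensor_class \<phi> (a + b)"
    then have "x - b \<doteq> a" using equiv_diff[OF _ equiv_refl, of x "a + b" b]
      by (simp add: mem_tensor_class)
    then show "x \<in> {x + y |x y. x \<in> tensor_class \<phi> a \<and> y \<in> tensor_class \<phi> b}"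
      by (intro CollectI exI[of _ "x - b"] exI[of _ b]) (simp add: mem_tensor_class)
  qed (auto simp: mem_tensor_class equiv_add)
  finally show ?thesis .
qed

lemma tensor_square_smult:
  "s \<odot>\<^bsub>tensor_square \<phi>\<^esub> tensor_class \<phi> c = tensor_class \<phi> (right_scale s c)"
proof -
  have "s \<odot>\<^bsub>tensor_square \<phi>\<^esub> tensor_class \<phi> c =
      the_elem ((\<lambda>c. tensor_class \<phi> (right_scale s c)) ` tensor_class \<phi> c)"
    by (simp add: tensor_square_def tensor_right_module_def Let_def right_scale_def tensor_class_def)
  also have "\<dots> = tensor_class \<phi> (right_scale s c)"
    by (rule the_elem_class) (simp add: tensor_class_eq_iff equiv_right_scale)
  finally show ?thesis .
qed

lemma pure_tensor_eq: "pure_tensor \<phi> x y = tensor_class \<phi> (frag_of (x, y))"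
  by (simp add: pure_tensor_def tensor_def tensor_class_def)

definition mult_frag :: "('a \<times> 'a \<Rightarrow>\<^sub>0 int) \<Rightarrow> 'a" where
  "mult_frag = frag_eval (\<lambda>k. fst k * snd k)"

lemma mult_frag_equiv: "a \<doteq> b \<Longrightarrow> mult_frag a = mult_frag b"
proof -
  have "mult_frag c = 0" if "c \<in> null" for c
    using that by (induction rule: null_induct)
      (auto simp: mult_frag_def frag_eval_diff distrib_left distrib_right)
  then have "a \<doteq> b \<Longrightarrow> mult_frag (a - b) = 0" by (simp add: equiv_def)
  then show "a \<doteq> b \<Longrightarrow> mult_frag a = mult_frag b" by (simp add: mult_frag_def frag_eval_diff)
qed

lemma mult_map_class: "mult_map (tensor_class \<phi> c) = mult_frag c"
proof -
  have "mult_frag = (\<lambda>c. \<Sum>k\<in>Poly_Mapping.keys c. of_int (Poly_Mapping.lookup c k) * (fst k * snd k))"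
    by (rule ext) (simp add: mult_frag_def frag_eval_def)
  then show ?thesis
    unfolding mult_map_def using the_elem_class[of c mult_frag, OF mult_frag_equiv] by presburger
qed

lemma mult_frag_right_scale: "mult_frag (right_scale s c) = s * mult_frag c"
proof (induction c rule: frag_induct)
  case (of k)
  then show ?case by (cases k) (simp add: mult_frag_def mult.left_commute)
qed (auto simp: mult_frag_def frag_eval_diff right_diff_distrib)

text \<open>
  The tensor square and the kernel of the multiplication map are both of this form.
\<close>

lemma module_of_frags:
  assumes P: "0 \<in> P" "\<And>a b. a \<in> P \<Longrightarrow> b \<in> P \<Longrightarrow> a - b \<in> P" "\<And>s a. a \<in> P \<Longrightarrow> right_scale s a \<in> P"
  shows "Module.module class_ring ((tensor_square \<phi>)\<lparr>carrier := tensor_class \<phi> ` P\<rparr>)"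
proof -
  let ?T = "(tensor_square \<phi>)\<lparr>carrier := tensor_class \<phi> ` P\<rparr>"
  have minus: "- a \<in> P" if "a \<in> P" for a using P(2)[OF P(1) that] by simp
  have plus: "a + b \<in> P" if "a \<in> P" "b \<in> P" for a b using P(2)[OF that(1) minus[OF that(2)]] by simp
  have *: "a \<oplus>\<^bsub>?T\<^esub> b = a \<oplus>\<^bsub>tensor_square \<phi>\<^esub> b" "\<zero>\<^bsub>?T\<^esub> = tensor_class \<phi> 0"
    "s \<odot>\<^bsub>?T\<^esub> a = s \<odot>\<^bsub>tensor_square \<phi>\<^esub> a" for a b s by (simp_all add: tensor_square_zero)
  show ?thesis
  proof (rule moduleI, unfold *)
    show "cring (class_ring :: 'a ring)" by (rule class_cring.is_cring)
    show "abelian_group ?T"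
    proof (rule abelian_groupI, unfold *)
      fix x assume "x \<in> carrier ?T"
      then obtain a where a: "a \<in> P" "x = tensor_class \<phi> a" by auto
      show "\<exists>y\<in>carrier ?T. y \<oplus>\<^bsub>tensor_square \<phi>\<^esub> x = tensor_class \<phi> 0"
        using imageI[OF minus[OF a(1)], of "tensor_class \<phi>"]
        by (intro bexI[of _ "tensor_class \<phi> (- a)"]) (simp_all add: a(2) tensor_square_add)
    qed (clarsimp simp: tensor_square_add ac_simps imageI plus P(1))+
  qed (clarsimp simp: tensor_square_add tensor_square_smult tensor_class_eq_iff right_scale_mult
      right_scale_1 equiv_right_scale_add imageI P(3))+
qed

lemma module_tensor_square: "Module.module class_ring (tensor_square \<phi>)"
  using module_of_frags[of UNIV] unfolding tensor_square_carrier[symmetric] by simp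

lemma ker_mult_map_eq:
  "ker_mult_map \<phi> = (tensor_square \<phi>)\<lparr>carrier := tensor_class \<phi> ` {c. mult_frag c = 0}\<rparr>"
proof -
  have "{t \<in> carrier (tensor_square \<phi>). mult_map t = 0} = tensor_class \<phi> ` {c. mult_frag c = 0}"
    unfolding tensor_square_carrier by (force simp: mult_map_class)
  then show ?thesis by (simp add: ker_mult_map_def)
qed

lemma module_ker_mult_map: "Module.module class_ring (ker_mult_map \<phi>)"
  unfolding ker_mult_map_eq
  by (rule module_of_frags) (auto simp: mult_frag_right_scale, auto simp: mult_frag_def frag_eval_diff)

lemma tensor_square_minus:
  "tensor_class \<phi> a \<ominus>\<^bsub>tensor_square \<phi>\<^esub> tensor_class \<phi> b = tensor_class \<phi> (a - b)"
proof -
  interpret T: Module.module class_ring "tensor_square \<phi>" by (rule module_tensor_square)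
  have "\<ominus>\<^bsub>tensor_square \<phi>\<^esub> tensor_class \<phi> b = tensor_class \<phi> (- b)"
    by (rule T.minus_equality)
      (simp_all add: tensor_square_add tensor_square_zero tensor_square_carrier)
  then show ?thesis by (simp add: a_minus_def tensor_square_add)
qed

lemma tensor_square_finsum:
  "finite I \<Longrightarrow> finsum (tensor_square \<phi>) (\<lambda>i. tensor_class \<phi> (h i)) I = tensor_class \<phi> (sum h I)"
proof (induction I rule: finite_induct)
  interpret T: Module.module class_ring "tensor_square \<phi>" by (rule module_tensor_square)
  case empty
  show ?case by (simp add: tensor_square_zero)
next
  interpret T: Module.module class_ring "tensor_square \<phi>" by (rule module_tensor_square)
  case (insert i I)
  then show ?case
    by (subst T.finsum_insert) (simp_all add: tensor_square_carrier tensor_square_add)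
qed

text \<open>
  A formal sum whose class is \<open>\<Delta>G(v)\<close>; the coefficients \<open>v\<^sub>i\<close> act on the right-hand factor.
\<close>

definition Delta_frag :: "'a Matrix.vec \<Rightarrow> 'a Matrix.vec \<Rightarrow> ('a \<times> 'a \<Rightarrow>\<^sub>0 int)" where
  "Delta_frag g v = (\<Sum>i<dim_vec g. frag_of (g $ i, v $ i) - frag_of (1, g $ i * v $ i))"

lemma Delta_eq: "Delta \<phi> g v = tensor_class \<phi> (Delta_frag g v)"
  unfolding Delta_def free_module_map_def pure_tensor_eq tensor_square_minus tensor_square_smult
  by (simp add: tensor_square_finsum Delta_frag_def mult.commute)

lemma mult_frag_Delta: "mult_frag (Delta_frag g v) = 0"
  by (simp add: Delta_frag_def mult_frag_def frag_eval_sum frag_eval_diff)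

lemma Delta_frag_add:
  assumes "v \<in> carrier_vec (dim_vec g)" "w \<in> carrier_vec (dim_vec g)"
  shows "Delta_frag g (v + w) \<doteq> Delta_frag g v + Delta_frag g w"
proof -
  have "Delta_frag g (v + w) \<doteq> (\<Sum>i<dim_vec g. (frag_of (g $ i, v $ i) + frag_of (g $ i, w $ i))
      - (frag_of (1, g $ i * v $ i) + frag_of (1, g $ i * w $ i)))"
    unfolding Delta_frag_def using assms
    by (intro equiv_sum equiv_diff) (auto simp: distrib_left intro: equiv_add_right)
  also have "\<dots> = Delta_frag g v + Delta_frag g w"
    by (simp add: Delta_frag_def sum.distrib[symmetric] algebra_simps)
  finally show ?thesis .
qed

lemma Delta_frag_smult:
  "v \<in> carrier_vec (dim_vec g) \<Longrightarrow> Delta_frag g (s \<cdot>\<^sub>v v) = right_scale s (Delta_frag g v)"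
  by (simp add: Delta_frag_def right_scale_sum mult.left_commute)

lemma Delta_hom:
  assumes "g \<in> carrier_vec r"
  shows "Delta \<phi> g \<in> module_hom class_ring (module_vec TYPE('a) r) (ker_mult_map \<phi>)"
  using assms unfolding module_hom_def ker_mult_map_eq
  by (clarsimp simp: Delta_eq module_vec_simps mult_frag_Delta tensor_square_add tensor_square_smult
      tensor_class_eq_iff Delta_frag_add Delta_frag_smult imageI)

end

section \<open>Symmetric presentations\<close>

lemma module_module_vec: "Module.module class_ring (module_vec TYPE('a::comm_ring_1) r)"
proof -
  interpret vec_module "TYPE('a)" r .
  show ?thesis by (rule module_axioms)
qed

locale symmetric_presentation = ring_extension +
  fixes \<Lambda> :: "'a Matrix.mat" and g :: "'b Matrix.vec" and r :: nat
  assumes \<Lambda>: "\<Lambda> \<in> carrier_mat (r + 1) (r + 1)" and g: "g \<in> carrier_vec r"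
    and symmetric: "transpose_mat \<Lambda> = \<Lambda>"
    and exact: "short_exact_modules (class_ring :: 'a ring)
      (module_vec TYPE('a) (r + 1)) (module_vec TYPE('a) (r + 1)) (restr_module \<phi>)
      (\<lambda>v. \<Lambda> *\<^sub>v v) (\<lambda>v. scalar_prod (vCons 1 g) (map_vec \<phi> v))"
begin

definition gen :: "nat \<Rightarrow> 'b" where
  "gen i = vCons 1 g $ i"

lemma gen_simps [simp]: "gen 0 = 1" "gen (Suc i) = g $ i"
  by (simp_all add: gen_def)

definition eval_gens :: "'a Matrix.vec \<Rightarrow> 'b" where
  "eval_gens a = (\<Sum>i<Suc r. gen i * \<phi> (a $ i))"

lemma eval_gens_eq:
  "a \<in> carrier_vec (r + 1) \<Longrightarrow> scalar_prod (vCons 1 g) (map_vec \<phi> a) = eval_gens a"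
  by (auto simp: eval_gens_def scalar_prod_def gen_def atLeast0LessThan)

lemma eval_gens_Suc: "eval_gens a = \<phi> (a $ 0) + (\<Sum>i<r. g $ i * \<phi> (a $ Suc i))"
  by (simp add: eval_gens_def lessThan_Suc_eq_insert_0 sum.reindex)

lemma eval_gens_eq_0_iff:
  assumes "a \<in> carrier_vec (r + 1)"
  shows "eval_gens a = 0 \<longleftrightarrow> (\<exists>b\<in>carrier_vec (r + 1). a = \<Lambda> *\<^sub>v b)"
proof -
  have "(\<lambda>v. \<Lambda> *\<^sub>v v) ` carrier_vec (r + 1) =
      {x \<in> carrier_vec (r + 1). scalar_prod (vCons 1 g) (map_vec \<phi> x) = 0}"
    using exact by (simp add: short_exact_modules_def module_vec_simps)
  then have "a \<in> (\<lambda>v. \<Lambda> *\<^sub>v v) ` carrier_vec (r + 1) \<longleftrightarrow> eval_gens a = 0"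
    using assms eval_gens_eq by auto
  then show ?thesis by auto
qed

lemma eval_gens_surj: "\<exists>a\<in>carrier_vec (r + 1). eval_gens a = h"
proof -
  have "(\<lambda>v. scalar_prod (vCons 1 g) (map_vec \<phi> v)) ` carrier_vec (r + 1) = UNIV"
    using exact by (simp add: short_exact_modules_def module_vec_simps)
  then show ?thesis using eval_gens_eq by (metis (no_types, lifting) UNIV_I imageE)
qed

lemma eval_gens_add:
  "a \<in> carrier_vec (r + 1) \<Longrightarrow> b \<in> carrier_vec (r + 1) \<Longrightarrow>
    eval_gens (a + b) = eval_gens a + eval_gens b"
  by (simp add: eval_gens_def hom_add distrib_left sum.distrib)

lemma eval_gens_smult:
  "a \<in> carrier_vec (r + 1) \<Longrightarrow> eval_gens (c \<cdot>\<^sub>v a) = \<phi> c * eval_gens a"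
  by (simp add: eval_gens_def hom_mult sum_distrib_left distrib_left mult.left_commute)

lemma eval_gens_diff:
  assumes "a \<in> carrier_vec (r + 1)" "b \<in> carrier_vec (r + 1)"
  shows "eval_gens (a - b) = eval_gens a - eval_gens b"
  using assms by (simp add: eval_gens_def hom_minus right_diff_distrib sum_subtractf)

lemma eval_gens_unit: "i < r + 1 \<Longrightarrow> eval_gens (unit_vec (r + 1) i) = gen i"
proof -
  assume "i < r + 1"
  then have "eval_gens (unit_vec (r + 1) i) = (\<Sum>j<Suc r. if j = i then gen i else 0)"
    unfolding eval_gens_def by (intro sum.cong) auto
  then show ?thesis using \<open>i < r + 1\<close> by simp
qed

lemma column_relation: "j < r + 1 \<Longrightarrow> (\<Sum>i<Suc r. gen i * \<phi> (\<Lambda> $$ (i, j))) = 0"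
proof -
  assume j: "j < r + 1"
  have "eval_gens (\<Lambda> *\<^sub>v unit_vec (r + 1) j) = 0"
    using \<Lambda> by (subst eval_gens_eq_0_iff) (auto intro: bexI[of _ "unit_vec (r + 1) j"])
  moreover have "eval_gens (\<Lambda> *\<^sub>v unit_vec (r + 1) j) = (\<Sum>i<Suc r. gen i * \<phi> (\<Lambda> $$ (i, j)))"
    unfolding eval_gens_def using \<Lambda> j
    by (intro sum.cong refl) (auto simp: scalar_prod_right_unit[of _ "r + 1", simplified])
  ultimately show ?thesis by simp
qed

lemma column_relation_Suc:
  "j < r + 1 \<Longrightarrow> (\<Sum>i<r. g $ i * \<phi> (\<Lambda> $$ (Suc i, j))) = - \<phi> (\<Lambda> $$ (0, j))"
  using column_relation[of j]
  by (simp add: lessThan_Suc_eq_insert_0 sum.reindex eq_neg_iff_add_eq_0 add.commute)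

lemma symmetric_entry: "i < r + 1 \<Longrightarrow> j < r + 1 \<Longrightarrow> \<Lambda> $$ (i, j) = \<Lambda> $$ (j, i)"
  using symmetric \<Lambda> by (metis carrier_matD index_transpose_mat(1))

definition minor :: "'b Matrix.mat" where
  "minor = map_mat \<phi> (mat_delete \<Lambda> 0 0)"

lemma minor_carrier: "minor \<in> carrier_mat r r"
  using \<Lambda> by (auto simp: minor_def mat_delete_def)

lemma minor_entry: "i < r \<Longrightarrow> j < r \<Longrightarrow> minor $$ (i, j) = \<phi> (\<Lambda> $$ (Suc i, Suc j))"
  using \<Lambda> by (simp add: minor_def mat_delete_def)

lemma minor_mult_entry:
  "u \<in> carrier_vec r \<Longrightarrow> i < r \<Longrightarrow> (minor *\<^sub>v u) $ i = (\<Sum>j<r. \<phi> (\<Lambda> $$ (Suc i, Suc j)) * u $ j)"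
  using minor_carrier by (auto simp: scalar_prod_def minor_entry atLeast0LessThan intro!: sum.cong)

lemma minor_smult: "u \<in> carrier_vec r \<Longrightarrow> minor *\<^sub>v (s \<cdot>\<^sub>v u) = s \<cdot>\<^sub>v (minor *\<^sub>v u)"
proof (rule eq_vecI)
  fix i assume u: "u \<in> carrier_vec r" and "i < dim_vec (s \<cdot>\<^sub>v (minor *\<^sub>v u))"
  then have "i < r" using minor_carrier by auto
  then show "(minor *\<^sub>v (s \<cdot>\<^sub>v u)) $ i = (s \<cdot>\<^sub>v (minor *\<^sub>v u)) $ i"
    using u minor_carrier minor_mult_entry[of "s \<cdot>\<^sub>v u" i] minor_mult_entry[of u i]
    by (auto simp: sum_distrib_left mult.left_commute)
qed (use minor_carrier in auto)

definition minor_image :: "'b Matrix.vec set" where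
  "minor_image = (\<lambda>u. minor *\<^sub>v u) ` carrier_vec r"

lemma minor_image_add: "v \<in> minor_image \<Longrightarrow> w \<in> minor_image \<Longrightarrow> v + w \<in> minor_image"
proof -
  assume "v \<in> minor_image" "w \<in> minor_image"
  then obtain u u' where "u \<in> carrier_vec r" "u' \<in> carrier_vec r" "v = minor *\<^sub>v u" "w = minor *\<^sub>v u'"
    by (auto simp: minor_image_def)
  then show ?thesis
    unfolding minor_image_def using mult_add_distrib_mat_vec[OF minor_carrier, of u u']
    by (intro image_eqI[of _ _ "u + u'"]) auto
qed

lemma minor_image_smult: "v \<in> minor_image \<Longrightarrow> s \<cdot>\<^sub>v v \<in> minor_image"
proof -
  assume "v \<in> minor_image"
  then obtain u where "u \<in> carrier_vec r" "v = minor *\<^sub>v u" by (auto simp: minor_image_def)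
  then show ?thesis
    unfolding minor_image_def using minor_smult[of u s]
    by (intro image_eqI[of _ _ "s \<cdot>\<^sub>v u"]) auto
qed

lemma minor_image_carrier: "v \<in> minor_image \<Longrightarrow> v \<in> carrier_vec r"
  using minor_carrier by (auto simp: minor_image_def)

lemma minor_image_zero: "0\<^sub>v r \<in> minor_image"
  unfolding minor_image_def using minor_carrier
  by (intro image_eqI[of _ _ "0\<^sub>v r"]) auto

lemma minor_image_diff: "v \<in> minor_image \<Longrightarrow> w \<in> minor_image \<Longrightarrow> v - w \<in> minor_image"
proof -
  assume vw: "v \<in> minor_image" "w \<in> minor_image"
  have "v - w = v + (- 1) \<cdot>\<^sub>v w"
    using vw[THEN minor_image_carrier] by (intro eq_vecI) auto
  then show ?thesis using minor_image_add[OF vw(1) minor_image_smult[OF vw(2), of "- 1"]] by simp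
qed

text \<open>
  By symmetry the relations between the rows of \<open>f\<^sup>*\<Lambda>\<close> are also relations between its columns:
  the first column is a combination of the others. Hence the last \<open>r\<close> entries of any relation
  between the generators are pulled back into the image of the minor.
\<close>

lemma relation_in_minor_image:
  assumes a: "a \<in> carrier_vec (r + 1)" and rel: "eval_gens a = 0"
  shows "Matrix.vec r (\<lambda>i. s * \<phi> (a $ Suc i)) \<in> minor_image"
proof -
  obtain b where b: "b \<in> carrier_vec (r + 1)" "a = \<Lambda> *\<^sub>v b"
    using eval_gens_eq_0_iff[OF a] rel by blast
  define u where "u = Matrix.vec r (\<lambda>j. s * (\<phi> (b $ Suc j) - g $ j * \<phi> (b $ 0)))"
  have "s * \<phi> (a $ Suc i) = (minor *\<^sub>v u) $ i" if i: "i < r" for i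
  proof -
    have a_i: "a $ Suc i = (\<Sum>j<Suc r. \<Lambda> $$ (Suc i, j) * b $ j)"
      using \<Lambda> b i by (auto simp: scalar_prod_def atLeast0LessThan intro!: sum.cong)
    have "\<phi> (a $ Suc i) = \<phi> (\<Lambda> $$ (Suc i, 0)) * \<phi> (b $ 0) +
        (\<Sum>j<r. \<phi> (\<Lambda> $$ (Suc i, Suc j)) * \<phi> (b $ Suc j))"
      unfolding a_i by (simp add: lessThan_Suc_eq_insert_0 sum.reindex hom_add hom_mult hom_sum
          del: sum.lessThan_Suc)
    moreover have "\<phi> (\<Lambda> $$ (Suc i, 0)) = - (\<Sum>j<r. g $ j * \<phi> (\<Lambda> $$ (Suc i, Suc j)))"
    proof -
      have "(\<Sum>j<r. g $ j * \<phi> (\<Lambda> $$ (Suc i, Suc j))) = (\<Sum>j<r. g $ j * \<phi> (\<Lambda> $$ (Suc j, Suc i)))"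
        using i by (intro sum.cong) (auto simp: symmetric_entry[of "Suc i"])
      then show ?thesis
        using column_relation_Suc[of "Suc i"] i symmetric_entry[of "Suc i" 0] by simp
    qed
    ultimately have "\<phi> (a $ Suc i) =
        (\<Sum>j<r. \<phi> (\<Lambda> $$ (Suc i, Suc j)) * (\<phi> (b $ Suc j) - g $ j * \<phi> (b $ 0)))"
      by (simp add: sum_subtractf right_diff_distrib sum_distrib_left mult_ac)
    then show ?thesis using i
      by (simp add: minor_mult_entry u_def sum_distrib_left mult_ac)
  qed
  then have "Matrix.vec r (\<lambda>i. s * \<phi> (a $ Suc i)) = minor *\<^sub>v u"
    using minor_carrier by (intro eq_vecI) auto
  then show ?thesis unfolding minor_image_def u_def by (intro image_eqI) auto
qed

definition coord :: "'b \<Rightarrow> 'a Matrix.vec" where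
  "coord h = (SOME a. a \<in> carrier_vec (r + 1) \<and> eval_gens a = h)"

lemma coord: "coord h \<in> carrier_vec (r + 1)" "eval_gens (coord h) = h"
  using someI_ex[of "\<lambda>a. a \<in> carrier_vec (r + 1) \<and> eval_gens a = h"] eval_gens_surj
  by (auto simp: coord_def)

lemma coord_relation:
  assumes "a \<in> carrier_vec (r + 1)" "eval_gens a = h"
  shows "Matrix.vec r (\<lambda>i. s * (\<phi> (coord h $ Suc i) - \<phi> (a $ Suc i))) \<in> minor_image"
proof -
  have "Matrix.vec r (\<lambda>i. s * \<phi> ((coord h - a) $ Suc i)) \<in> minor_image"
    using assms coord[of h] by (intro relation_in_minor_image) (auto simp: eval_gens_diff)
  also have "Matrix.vec r (\<lambda>i. s * \<phi> ((coord h - a) $ Suc i)) =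
      Matrix.vec r (\<lambda>i. s * (\<phi> (coord h $ Suc i) - \<phi> (a $ Suc i)))"
    using assms(1) by (intro eq_vecI) (auto simp: hom_minus)
  finally show ?thesis .
qed

text \<open>
  A left inverse of \<open>\<Delta>G\<close> modulo the image of the minor: \<open>h \<otimes> b\<close> is sent to \<open>b\<close> times the
  pulled back coefficients of \<open>g\<^sub>1, \<dots>, g\<^sub>r\<close> in an expression of \<open>h\<close>.
\<close>

definition coords_frag :: "('b \<times> 'b \<Rightarrow>\<^sub>0 int) \<Rightarrow> 'b Matrix.vec" where
  "coords_frag c = Matrix.vec r (\<lambda>i. frag_eval (\<lambda>k. snd k * \<phi> (coord (fst k) $ Suc i)) c)"

lemma coords_frag_diff: "coords_frag (a - b) = coords_frag a - coords_frag b"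
  by (intro eq_vecI) (auto simp: coords_frag_def frag_eval_diff)

lemma coords_frag_null: "c \<in> null \<Longrightarrow> coords_frag c \<in> minor_image"
proof (induction rule: null_induct)
  case (add_left x x' y)
  have "Matrix.vec r (\<lambda>i. y * (\<phi> (coord (x + x') $ Suc i) - \<phi> ((coord x + coord x') $ Suc i)))
      \<in> minor_image"
    using coord[of x] coord[of x'] by (intro coord_relation) (auto simp: eval_gens_add)
  also have "Matrix.vec r (\<lambda>i. y * (\<phi> (coord (x + x') $ Suc i) - \<phi> ((coord x + coord x') $ Suc i))) =
      coords_frag (frag_of (x + x', y) - frag_of (x, y) - frag_of (x', y))"
    using coord(1)[of x] coord(1)[of x']
    by (intro eq_vecI) (auto simp: coords_frag_def frag_eval_diff hom_add right_diff_distrib distrib_left)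
  finally show ?case .
next
  case (add_right x y y')
  have "coords_frag (frag_of (x, y + y') - frag_of (x, y) - frag_of (x, y')) = 0\<^sub>v r"
    by (intro eq_vecI) (auto simp: coords_frag_def frag_eval_diff distrib_right)
  then show ?case by (simp add: minor_image_zero)
next
  case (balanced c x y)
  have "Matrix.vec r (\<lambda>i. y * (\<phi> (coord (\<phi> c * x) $ Suc i) - \<phi> ((c \<cdot>\<^sub>v coord x) $ Suc i)))
      \<in> minor_image"
    using coord[of x] by (intro coord_relation) (auto simp: eval_gens_smult)
  also have "Matrix.vec r (\<lambda>i. y * (\<phi> (coord (\<phi> c * x) $ Suc i) - \<phi> ((c \<cdot>\<^sub>v coord x) $ Suc i))) =
      coords_frag (frag_of (\<phi> c * x, y) - frag_of (x, \<phi> c * y))"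
    using coord(1)[of x]
    by (intro eq_vecI) (auto simp: coords_frag_def frag_eval_diff hom_mult right_diff_distrib mult_ac)
  finally show ?case .
next
  case (diff a b)
  then show ?case by (simp add: coords_frag_diff minor_image_diff)
qed

lemma vec_sum_in_minor_image:
  assumes "finite I" "\<And>k. k \<in> I \<Longrightarrow> Matrix.vec r (h k) \<in> minor_image"
  shows "Matrix.vec r (\<lambda>i. \<Sum>k\<in>I. h k i) \<in> minor_image"
  using assms
proof (induction I rule: finite_induct)
  case empty
  have "Matrix.vec r (\<lambda>i. \<Sum>k\<in>{}. h k i) = 0\<^sub>v r" by (intro eq_vecI) auto
  then show ?case by (simp add: minor_image_zero)
next
  case (insert k I)
  then have "Matrix.vec r (h k) + Matrix.vec r (\<lambda>i. \<Sum>k\<in>I. h k i) \<in> minor_image"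
    by (intro minor_image_add) auto
  also have "Matrix.vec r (h k) + Matrix.vec r (\<lambda>i. \<Sum>k\<in>I. h k i) = Matrix.vec r (\<lambda>i. \<Sum>k\<in>insert k I. h k i)"
    using insert.hyps by (intro eq_vecI) auto
  finally show ?case .
qed

lemma coords_frag_Delta:
  assumes v: "v \<in> carrier_vec r"
  shows "coords_frag (Delta_frag g v) - v \<in> minor_image"
proof -
  define h where "h = (\<lambda>k i. v $ k * (\<phi> (coord (g $ k) $ Suc i) - \<phi> (unit_vec (r + 1) (Suc k) $ Suc i))
      - (g $ k * v $ k) * (\<phi> (coord 1 $ Suc i) - \<phi> (unit_vec (r + 1) 0 $ Suc i)))"
  have "Matrix.vec r (h k) \<in> minor_image" if "k \<in> {..<r}" for k
  proof -
    have "Matrix.vec r (\<lambda>i. v $ k * (\<phi> (coord (g $ k) $ Suc i) - \<phi> (unit_vec (r + 1) (Suc k) $ Suc i)))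
      - Matrix.vec r (\<lambda>i. (g $ k * v $ k) * (\<phi> (coord 1 $ Suc i) - \<phi> (unit_vec (r + 1) 0 $ Suc i)))
      \<in> minor_image"
      using that eval_gens_unit[of "Suc k"] eval_gens_unit[of 0]
      by (intro minor_image_diff coord_relation) auto
    also have "Matrix.vec r (\<lambda>i. v $ k * (\<phi> (coord (g $ k) $ Suc i) - \<phi> (unit_vec (r + 1) (Suc k) $ Suc i)))
      - Matrix.vec r (\<lambda>i. (g $ k * v $ k) * (\<phi> (coord 1 $ Suc i) - \<phi> (unit_vec (r + 1) 0 $ Suc i)))
      = Matrix.vec r (h k)"
      by (intro eq_vecI) (auto simp: h_def)
    finally show ?thesis .
  qed
  then have "Matrix.vec r (\<lambda>i. \<Sum>k<r. h k i) \<in> minor_image"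
    by (intro vec_sum_in_minor_image) auto
  also have "Matrix.vec r (\<lambda>i. \<Sum>k<r. h k i) = coords_frag (Delta_frag g v) - v"
  proof (intro eq_vecI)
    fix i assume "i < dim_vec (coords_frag (Delta_frag g v) - v)"
    then have i: "i < r" using v by simp
    have "(\<Sum>k<r. v $ k * \<phi> (unit_vec (r + 1) (Suc k) $ Suc i)) = (\<Sum>k<r. if k = i then v $ i else 0)"
      using i by (intro sum.cong) auto
    then have 1: "(\<Sum>k<r. v $ k * \<phi> (unit_vec (r + 1) (Suc k) $ Suc i)) = v $ i" using i by simp
    have 2: "h k i = (v $ k * \<phi> (coord (g $ k) $ Suc i) - (g $ k * v $ k) * \<phi> (coord 1 $ Suc i))
        - v $ k * \<phi> (unit_vec (r + 1) (Suc k) $ Suc i)" for k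
      using i by (simp add: h_def right_diff_distrib)
    have "(\<Sum>k<r. h k i) = (\<Sum>k<r. v $ k * \<phi> (coord (g $ k) $ Suc i) - (g $ k * v $ k) * \<phi> (coord 1 $ Suc i)) - v $ i"
      unfolding 2 sum_subtractf[of _ "\<lambda>k. v $ k * \<phi> (unit_vec (r + 1) (Suc k) $ Suc i)"] 1 ..
    then show "Matrix.vec r (\<lambda>i. \<Sum>k<r. h k i) $ i = (coords_frag (Delta_frag g v) - v) $ i"
      using i v g by (simp add: coords_frag_def Delta_frag_def frag_eval_sum frag_eval_diff)
  qed (use v in \<open>simp add: coords_frag_def\<close>)
  finally show ?thesis .
qed

text \<open>
  Moving the entries of \<open>\<Lambda>\<close> across the tensor sign and using the relations given by the columns,
  both halves of the formal sum become \<open>\<Sum>\<^sub>j 1 \<otimes> (-\<Lambda>\<^sub>0\<^sub>j) u\<^sub>j\<close>.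
\<close>

lemma Delta_frag_minor_image:
  assumes u: "u \<in> carrier_vec r"
  shows "Delta_frag g (minor *\<^sub>v u) \<doteq> 0"
proof -
  define v where "v = minor *\<^sub>v u"
  define L where "L = (\<lambda>i j. \<phi> (\<Lambda> $$ (Suc i, Suc j)))"
  have v: "v $ i = (\<Sum>j<r. L i j * u $ j)" if "i < r" for i
    using minor_mult_entry[OF u that] by (simp add: v_def L_def)
  have "(\<Sum>i<r. frag_of (g $ i, v $ i)) \<doteq> (\<Sum>i<r. \<Sum>j<r. frag_of (L i j * g $ i, u $ j))"
  proof (intro equiv_sum)
    fix i assume "i \<in> {..<r}"
    then have "frag_of (g $ i, v $ i) = frag_of (g $ i, \<Sum>j<r. L i j * u $ j)" using v by simp
    also have "\<dots> \<doteq> (\<Sum>j<r. frag_of (g $ i, L i j * u $ j))" by (rule equiv_sum_right) simp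
    also have "\<dots> \<doteq> (\<Sum>j<r. frag_of (L i j * g $ i, u $ j))"
      unfolding L_def by (intro equiv_sum equiv_sym[OF equiv_balanced])
    finally show "frag_of (g $ i, v $ i) \<doteq> (\<Sum>j<r. frag_of (L i j * g $ i, u $ j))" .
  qed
  also have "(\<Sum>i<r. \<Sum>j<r. frag_of (L i j * g $ i, u $ j)) = (\<Sum>j<r. \<Sum>i<r. frag_of (L i j * g $ i, u $ j))"
    by (rule sum.swap)
  also have "\<dots> \<doteq> (\<Sum>j<r. frag_of (\<Sum>i<r. L i j * g $ i, u $ j))"
    by (intro equiv_sum equiv_sym[OF equiv_sum_left]) simp
  also have "\<dots> = (\<Sum>j<r. frag_of (\<phi> (- \<Lambda> $$ (0, Suc j)) * 1, u $ j))"
    using column_relation_Suc by (intro sum.cong) (auto simp: L_def mult.commute hom_uminus)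
  also have "\<dots> \<doteq> (\<Sum>j<r. frag_of (1, \<phi> (- \<Lambda> $$ (0, Suc j)) * u $ j))"
    by (intro equiv_sum equiv_balanced)
  also have "\<dots> = (\<Sum>j<r. frag_of (1, \<Sum>i<r. g $ i * (L i j * u $ j)))"
  proof (intro sum.cong refl)
    fix j assume "j \<in> {..<r}"
    then have "\<phi> (- \<Lambda> $$ (0, Suc j)) * u $ j = (\<Sum>i<r. g $ i * L i j) * u $ j"
      using column_relation_Suc[of "Suc j"] by (simp add: L_def hom_uminus)
    then show "frag_of (1, \<phi> (- \<Lambda> $$ (0, Suc j)) * u $ j) = frag_of (1, \<Sum>i<r. g $ i * (L i j * u $ j))"
      by (simp add: sum_distrib_right mult.assoc)
  qed
  also have "\<dots> \<doteq> frag_of (1, \<Sum>j<r. \<Sum>i<r. g $ i * (L i j * u $ j))"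
    by (rule equiv_sym[OF equiv_sum_right]) simp
  also have "(\<Sum>j<r. \<Sum>i<r. g $ i * (L i j * u $ j)) = (\<Sum>i<r. g $ i * v $ i)"
    by (subst sum.swap) (simp add: v sum_distrib_left)
  also have "frag_of (1, \<Sum>i<r. g $ i * v $ i) \<doteq> (\<Sum>i<r. frag_of (1, g $ i * v $ i))"
    by (rule equiv_sum_right) simp
  finally have "(\<Sum>i<r. frag_of (g $ i, v $ i)) \<doteq> (\<Sum>i<r. frag_of (1, g $ i * v $ i))" .
  then show ?thesis
    using g by (simp add: Delta_frag_def v_def[symmetric] sum_subtractf equiv_def)
qed

text \<open>
  The tensor square is the direct sum of the image of \<open>\<Delta>G\<close> and of \<open>1 \<otimes> S\<close>, and the second
  component is the multiplication map; this gives surjectivity onto its kernel.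
\<close>

lemma frag_decomposition: "c \<doteq> Delta_frag g (coords_frag c) + frag_of (1, mult_frag c)"
proof (induction c rule: frag_induct)
  case zero
  have "coords_frag 0 = 0\<^sub>v r" by (intro eq_vecI) (auto simp: coords_frag_def)
  moreover have "minor *\<^sub>v 0\<^sub>v r = 0\<^sub>v r" using minor_carrier by auto
  ultimately have "Delta_frag g (coords_frag 0) \<doteq> 0"
    using Delta_frag_minor_image[of "0\<^sub>v r"] by simp
  from equiv_add[OF this equiv_zero_right[of 1]]
  show ?case by (simp add: mult_frag_def equiv_sym)
next
  case (of k)
  obtain h b where k: "k = (h, b)" by (cases k)
  define a where "a = (\<lambda>i. \<phi> (coord h $ i))"
  have h: "h = a 0 + (\<Sum>i<r. g $ i * a (Suc i))"
    using coord(2)[of h] by (simp add: eval_gens_Suc a_def)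
  have bal: "frag_of (x * a i, b) \<doteq> frag_of (x, a i * b)" for x i
    using equiv_balanced[of "coord h $ i" x b] by (simp add: a_def mult.commute)
  have "frag_of (h, b) \<doteq> frag_of (a 0, b) + frag_of (\<Sum>i<r. g $ i * a (Suc i), b)"
    by (subst h) (rule equiv_add_left)
  also have "\<dots> \<doteq> frag_of (1, a 0 * b) + (\<Sum>i<r. frag_of (g $ i, a (Suc i) * b))"
    using bal[of 1] by (intro equiv_add equiv_trans[OF equiv_sum_left equiv_sum[OF bal]]) auto
  finally have left: "frag_of (h, b) \<doteq> frag_of (1, a 0 * b) + (\<Sum>i<r. frag_of (g $ i, a (Suc i) * b))" .
  have hb: "h * b = a 0 * b + (\<Sum>i<r. g $ i * (a (Suc i) * b))"
    unfolding h by (simp add: distrib_right sum_distrib_right mult.assoc)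
  have "frag_of (1, h * b) \<doteq> frag_of (1, a 0 * b) + frag_of (1, \<Sum>i<r. g $ i * (a (Suc i) * b))"
    unfolding hb by (rule equiv_add_right)
  also have "\<dots> \<doteq> frag_of (1, a 0 * b) + (\<Sum>i<r. frag_of (1, g $ i * (a (Suc i) * b)))"
    by (intro equiv_add equiv_sum_right) auto
  finally have right: "frag_of (1, h * b) \<doteq> frag_of (1, a 0 * b) + (\<Sum>i<r. frag_of (1, g $ i * (a (Suc i) * b)))" .
  have D: "Delta_frag g (coords_frag (frag_of (h, b))) =
      (\<Sum>i<r. frag_of (g $ i, a (Suc i) * b)) - (\<Sum>i<r. frag_of (1, g $ i * (a (Suc i) * b)))"
    using g by (simp add: Delta_frag_def coords_frag_def a_def sum_subtractf mult.commute)
  have "frag_of (h, b) \<doteq> Delta_frag g (coords_frag (frag_of (h, b))) +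
      (frag_of (1, a 0 * b) + (\<Sum>i<r. frag_of (1, g $ i * (a (Suc i) * b))))"
    using left by (simp add: D algebra_simps)
  also have "\<dots> \<doteq> Delta_frag g (coords_frag (frag_of (h, b))) + frag_of (1, h * b)"
    by (intro equiv_add equiv_refl equiv_sym[OF right])
  finally show ?case by (simp add: k mult_frag_def)
next
  case (diff a b)
  have cb: "coords_frag x \<in> carrier_vec r" for x by (simp add: coords_frag_def)
  have 1: "Delta_frag g (coords_frag a) \<doteq> Delta_frag g (coords_frag (a - b)) + Delta_frag g (coords_frag b)"
  proof -
    have "coords_frag a = coords_frag (a - b) + coords_frag b"
      using cb[of a] cb[of b] unfolding coords_frag_diff by (intro eq_vecI) auto
    then show ?thesis using Delta_frag_add[of "coords_frag (a - b)" g "coords_frag b"] cb g by simp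
  qed
  have 2: "frag_of (1, mult_frag a) \<doteq> frag_of (1, mult_frag (a - b)) + frag_of (1, mult_frag b)"
    using equiv_add_right[of 1 "mult_frag (a - b)" "mult_frag b"] by (simp add: mult_frag_def frag_eval_diff)
  have "a - b \<doteq> (Delta_frag g (coords_frag a) + frag_of (1, mult_frag a)) -
      (Delta_frag g (coords_frag b) + frag_of (1, mult_frag b))"
    by (rule equiv_diff[OF diff])
  also have "\<dots> \<doteq> ((Delta_frag g (coords_frag (a - b)) + Delta_frag g (coords_frag b)) +
      (frag_of (1, mult_frag (a - b)) + frag_of (1, mult_frag b))) -
      (Delta_frag g (coords_frag b) + frag_of (1, mult_frag b))"
    by (intro equiv_diff equiv_add 1 2 equiv_refl)
  finally show ?case by (simp add: algebra_simps)
qed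

text \<open>
  Everything but the injectivity of the minor is formal: its image is the kernel of \<open>\<Delta>G\<close> because
  \<open>coords_frag\<close> inverts \<open>\<Delta>G\<close> modulo this image.
\<close>

theorem exact_if_minor_injective:
  assumes inj: "\<And>v. v \<in> carrier_vec r \<Longrightarrow> minor *\<^sub>v v = 0\<^sub>v r \<Longrightarrow> v = 0\<^sub>v r"
  shows "short_exact_modules class_ring (module_vec TYPE('b) r) (module_vec TYPE('b) r)
    (ker_mult_map \<phi>) (\<lambda>v. minor *\<^sub>v v) (Delta \<phi> g)"
  unfolding short_exact_modules_def
proof (intro conjI)
  show "Module.module class_ring (module_vec TYPE('b) r)" "Module.module class_ring (module_vec TYPE('b) r)"
    by (rule module_module_vec)+
  show "Module.module class_ring (ker_mult_map \<phi>)" by (rule module_ker_mult_map)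
  show "(\<lambda>v. minor *\<^sub>v v) \<in> module_hom class_ring (module_vec TYPE('b) r) (module_vec TYPE('b) r)"
    using minor_carrier mult_add_distrib_mat_vec[OF minor_carrier] minor_smult
    by (auto simp: module_hom_def module_vec_simps)
  show "Delta \<phi> g \<in> module_hom class_ring (module_vec TYPE('b) r) (ker_mult_map \<phi>)"
    by (rule Delta_hom[OF g])
  show "inj_on (\<lambda>v. minor *\<^sub>v v) (carrier (module_vec TYPE('b) r))"
  proof (rule inj_onI)
    fix v w assume vw: "v \<in> carrier (module_vec TYPE('b) r)" "w \<in> carrier (module_vec TYPE('b) r)"
      and eq: "minor *\<^sub>v v = minor *\<^sub>v w"
    have c: "v \<in> carrier_vec r" "w \<in> carrier_vec r" using vw by (auto simp: module_vec_simps)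
    then have "minor *\<^sub>v (v - w) = 0\<^sub>v r"
      using mult_minus_distrib_mat_vec[OF minor_carrier c] eq minor_carrier by auto
    then have 0: "v - w = 0\<^sub>v r" using inj c by simp
    show "v = w"
    proof (rule eq_vecI)
      fix i assume i: "i < dim_vec w"
      then have "(v - w) $ i = 0" using 0 c by simp
      then show "v $ i = w $ i" using i c by simp
    qed (use c in auto)
  qed
  show "(\<lambda>v. minor *\<^sub>v v) ` carrier (module_vec TYPE('b) r) =
      {x \<in> carrier (module_vec TYPE('b) r). Delta \<phi> g x = \<zero>\<^bsub>ker_mult_map \<phi>\<^esub>}"
  proof -
    have "v \<in> minor_image \<longleftrightarrow> Delta_frag g v \<doteq> 0" if v: "v \<in> carrier_vec r" for v
    proof
      assume "v \<in> minor_image"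
      then show "Delta_frag g v \<doteq> 0" using Delta_frag_minor_image by (auto simp: minor_image_def)
    next
      assume "Delta_frag g v \<doteq> 0"
      then have "coords_frag (Delta_frag g v) \<in> minor_image"
        by (intro coords_frag_null) (simp add: equiv_def)
      from minor_image_diff[OF this coords_frag_Delta[OF v]]
      have "coords_frag (Delta_frag g v) - (coords_frag (Delta_frag g v) - v) \<in> minor_image" .
      also have "coords_frag (Delta_frag g v) - (coords_frag (Delta_frag g v) - v) = v"
        using v by (intro eq_vecI) (auto simp: coords_frag_def)
      finally show "v \<in> minor_image" .
    qed
    moreover have "Delta \<phi> g v = \<zero>\<^bsub>ker_mult_map \<phi>\<^esub> \<longleftrightarrow> Delta_frag g v \<doteq> 0" for v
      by (simp add: ker_mult_map_eq tensor_square_zero Delta_eq tensor_class_eq_iff)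
    ultimately show ?thesis
      using minor_image_carrier by (auto simp: module_vec_simps minor_image_def[symmetric])
  qed
  show "Delta \<phi> g ` carrier (module_vec TYPE('b) r) = carrier (ker_mult_map \<phi>)"
  proof
    show "Delta \<phi> g ` carrier (module_vec TYPE('b) r) \<subseteq> carrier (ker_mult_map \<phi>)"
      by (auto simp: ker_mult_map_eq Delta_eq mult_frag_Delta)
    show "carrier (ker_mult_map \<phi>) \<subseteq> Delta \<phi> g ` carrier (module_vec TYPE('b) r)"
    proof
      fix t assume "t \<in> carrier (ker_mult_map \<phi>)"
      then obtain c where c: "mult_frag c = 0" "t = tensor_class \<phi> c" by (auto simp: ker_mult_map_eq)
      have "c \<doteq> Delta_frag g (coords_frag c) + frag_of (1, 0)"
        using frag_decomposition[of c] c(1) by simp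
      also have "\<dots> \<doteq> Delta_frag g (coords_frag c) + 0" by (intro equiv_add equiv_refl equiv_zero_right)
      finally have "t = Delta \<phi> g (coords_frag c)"
        by (simp add: c(2) Delta_eq tensor_class_eq_iff)
      then show "t \<in> Delta \<phi> g ` carrier (module_vec TYPE('b) r)"
        by (simp add: module_vec_simps coords_frag_def)
    qed
  qed
qed

text \<open>
  The first row of \<open>f\<^sup>*\<Lambda>\<close> is a combination of the others, and by symmetry so is the first column;
  hence the equations given by the minor imply the one for the remaining column.
\<close>

lemma minor_kernel_annihilates:
  assumes v: "v \<in> carrier_vec r" and kernel: "minor *\<^sub>v v = 0\<^sub>v r" and k: "k < Suc r"
  shows "(\<Sum>i<Suc r. (case i of 0 \<Rightarrow> 0 | Suc i \<Rightarrow> v $ i) * \<phi> (\<Lambda> $$ (i, k))) = 0"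
proof -
  have shift: "(\<Sum>i<Suc r. (case i of 0 \<Rightarrow> 0 | Suc i \<Rightarrow> v $ i) * \<phi> (\<Lambda> $$ (i, k))) =
      (\<Sum>i<r. v $ i * \<phi> (\<Lambda> $$ (Suc i, k)))"
    by (subst sum.lessThan_Suc_shift) simp
  have entry: "(\<Sum>i<r. v $ i * \<phi> (\<Lambda> $$ (Suc i, Suc l))) = 0" if l: "l < r" for l
  proof -
    have "(\<Sum>i<r. v $ i * \<phi> (\<Lambda> $$ (Suc i, Suc l))) = (\<Sum>i<r. \<phi> (\<Lambda> $$ (Suc l, Suc i)) * v $ i)"
      using l symmetric_entry[of "Suc l"] by (intro sum.cong) (auto simp: mult.commute)
    also have "\<dots> = (minor *\<^sub>v v) $ l" by (simp add: minor_mult_entry[OF v l])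
    finally show ?thesis using l by (simp add: kernel)
  qed
  show ?thesis
  proof (cases k)
    case 0
    have "\<phi> (\<Lambda> $$ (Suc i, 0)) = - (\<Sum>l<r. g $ l * \<phi> (\<Lambda> $$ (Suc l, Suc i)))" if "i < r" for i
      using that column_relation_Suc[of "Suc i"] symmetric_entry[of "Suc i" 0] by simp
    then have "(\<Sum>i<r. v $ i * \<phi> (\<Lambda> $$ (Suc i, k))) =
        - (\<Sum>i<r. \<Sum>l<r. g $ l * (v $ i * \<phi> (\<Lambda> $$ (Suc l, Suc i))))"
      by (simp add: 0 sum_distrib_left sum_negf mult.left_commute)
    also have "(\<Sum>i<r. \<Sum>l<r. g $ l * (v $ i * \<phi> (\<Lambda> $$ (Suc l, Suc i)))) =
        (\<Sum>l<r. g $ l * (\<Sum>i<r. v $ i * \<phi> (\<Lambda> $$ (Suc l, Suc i))))"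
      by (subst sum.swap) (simp add: sum_distrib_left)
    also have "\<dots> = 0"
      using entry symmetric_entry by (intro sum.neutral) (simp add: mult.commute)
    finally show ?thesis using shift by simp
  next
    case (Suc l)
    then show ?thesis using shift entry k by simp
  qed
qed

end

section \<open>The exact sequence\<close>

theorem proposition4p1:
  fixes f :: "complex^'n \<Rightarrow> complex^'m"
    and r :: nat
    and \<Lambda> :: "'m germ Matrix.mat"
    and g :: "'n germ Matrix.vec"
  assumes "CARD('m) = CARD('n) + 1"
    and "holo_map_germ f"
    and "finite_map_germ f"
    and "generically_one_to_one f"
    and "\<Lambda> \<in> carrier_mat (r + 1) (r + 1)"
    and "g \<in> carrier_vec r"
    and "transpose_mat \<Lambda> = \<Lambda>"
    and "short_exact_modules (class_ring :: 'm germ ring)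
           (module_vec TYPE('m germ) (r + 1)) (module_vec TYPE('m germ) (r + 1))
           (restr_module (germ_pullback f))
           (\<lambda>v. \<Lambda> *\<^sub>v v)
           (\<lambda>v. scalar_prod (vCons 1 g) (map_vec (germ_pullback f) v))"
  shows "short_exact_modules (class_ring :: 'n germ ring)
           (module_vec TYPE('n germ) r) (module_vec TYPE('n germ) r)
           (ker_mult_map (germ_pullback f))
           (\<lambda>v. map_mat (germ_pullback f) (mat_delete \<Lambda> 0 0) *\<^sub>v v)
           (Delta (germ_pullback f) g)"
proof -
  have f: "holo_map_germ f" by fact
  interpret symmetric_presentation "germ_pullback f" \<Lambda> g r
    by (intro symmetric_presentation.intro ring_extension.intro symmetric_presentation_axioms.intro
        comm_ring_hom_pullback assms)
  interpret germs: germ_presentation f "Suc r" "\<lambda>i k. \<Lambda> $$ (i, k)" gen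
  proof
    show "\<exists>a. (\<Sum>i<Suc r. gen i * germ_pullback f (a i)) = h" for h
    proof -
      obtain a where "eval_gens a = h" using eval_gens_surj by blast
      then show ?thesis unfolding eval_gens_def by blast
    qed
    show "\<exists>b. \<forall>i<Suc r. a i = (\<Sum>k<Suc r. \<Lambda> $$ (i, k) * b k)"
      if rel: "(\<Sum>i<Suc r. gen i * germ_pullback f (a i)) = 0" for a
    proof -
      have "eval_gens (Matrix.vec (Suc r) a) = (\<Sum>i<Suc r. gen i * germ_pullback f (a i))"
        unfolding eval_gens_def by (intro sum.cong) auto
      then obtain b where b: "b \<in> carrier_vec (r + 1)" "Matrix.vec (Suc r) a = \<Lambda> *\<^sub>v b"
        using eval_gens_eq_0_iff[of "Matrix.vec (Suc r) a"] rel by auto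
      have "a i = (\<Sum>k<Suc r. \<Lambda> $$ (i, k) * b $ k)" if "i < Suc r" for i
      proof -
        have "a i = Matrix.vec (Suc r) a $ i" using that by simp
        also have "\<dots> = (\<Sum>k<Suc r. \<Lambda> $$ (i, k) * b $ k)"
          unfolding b(2) using \<Lambda> b(1) that
          by (auto simp: scalar_prod_def atLeast0LessThan simp del: sum.lessThan_Suc intro!: sum.cong)
        finally show ?thesis .
      qed
      then show ?thesis by blast
    qed
    show "(\<Sum>i<Suc r. gen i * germ_pullback f (\<Lambda> $$ (i, k))) = 0" if "k < Suc r" for k
      using column_relation[of k] that by simp
  qed (use f in simp_all)
  have "v = 0\<^sub>v r" if v: "v \<in> carrier_vec r" "minor *\<^sub>v v = 0\<^sub>v r" for v
  proof (rule eq_vecI)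
    fix i assume "i < dim_vec (0\<^sub>v r :: 'n germ Matrix.vec)"
    then have i: "i < r" by simp
    define w where "w = (\<lambda>i. case i of 0 \<Rightarrow> 0 | Suc i \<Rightarrow> v $ i)"
    have "w (Suc i) = 0"
    proof (rule germs.form_vanishes[OF assms(4)])
      show "w 0 = 0" by (simp add: w_def)
      show "(\<Sum>i<Suc r. w i * germ_pullback f (\<Lambda> $$ (i, k))) = 0" if "k < Suc r" for k
        unfolding w_def by (rule minor_kernel_annihilates[OF v that])
    qed (use i in simp)
    then show "v $ i = 0\<^sub>v r $ i" using i by (simp add: w_def)
  qed (use v in simp)
  from exact_if_minor_injective[OF this] show ?thesis by (simp add: minor_def)
qed

end
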